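(* Let $\psi$ and $\varphi$ be pure entangled states on finite dimensional bipartite quantum systems, with distributions of squared Schmidt coefficients $P_\psi,P_\varphi$. For $0<s_1\le S_\psi$ and $\nu\in(0,1)$, $$\mathcal R^{2,\mathcal Q}_{\psi,\varphi}\Big(s_1,\frac{s_1}{S_\varphi},\nu\Big)=\mathcal R^{2,\mathcal M}_{P_\psi,P_\varphi}\Big(s_1,\frac{s_1}{H(P_\varphi)},\nu\Big).$$
   Context: All logarithms are to base $2$. $H$ is the Shannon entropy; $S_\psi$ is the von Neumann entropy of the partial (reduced) density matrix of $\psi$. $\mathcal S(\mathcal H)$ is the set of density operators on $\mathcal H$. LOCC means local operations and classical communication between the two parties of a bipartite system. $F(\rho,\sigma)=\mathrm{Tr}\,|\sqrt\rho\sqrt\sigma|$ is the quantum fidelity. For real $N\ge0$, an entanglement storage of size $N$ is the bipartite system $\mathbb C^K\otimes\mathbb C^K$ with $K=\lfloor2^N\rfloor$ (for integer $N$ this is $(\mathbb C^2\otimes\mathbb C^2)^{\otimes N}$). For $\psi$ on $\mathcal H$ and $\varphi$ on $\mathcal H'$, $$F^{\mathcal Q}(\psi\to\varphi|N)=\sup\{F(\Gamma'\circ\Gamma(\psi),\varphi)\},$$ the supremum over LOCC maps $\Gamma:\mathcal S(\mathcal H)\to\mathcal S(\mathbb C^K\otimes\mathbb C^K)$ and $\Gamma':\mathcal S(\mathbb C^K\otimes\mathbb C^K)\to\mathcal S(\mathcal H')$. For probability distributions $P,Q$ on finite sets $\mathcal X,\mathcal Y$: $F(Q,Q')=\sum_y\sqrt{Q(y)Q'(y)}$;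 $P^\downarrow_i$ is the $i$-th largest value of $P$ ($0$ beyond the size); $P\prec Q$ means $\sum_{i\le l}P^\downarrow_i\le\sum_{i\le l}Q^\downarrow_i$ for all $l$; with $K_N$ a set of $\lfloor 2^N\rfloor$ elements and $\mathcal P(\cdot)$ the set of distributions, $F^{\mathcal M}(P\to Q|N)=\sup\{F(P'',Q)\mid P''\in\mathcal P(\mathcal Y),\ \exists P'\in\mathcal P(K_N):\ P\prec P'\prec P''\}$. $\mathcal R^{2,\mathcal Q}_{\psi,\varphi}(s_1,t_1,\nu)$ (resp. $\mathcal R^{2,\mathcal M}_{P,Q}(s_1,t_1,\nu)$) is the set of $(s_2,t_2)\in\mathbb R^2$ for which there exist $S_n=s_1n+s_2\sqrt n+o(\sqrt n)$ (reals) and $T_n=t_1n+t_2\sqrt n+o(\sqrt n)$ (integers) with $\liminf_{n\to\infty}F^{\mathcal Q}(\psi^{\otimes n}\to\varphi^{\otimes T_n}|S_n)\ge\nu$ (resp. $\liminf_{n\to\infty}F^{\mathcal M}(P^n\to Q^{T_n}|S_n)\ge\nu$), where $P^n$ is the $n$-fold i.i.d. product; only large $n$ matter. *)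

theory Defs
  imports
    "HOL-Probability.Probability"
    "HOL-Library.Landau_Symbols"
    "Jordan_Normal_Form.Schur_Decomposition"
begin

unbundle no vec_syntax

section \<open>Matrices\<close>

definition mat_trace :: "complex mat \<Rightarrow> complex" where
  "mat_trace A = (\<Sum>i<dim_row A. A $$ (i, i))"

definition mat_sum :: "nat \<Rightarrow> nat \<Rightarrow> (nat \<Rightarrow> complex mat) \<Rightarrow> complex mat" where
  "mat_sum d m f = mat d d (\<lambda>ij. \<Sum>k<m. f k $$ ij)"

text \<open>The basis vector $e_i \otimes e_j$ of a tensor product has index
  \<open>i * d + j\<close>, where \<open>d\<close> is the dimension of the second factor.\<close>

definition kron :: "complex mat \<Rightarrow> complex mat \<Rightarrow> complex mat" where
  "kron A B = mat (dim_row A * dim_row B) (dim_col A * dim_col B)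
     (\<lambda>(i, j). A $$ (i div dim_row B, j div dim_col B) * B $$ (i mod dim_row B, j mod dim_col B))"

primrec kron_pow :: "complex mat \<Rightarrow> nat \<Rightarrow> complex mat" where
  "kron_pow A 0 = 1\<^sub>m 1"
| "kron_pow A (Suc n) = kron A (kron_pow A n)"

text \<open>The inequality is in the order on \<^typ>\<open>complex\<close>: the left-hand side of $\ge$ is real
  and nonnegative.\<close>

definition psd :: "complex mat \<Rightarrow> bool" where
  "psd A \<longleftrightarrow> dim_row A = dim_col A \<and> (\<forall>v \<in> carrier_vec (dim_row A). (A *\<^sub>v v) \<bullet>c v \<ge> 0)"

definition mat_sqrt :: "complex mat \<Rightarrow> complex mat" where
  "mat_sqrt A = (THE B. B \<in> carrier_mat (dim_row A) (dim_row A) \<and> psd B \<and> B * B = A)"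

definition mat_abs :: "complex mat \<Rightarrow> complex mat" where
  "mat_abs A = mat_sqrt (mat_adjoint A * A)"

definition fidelity :: "complex mat \<Rightarrow> complex mat \<Rightarrow> real" where
  "fidelity \<rho> \<sigma> = Re (mat_trace (mat_abs (mat_sqrt \<rho> * mat_sqrt \<sigma>)))"

text \<open>The spectral form of $-\mathrm{Tr}\,\rho\log_2\rho$, eigenvalues counted with
  multiplicity; the library's \<open>log 2 0 = 0\<close> gives the convention $0\log 0=0$.\<close>

definition von_neumann_entropy :: "complex mat \<Rightarrow> real" where
  "von_neumann_entropy \<rho> =
     - (\<Sum>x | eigenvalue \<rho> x. real (Polynomial.order x (char_poly \<rho>)) * (Re x * log 2 (Re x)))"


section \<open>Bipartite pure states\<close>

text \<open>A vector $\sum_{i,j} C_{ij}\, e_i\otimes e_j$ of $\mathbb C^{d_A}\otimes\mathbb C^{d_B}$ is given by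
  its $d_A\times d_B$ coefficient matrix \<open>C\<close>, so that the dimensions of both parties can be read
  off from \<open>C\<close>. With this encoding \<open>kron_pow C n\<close> is the $n$-fold tensor power, with
  the $n$ systems of each party grouped together.\<close>

definition state_vec :: "complex mat \<Rightarrow> complex vec" where
  "state_vec C = vec (dim_row C * dim_col C) (\<lambda>k. C $$ (k div dim_col C, k mod dim_col C))"

definition pure_state :: "complex mat \<Rightarrow> bool" where
  "pure_state C \<longleftrightarrow> state_vec C \<bullet>c state_vec C = 1"

definition entangled :: "complex mat \<Rightarrow> bool" where
  "entangled C \<longleftrightarrow> \<not> (\<exists>a \<in> carrier_vec (dim_row C). \<exists>b \<in> carrier_vec (dim_col C).
     \<forall>i<dim_row C. \<forall>j<dim_col C. C $$ (i, j) = a $ i * b $ j)"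

definition density :: "complex mat \<Rightarrow> complex mat" where
  "density C = (let v = state_vec C in mat (dim_vec v) (dim_vec v) (\<lambda>(k, l). v $ k * cnj (v $ l)))"

definition partial_trace_B :: "nat \<Rightarrow> nat \<Rightarrow> complex mat \<Rightarrow> complex mat" where
  "partial_trace_B dA dB \<rho> = mat dA dA (\<lambda>(i, k). \<Sum>j<dB. \<rho> $$ (i * dB + j, k * dB + j))"

definition entanglement_entropy :: "complex mat \<Rightarrow> real" where
  "entanglement_entropy C =
     von_neumann_entropy (partial_trace_B (dim_row C) (dim_col C) (density C))"

definition orthonormal_family :: "nat \<Rightarrow> nat \<Rightarrow> (nat \<Rightarrow> complex vec) \<Rightarrow> bool" where
  "orthonormal_family d r u \<longleftrightarrow> (\<forall>k<r. u k \<in> carrier_vec d) \<and>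
     (\<forall>k<r. \<forall>l<r. u k \<bullet>c u l = (if k = l then 1 else 0))"

text \<open>\<open>P\<close> is the distribution, on \<open>{..<r}\<close>, of the squared coefficients of a Schmidt
  decomposition $\sum_{k<r}\sqrt{P(k)}\,u_k\otimes v_k$ of the state. Vanishing coefficients are
  permitted, so \<open>r\<close> may be any number from the Schmidt rank up to $\min(d_A,d_B)$.\<close>

definition schmidt_distribution :: "complex mat \<Rightarrow> nat \<Rightarrow> nat pmf \<Rightarrow> bool" where
  "schmidt_distribution C r P \<longleftrightarrow> set_pmf P \<subseteq> {..<r} \<and>
     (\<exists>u v. orthonormal_family (dim_row C) r u \<and> orthonormal_family (dim_col C) r v \<and>
        (\<forall>i<dim_row C. \<forall>j<dim_col C.
           C $$ (i, j) = (\<Sum>k<r. complex_of_real (sqrt (pmf P k)) * u k $ i * v k $ j)))"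


section \<open>LOCC\<close>

text \<open>\<open>locc dA dB eA eB E\<close>: the map \<open>E\<close> from operators on
  $\mathbb C^{d_A}\otimes\mathbb C^{d_B}$ to operators on $\mathbb C^{e_A}\otimes\mathbb C^{e_B}$ is
  realised by a protocol with finitely many rounds. In each round one party performs a
  measurement with Kraus operators \<open>K i\<close>, \<open>i < m\<close>, and announces the
  outcome \<open>i\<close>, on which the rest of the protocol may depend; the output dimension
  \<open>d i\<close> may depend on \<open>i\<close> as well. The final sum forgets the record of outcomes.
  One Kraus operator per outcome is no restriction: an instrument with several Kraus operators
  per outcome is obtained by continuing in the same way after each of them, so all
  local channels (including discarding a subsystem) and shared randomness are covered.\<close>

inductive locc :: "nat \<Rightarrow> nat \<Rightarrow> nat \<Rightarrow> nat \<Rightarrow> (complex mat \<Rightarrow> complex mat) \<Rightarrow> bool" where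
  stop: "locc eA eB eA eB (\<lambda>\<rho>. \<rho>)"
| alice: "locc dA dB eA eB
     (\<lambda>\<rho>. mat_sum (eA * eB) m
        (\<lambda>i. E i (kron (K i) (1\<^sub>m dB) * \<rho> * mat_adjoint (kron (K i) (1\<^sub>m dB)))))"
  if "\<And>i. i < m \<Longrightarrow> K i \<in> carrier_mat (d i) dA"
    and "mat_sum dA m (\<lambda>i. mat_adjoint (K i) * K i) = 1\<^sub>m dA"
    and "\<And>i. i < m \<Longrightarrow> locc (d i) dB eA eB (E i)"
| bob: "locc dA dB eA eB
     (\<lambda>\<rho>. mat_sum (eA * eB) m
        (\<lambda>i. E i (kron (1\<^sub>m dA) (K i) * \<rho> * mat_adjoint (kron (1\<^sub>m dA) (K i)))))"
  if "\<And>i. i < m \<Longrightarrow> K i \<in> carrier_mat (d i) dB"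
    and "mat_sum dB m (\<lambda>i. mat_adjoint (K i) * K i) = 1\<^sub>m dB"
    and "\<And>i. i < m \<Longrightarrow> locc dA (d i) eA eB (E i)"

definition storage_dim :: "real \<Rightarrow> nat" where
  "storage_dim N = nat \<lfloor>2 powr N\<rfloor>"

definition FQ :: "complex mat \<Rightarrow> complex mat \<Rightarrow> real \<Rightarrow> real" where
  "FQ \<psi> \<phi> N = Sup {fidelity (\<Gamma>' (\<Gamma> (density \<psi>))) (density \<phi>) | \<Gamma> \<Gamma>'.
     locc (dim_row \<psi>) (dim_col \<psi>) (storage_dim N) (storage_dim N) \<Gamma> \<and>
     locc (storage_dim N) (storage_dim N) (dim_row \<phi>) (dim_col \<phi>) \<Gamma>'}"


section \<open>Majorization\<close>

definition shannon_entropy :: "'a pmf \<Rightarrow> real" where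
  "shannon_entropy P = - (\<Sum>x\<in>set_pmf P. pmf P x * log 2 (pmf P x))"

text \<open>For finitely supported \<open>P\<close>; indices start at 0. Zero values need not be listed, since
  the sequence is continued by 0 anyway.\<close>

definition decr_prob :: "'a pmf \<Rightarrow> nat \<Rightarrow> real" where
  "decr_prob P i =
     (let ps = rev (sorted_list_of_multiset (image_mset (pmf P) (mset_set (set_pmf P))))
      in if i < length ps then ps ! i else 0)"

definition majorized :: "'a pmf \<Rightarrow> 'b pmf \<Rightarrow> bool" (infix \<open>\<prec>\<^sub>m\<close> 50) where
  "P \<prec>\<^sub>m Q \<longleftrightarrow> (\<forall>l. (\<Sum>i<l. decr_prob P i) \<le> (\<Sum>i<l. decr_prob Q i))"

text \<open>A distribution on a finite set \<open>Y\<close> is a \<^typ>\<open>'y pmf\<close> with support in \<open>Y\<close>.\<close>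

definition classical_fidelity :: "'y set \<Rightarrow> 'y pmf \<Rightarrow> 'y pmf \<Rightarrow> real" where
  "classical_fidelity Y Q Q' = (\<Sum>y\<in>Y. sqrt (pmf Q y * pmf Q' y))"

definition FM :: "'x pmf \<Rightarrow> 'y set \<Rightarrow> 'y pmf \<Rightarrow> real \<Rightarrow> real" where
  "FM P Y Q N = Sup {classical_fidelity Y P'' Q | P''. set_pmf P'' \<subseteq> Y \<and>
     (\<exists>P' :: nat pmf. set_pmf P' \<subseteq> {..<storage_dim N} \<and> P \<prec>\<^sub>m P' \<and> P' \<prec>\<^sub>m P'')}"


section \<open>Second-order rate regions\<close>

definition second_order_expansion :: "(nat \<Rightarrow> real) \<Rightarrow> real \<Rightarrow> real \<Rightarrow> bool" where
  "second_order_expansion a c1 c2 \<longleftrightarrow>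
     (\<lambda>n. a n - (c1 * real n + c2 * sqrt (real n))) \<in> o(\<lambda>n. sqrt (real n))"

text \<open>Neither \<open>nat\<close>, which cuts off negative \<open>T n\<close>, nor the value of the suprema
  for negative storage sizes matters when $s_1,t_1>0$: only finitely many \<open>n\<close> are affected.\<close>

definition R2Q :: "complex mat \<Rightarrow> complex mat \<Rightarrow> real \<Rightarrow> real \<Rightarrow> real \<Rightarrow> (real \<times> real) set" where
  "R2Q \<psi> \<phi> s1 t1 \<nu> = {(s2, t2). \<exists>(S :: nat \<Rightarrow> real) (T :: nat \<Rightarrow> int).
     second_order_expansion S s1 s2 \<and>
     second_order_expansion (\<lambda>n. real_of_int (T n)) t1 t2 \<and>
     liminf (\<lambda>n. ereal (FQ (kron_pow \<psi> n) (kron_pow \<phi> (nat (T n))) (S n))) \<ge> ereal \<nu>}"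

text \<open>The $n$-fold product of a distribution on \<open>Y\<close> is a distribution on the lists of length
  \<open>n\<close> over \<open>Y\<close>.\<close>

definition R2M :: "'x pmf \<Rightarrow> 'y set \<Rightarrow> 'y pmf \<Rightarrow> real \<Rightarrow> real \<Rightarrow> real \<Rightarrow> (real \<times> real) set" where
  "R2M P Y Q s1 t1 \<nu> = {(s2, t2). \<exists>(S :: nat \<Rightarrow> real) (T :: nat \<Rightarrow> int).
     second_order_expansion S s1 s2 \<and>
     second_order_expansion (\<lambda>n. real_of_int (T n)) t1 t2 \<and>
     liminf (\<lambda>n. ereal (FM (replicate_pmf n P)
        {ys. set ys \<subseteq> Y \<and> length ys = nat (T n)} (replicate_pmf (nat (T n)) Q) (S n))) \<ge> ereal \<nu>}"

end

theory Submission
  imports Defs "HOL-Combinatorics.Permutations"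
begin

text \<open>For every storage size the two fidelities agree exactly:
  $F^{\mathcal Q}(\psi\to\varphi|N) = F^{\mathcal M}(P_\psi\to P_\varphi|N)$, so the two regions
  are given by the same condition once $S_\varphi = H(P_\varphi)$ is known.

  $\le$: an LOCC map turns a pure state into a mixture of pure states whose averaged decreasing
  squared Schmidt coefficients majorize those of the input: each measurement step preserves
  the norm of the vectors $C x$, where $C$ is the coefficient matrix, and Ky Fan's principle
  expresses partial sums of the coefficients through such norms. For the maps into and out of the
  storage this gives
  $P \prec P' \prec P''$. By von Neumann's trace inequality the squared overlap of each pure
  component with $\varphi$ is at most the squared classical fidelity of the coefficients, which is
  concave.

  $\ge$: by Nielsen's theorem $\psi$ can be transformed into a state with Schmidt distribution
  $P'$, and this one into a state with Schmidt distribution $P''$ in the Schmidt bases of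
  $\varphi$.\<close>

section \<open>Orthonormal families\<close>

text \<open>The converse bound works with unnormalized branches: the weight of a branch is its
  squared norm, so averages over outcomes are plain sums and no branch of probability zero has to be
  excluded. The averages are taken over coefficient sequences that are already decreasing, and a sum
  of such sequences is again decreasing. Hence the averages are themselves the decreasing
  rearrangements of \<open>P'\<close> and \<open>P''\<close>, and the bound \<open>K\<close> on the
  number of coefficients of every storage state carries over to \<open>P'\<close>. One obstacle
  remains: a final branch can have more Schmidt coefficients than the index set \<open>J\<close> of
  the target offers. The surplus mass of the average is moved onto its largest entry, which keeps
  the order, raises the partial sums and does not lower the fidelity.

  A Schmidt family need not be a basis, and it is never completed to one: Bessel's inequality takes
  the place of Parseval's identity, a substochastic matrix that of a doubly stochastic one, and
  Kraus operators are completed by a measurement of the orthogonal complement.\<close>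

definition ip :: "nat \<Rightarrow> (nat \<Rightarrow> complex) \<Rightarrow> (nat \<Rightarrow> complex) \<Rightarrow> complex" where
  "ip d x y = (\<Sum>i<d. x i * cnj (y i))"

definition nsq :: "nat \<Rightarrow> (nat \<Rightarrow> complex) \<Rightarrow> real" where
  "nsq d x = (\<Sum>i<d. (cmod (x i))\<^sup>2)"

text \<open>Vectors of length \<open>d\<close> are functions whose values from \<open>d\<close> on
  are ignored. The index type is free, so that tensor powers can be indexed by lists.\<close>

definition ortho :: "nat \<Rightarrow> 'k set \<Rightarrow> ('k \<Rightarrow> nat \<Rightarrow> complex) \<Rightarrow> bool" where
  "ortho d I u \<longleftrightarrow> (\<forall>k\<in>I. \<forall>l\<in>I. ip d (u k) (u l) = (if k = l then 1 else 0))"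

lemma orthoD: "ortho d I u \<Longrightarrow> k \<in> I \<Longrightarrow> l \<in> I \<Longrightarrow> ip d (u k) (u l) = (if k = l then 1 else 0)"
  by (auto simp: ortho_def)

lemma ortho_subset: "ortho d I u \<Longrightarrow> J \<subseteq> I \<Longrightarrow> ortho d J u"
  unfolding ortho_def by blast

lemma ortho_reindex: "ortho d I u \<Longrightarrow> inj_on g J \<Longrightarrow> g ` J \<subseteq> I \<Longrightarrow> ortho d J (\<lambda>k. u (g k))"
  by (auto simp: ortho_def inj_on_def image_subset_iff)

lemma ip_sum_left: "ip d (\<lambda>i. \<Sum>k\<in>I. a k * u k i) y = (\<Sum>k\<in>I. a k * ip d (u k) y)"
  unfolding ip_def sum_distrib_left sum_distrib_right
  by (subst sum.swap) (simp add: mult_ac)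

lemma ip_sum_right: "ip d y (\<lambda>i. \<Sum>k\<in>I. a k * u k i) = (\<Sum>k\<in>I. cnj (a k) * ip d y (u k))"
  unfolding ip_def sum_distrib_left sum_distrib_right cnj_sum
  by (subst sum.swap) (simp add: mult_ac)

lemma ip_commute: "ip d x y = cnj (ip d y x)"
  by (simp add: ip_def cnj_sum mult.commute)

lemma ip_cnj: "ip d (\<lambda>i. cnj (x i)) (\<lambda>i. cnj (y i)) = cnj (ip d x y)"
  by (simp add: ip_def cnj_sum)

lemma ip_self: "ip d x x = of_real (nsq d x)"
  by (simp add: ip_def nsq_def flip: complex_norm_square)

lemma nsq_nonneg: "0 \<le> nsq d x"
  by (simp add: nsq_def sum_nonneg)

lemma nsq_0_iff: "nsq d x = 0 \<longleftrightarrow> (\<forall>i<d. x i = 0)"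
  by (auto simp: nsq_def sum_nonneg_eq_0_iff)

lemma ip_scale_left: "ip d (\<lambda>i. c * x i) y = c * ip d x y"
  by (simp add: ip_def sum_distrib_left mult_ac)

lemma ip_scale_right: "ip d x (\<lambda>i. c * y i) = cnj c * ip d x y"
  by (simp add: ip_def sum_distrib_left mult_ac)

lemma nsq_scale: "nsq d (\<lambda>i. c * x i) = (cmod c)\<^sup>2 * nsq d x"
  by (simp add: nsq_def sum_distrib_left norm_mult power_mult_distrib)

lemma ortho_cnj: "ortho d I u \<Longrightarrow> ortho d I (\<lambda>k i. cnj (u k i))"
  by (simp add: ortho_def ip_cnj)

lemma ortho_nsq: "ortho d I u \<Longrightarrow> k \<in> I \<Longrightarrow> nsq d (u k) = 1"
  using ip_self[of d "u k"] by (simp add: ortho_def)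

lemma ip_ortho_sum:
  assumes "ortho d I u" "finite I" "k \<in> I"
  shows "ip d (\<lambda>i. \<Sum>l\<in>I. a l * u l i) (u k) = a k"
proof -
  have "ip d (\<lambda>i. \<Sum>l\<in>I. a l * u l i) (u k) = (\<Sum>l\<in>I. if l = k then a l else 0)"
    unfolding ip_sum_left by (intro sum.cong refl) (simp add: orthoD[OF assms(1) _ assms(3)])
  then show ?thesis using assms by simp
qed

lemma nsq_ortho_sum:
  assumes "ortho d I u" "finite I"
  shows "nsq d (\<lambda>i. \<Sum>k\<in>I. a k * u k i) = (\<Sum>k\<in>I. (cmod (a k))\<^sup>2)"
proof -
  have "complex_of_real (nsq d (\<lambda>i. \<Sum>k\<in>I. a k * u k i)) = (\<Sum>k\<in>I. cnj (a k) * a k)"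
    unfolding ip_self[symmetric] ip_sum_right
    by (intro sum.cong refl) (simp add: ip_ortho_sum[OF assms])
  also have "\<dots> = of_real (\<Sum>k\<in>I. (cmod (a k))\<^sup>2)"
    by (simp add: mult.commute flip: complex_norm_square)
  finally show ?thesis by (simp only: of_real_eq_iff)
qed

lemma nsq_diff: "nsq d (\<lambda>i. x i - y i) = nsq d x - 2 * Re (ip d x y) + nsq d y"
proof -
  have "(cmod (a - b))\<^sup>2 = (cmod a)\<^sup>2 - 2 * Re (a * cnj b) + (cmod b)\<^sup>2" for a b
    by (simp add: cmod_power2) (simp add: power2_eq_square algebra_simps)
  then show ?thesis
    by (simp add: nsq_def ip_def sum.distrib sum_subtractf sum_distrib_left)
qed

lemma projection_residual:
  assumes "ortho d I u" "finite I"
  shows "nsq d (\<lambda>i. x i - (\<Sum>k\<in>I. ip d x (u k) * u k i)) = nsq d x - (\<Sum>k\<in>I. (cmod (ip d x (u k)))\<^sup>2)"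
proof -
  have "ip d x (\<lambda>i. \<Sum>k\<in>I. ip d x (u k) * u k i) = of_real (\<Sum>k\<in>I. (cmod (ip d x (u k)))\<^sup>2)"
    unfolding ip_sum_right by (simp add: mult.commute flip: complex_norm_square)
  then show ?thesis
    unfolding nsq_diff nsq_ortho_sum[OF assms] by simp
qed

lemma bessel:
  assumes "ortho d I u" "finite I"
  shows "(\<Sum>k\<in>I. (cmod (ip d x (u k)))\<^sup>2) \<le> nsq d x"
  using projection_residual[OF assms, of x] nsq_nonneg[of d "\<lambda>i. x i - (\<Sum>k\<in>I. ip d x (u k) * u k i)"]
  by simp

lemma ip_unit: "i < d \<Longrightarrow> ip d (\<lambda>j. if j = i then 1 else 0) y = cnj (y i)"
  by (simp add: ip_def if_distribR if_distrib[where f="\<lambda>z. z * _"] cong: if_cong)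

lemma nsq_unit: "i < d \<Longrightarrow> nsq d (\<lambda>j. if j = i then 1 else 0) = 1"
  by (simp add: nsq_def if_distrib[where f="\<lambda>z. (cmod z)\<^sup>2"] cong: if_cong)

text \<open>The trace of the projection onto the span: it equals \<open>card I\<close>, and Bessel's
  inequality at the \<open>d\<close> standard basis vectors bounds it by \<open>d\<close>.\<close>

lemma ortho_card_le:
  assumes "ortho d I u" "finite I"
  shows "card I \<le> d"
proof -
  have "real (card I) = (\<Sum>k\<in>I. nsq d (u k))"
    using ortho_nsq[OF assms(1)] by simp
  also have "\<dots> = (\<Sum>i<d. \<Sum>k\<in>I. (cmod (ip d (\<lambda>j. if j = i then 1 else 0) (u k)))\<^sup>2)"
    unfolding nsq_def by (subst sum.swap) (simp add: ip_unit)
  also have "\<dots> \<le> (\<Sum>i<d. nsq d (\<lambda>j. if j = i then 1 else 0))"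
    by (intro sum_mono bessel assms)
  also have "\<dots> = real d" by (simp add: nsq_unit)
  finally show ?thesis by simp
qed

text \<open>Completeness by counting. The Bessel defects of the \<open>d\<close> standard basis
  vectors are nonnegative and sum to \<open>d - card I = 0\<close>, so each of these vectors is its
  own projection; the expansion of \<open>x\<close> follows by linearity.\<close>

lemma ortho_expand:
  assumes "ortho d I u" "finite I" "card I = d" "i < d"
  shows "x i = (\<Sum>k\<in>I. ip d x (u k) * u k i)"
proof -
  have *: "(\<Sum>k\<in>I. (cmod (ip d (\<lambda>j. if j = i then 1 else 0) (u k)))\<^sup>2) = 1" if "i < d" for i
  proof -
    have "(\<Sum>i<d. 1 - (\<Sum>k\<in>I. (cmod (ip d (\<lambda>j. if j = i then 1 else 0) (u k)))\<^sup>2))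
      = real d - (\<Sum>k\<in>I. nsq d (u k))"
    proof -
      have "(\<Sum>k\<in>I. nsq d (u k)) = (\<Sum>i<d. \<Sum>k\<in>I. (cmod (ip d (\<lambda>j. if j = i then 1 else 0) (u k)))\<^sup>2)"
        unfolding nsq_def by (subst sum.swap) (simp add: ip_unit)
      then show ?thesis by (simp add: sum_subtractf)
    qed
    also have "\<dots> = 0" using ortho_nsq[OF assms(1)] assms(3) by simp
    finally show ?thesis
      using that bessel[OF assms(1,2)] 
      by (subst (asm) sum_nonneg_eq_0_iff) (auto simp: nsq_unit, (metis nsq_unit)+)
  qed
  have delta: "(\<Sum>k\<in>I. cnj (u k j) * u k i) = (if i = j then 1 else 0)" if "j < d" for j
  proof -
    have "nsq d (\<lambda>i. (if i = j then 1 else 0) - (\<Sum>k\<in>I. ip d (\<lambda>l. if l = j then 1 else 0) (u k) * u k i)) = 0"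
      using projection_residual[OF assms(1,2), of "\<lambda>l. if l = j then 1 else 0"] *[OF that] that
      by (simp add: nsq_unit)
    then show ?thesis using that assms(4) unfolding nsq_0_iff
      by (auto simp: ip_unit)
  qed
  have "(\<Sum>k\<in>I. ip d x (u k) * u k i) = (\<Sum>j<d. x j * (\<Sum>k\<in>I. cnj (u k j) * u k i))"
    unfolding ip_def sum_distrib_left sum_distrib_right by (subst sum.swap) (simp add: mult_ac)
  also have "\<dots> = (\<Sum>j<d. if i = j then x j else 0)"
    by (intro sum.cong refl) (simp add: delta)
  finally show ?thesis using assms(4) by simp
qed

lemma parseval:
  assumes "ortho d I u" "finite I" "card I = d"
  shows "(\<Sum>k\<in>I. (cmod (ip d x (u k)))\<^sup>2) = nsq d x"
proof -
  have "nsq d x = nsq d (\<lambda>i. \<Sum>k\<in>I. ip d x (u k) * u k i)"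
    unfolding nsq_def using ortho_expand[OF assms] by (intro sum.cong refl) simp
  then show ?thesis unfolding nsq_ortho_sum[OF assms(1,2)] by simp
qed

lemma ortho_delta:
  assumes "ortho d I u" "finite I" "card I = d" "i < d" "j < d"
  shows "(\<Sum>k\<in>I. u k i * cnj (u k j)) = (if i = j then 1 else 0)"
  using ortho_expand[OF assms(1-4), of "\<lambda>l. if l = j then 1 else 0"] assms(5)
  by (simp add: ip_unit mult.commute)

section \<open>Matrices acting on coordinate functions\<close>

definition app :: "complex mat \<Rightarrow> (nat \<Rightarrow> complex) \<Rightarrow> nat \<Rightarrow> complex" where
  "app A x i = (\<Sum>j<dim_col A. A $$ (i, j) * x j)"

lemma index_mult_mat_sum:
  assumes "i < dim_row A" "j < dim_col B" "dim_col A = dim_row B"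
  shows "(A * B) $$ (i, j) = (\<Sum>k<dim_col A. A $$ (i, k) * B $$ (k, j))"
  using assms by (auto simp: scalar_prod_def intro!: sum.cong)

lemma app_mult:
  assumes "A \<in> carrier_mat l m" "B \<in> carrier_mat m n" "i < l"
  shows "app (A * B) x i = app A (app B x) i"
proof -
  have "app (A * B) x i = (\<Sum>j<n. \<Sum>k<m. A $$ (i, k) * B $$ (k, j) * x j)"
    using assms unfolding app_def
    by (intro sum.cong) (auto simp: index_mult_mat_sum sum_distrib_right simp del: index_mult_mat(1))
  also have "\<dots> = app A (app B x) i"
    using assms unfolding app_def by (subst sum.swap) (auto simp: sum_distrib_left mult_ac)
  finally show ?thesis .
qed

lemma app_cong: "dim_col A = n \<Longrightarrow> (\<And>i. i < n \<Longrightarrow> x i = y i) \<Longrightarrow> app A x = app A y"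
  unfolding app_def by (intro ext sum.cong) auto

lemma app_sum: "app A (\<lambda>i. \<Sum>k\<in>I. a k * u k i) j = (\<Sum>k\<in>I. a k * app A (u k) j)"
  unfolding app_def sum_distrib_left by (subst sum.swap) (simp add: mult_ac)

lemma app_scale: "app A (\<lambda>i. c * x i) j = c * app A x j"
  unfolding app_def sum_distrib_left by (simp add: mult_ac)

lemma ip_cong: "(\<And>i. i < d \<Longrightarrow> x i = x' i) \<Longrightarrow> (\<And>i. i < d \<Longrightarrow> y i = y' i) \<Longrightarrow> ip d x y = ip d x' y'"
  unfolding ip_def by (intro sum.cong) auto

lemma nsq_cong: "(\<And>i. i < d \<Longrightarrow> x i = x' i) \<Longrightarrow> nsq d x = nsq d x'"
  unfolding nsq_def by (intro sum.cong) auto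

lemma mat_adjoint_dim [simp]: "dim_row (mat_adjoint A) = dim_col A" "dim_col (mat_adjoint A) = dim_row A"
  by (auto simp: mat_adjoint_def)

lemma mat_adjoint_index [simp]:
  "i < dim_col A \<Longrightarrow> j < dim_row A \<Longrightarrow> mat_adjoint A $$ (i, j) = cnj ((A :: complex mat) $$ (j, i))"
  by (auto simp: mat_adjoint_def mat_of_rows_def)

definition herm :: "complex mat \<Rightarrow> bool" where
  "herm A \<longleftrightarrow> dim_row A = dim_col A \<and> (\<forall>i<dim_row A. \<forall>j<dim_row A. A $$ (j, i) = cnj (A $$ (i, j)))"

lemma hermD: "herm A \<Longrightarrow> i < dim_row A \<Longrightarrow> j < dim_row A \<Longrightarrow> A $$ (i, j) = cnj (A $$ (j, i))"
  unfolding herm_def by blast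

lemma hermI:
  assumes "A \<in> carrier_mat n n" "\<And>i j. i < n \<Longrightarrow> j < n \<Longrightarrow> A $$ (j, i) = cnj (A $$ (i, j))"
  shows "herm A"
  unfolding herm_def carrier_matD[OF assms(1)] using assms(2) by blast

lemma herm_ip:
  assumes "herm A" "dim_row A = n"
  shows "ip n (app A x) y = ip n x (app A y)"
proof -
  have [simp]: "dim_col A = n" using assms by (simp add: herm_def)
  have "ip n (app A x) y = (\<Sum>i<n. \<Sum>j<n. A $$ (i, j) * x j * cnj (y i))"
    by (simp add: ip_def app_def sum_distrib_right)
  also have "\<dots> = (\<Sum>j<n. \<Sum>i<n. A $$ (i, j) * x j * cnj (y i))"
    by (rule sum.swap)
  also have "\<dots> = (\<Sum>j<n. \<Sum>i<n. x j * (cnj (A $$ (j, i)) * cnj (y i)))"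
    using assms(2) by (intro sum.cong refl) (subst hermD[OF assms(1)], auto)
  also have "\<dots> = ip n x (app A y)"
    by (simp add: ip_def app_def sum_distrib_left)
  finally show ?thesis .
qed

section \<open>Spectral theorem\<close>

lemma mat_trace_comm:
  assumes "A \<in> carrier_mat m n" "B \<in> carrier_mat n m"
  shows "mat_trace (A * B) = mat_trace (B * A)"
proof -
  have "mat_trace (A * B) = (\<Sum>i<m. \<Sum>j<n. A $$ (i, j) * B $$ (j, i))"
    using assms unfolding mat_trace_def by (intro sum.cong) (auto simp: index_mult_mat_sum simp del: index_mult_mat(1))
  also have "\<dots> = (\<Sum>j<n. \<Sum>i<m. B $$ (j, i) * A $$ (i, j))"
    by (subst sum.swap) (simp add: mult.commute)
  also have "\<dots> = mat_trace (B * A)"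
    using assms unfolding mat_trace_def by (intro sum.cong) (auto simp: index_mult_mat_sum simp del: index_mult_mat(1))
  finally show ?thesis .
qed

text \<open>The trace is the sum of the diagonal of a Schur form, which lists the roots of the
  characteristic polynomial. Used in the contrapositive: a trace different from
  \<open>of_nat n * \<tau>\<close> yields an eigenvalue other than \<open>\<tau>\<close>.\<close>

lemma trace_single_eigenvalue:
  assumes A: "A \<in> carrier_mat n n" and ev: "\<And>x. eigenvalue A x \<Longrightarrow> x = \<tau>"
  shows "mat_trace A = of_nat n * \<tau>"
proof -
  obtain as where as: "char_poly A = (\<Prod>a\<leftarrow>as. [:- a, 1:])" "length as = n"
    using char_poly_factorized[OF A] by blast
  have "eigenvalue A a" if "a \<in> set as" for a
    unfolding eigenvalue_root_char_poly[OF A] as(1) poly_prod_list prod_list_zero_iff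
    using that by (auto simp: image_iff intro!: bexI[of _ a])
  then have all: "\<And>a. a \<in> set as \<Longrightarrow> a = \<tau>" using ev by blast
  obtain B P Q where "schur_decomposition A as = (B, P, Q)" by (metis prod_cases3)
  from schur_decomposition[OF A as(1) this] have
    sim: "similar_mat_wit A B P Q" and diag: "diag_mat B = as" by auto
  have c: "B \<in> carrier_mat n n" "P \<in> carrier_mat n n" "Q \<in> carrier_mat n n" "Q * P = 1\<^sub>m n" "A = P * B * Q"
    using similar_mat_witD2[OF A sim] by auto
  have "mat_trace A = mat_trace (Q * (P * B))"
    unfolding c(5) using c by (intro mat_trace_comm) auto
  also have "Q * (P * B) = B" using assoc_mult_mat[OF c(3,2,1)] c(1,4) by simp
  also have "mat_trace B = sum_list as"
    unfolding diag[symmetric] mat_trace_def diag_mat_def using c(1)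
    by (simp add: interv_sum_list_conv_sum_set_nat atLeast0LessThan)
  also have "as = replicate n \<tau>" using all as(2) by (auto intro: replicate_eqI)
  finally show ?thesis by (simp add: sum_list_replicate)
qed

definition eigensystem :: "complex mat \<Rightarrow> nat \<Rightarrow> (nat \<Rightarrow> nat \<Rightarrow> complex) \<Rightarrow> (nat \<Rightarrow> real) \<Rightarrow> bool" where
  "eigensystem A k w \<alpha> \<longleftrightarrow> ortho (dim_row A) {..<k} w \<and>
     (\<forall>l<k. \<forall>i<dim_row A. app A (w l) i = of_real (\<alpha> l) * w l i)"

text \<open>Deflation without passing to a subspace: \<open>B\<close> agrees with \<open>A\<close>
  on the orthogonal complement of the \<open>w l\<close> and multiplies every \<open>w l\<close> by
  \<open>\<tau>\<close>. An eigenvector of \<open>B\<close> for another eigenvalue is orthogonal to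
  all \<open>w l\<close>, hence also an eigenvector of \<open>A\<close>.\<close>

lemma eigensystem_Suc:
  assumes "herm A" and n: "dim_row A = n" and e: "eigensystem A k w \<alpha>" and "k < n"
  shows "\<exists>w \<alpha>. eigensystem A (Suc k) w \<alpha>"
proof -
  have [simp]: "dim_col A = n" using assms by (simp add: herm_def)
  have o: "ortho n {..<k} w" and ev: "\<And>l i. l < k \<Longrightarrow> i < n \<Longrightarrow> app A (w l) i = of_real (\<alpha> l) * w l i"
    using e n by (auto simp: eigensystem_def)
  \<comment> \<open>The equation \<open>mat_trace B = of_nat n * \<tau>\<close> has the quotient as
    its only solution; adding 1 avoids it.\<close>
  define \<tau> where "\<tau> = (mat_trace A - (\<Sum>l<k. of_real (\<alpha> l))) / of_nat (n - k) + 1"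
  define B where "B = mat n n (\<lambda>(i, j). A $$ (i, j) + (\<Sum>l<k. (\<tau> - of_real (\<alpha> l)) * w l i * cnj (w l j)))"
  have B: "B \<in> carrier_mat n n" by (simp add: B_def)
  have "mat_trace B = mat_trace A + (\<Sum>i<n. \<Sum>l<k. (\<tau> - of_real (\<alpha> l)) * (w l i * cnj (w l i)))"
    by (simp add: mat_trace_def B_def n sum.distrib mult.assoc)
  also have "\<dots> = mat_trace A + (\<Sum>l<k. (\<tau> - of_real (\<alpha> l)) * ip n (w l) (w l))"
    by (subst sum.swap) (simp add: ip_def sum_distrib_left)
  also have "\<dots> = mat_trace A + (\<Sum>l<k. \<tau> - of_real (\<alpha> l))"
    using orthoD[OF o] by simp
  finally have tr: "mat_trace B = mat_trace A + of_nat k * \<tau> - (\<Sum>l<k. of_real (\<alpha> l))"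
    by (simp add: sum_subtractf)
  have "of_nat (n - k) * \<tau> = mat_trace A - (\<Sum>l<k. of_real (\<alpha> l)) + of_nat (n - k)"
    using \<open>k < n\<close> by (simp add: \<tau>_def field_simps)
  moreover have "of_nat n * \<tau> = of_nat (n - k) * \<tau> + of_nat k * \<tau>"
    using \<open>k < n\<close> by (simp flip: distrib_right of_nat_add)
  moreover have "(of_nat (n - k) :: complex) \<noteq> 0" using \<open>k < n\<close> by simp
  ultimately have "mat_trace B \<noteq> of_nat n * \<tau>"
    unfolding tr by auto
  then obtain \<kappa> where \<kappa>: "eigenvalue B \<kappa>" "\<kappa> \<noteq> \<tau>" using trace_single_eigenvalue[OF B] by blast
  then obtain v where v: "v \<in> carrier_vec n" "v \<noteq> 0\<^sub>v n" "B *\<^sub>v v = \<kappa> \<cdot>\<^sub>v v"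
    using B by (auto simp: eigenvalue_def eigenvector_def)
  define y where "y = (\<lambda>i. v $ i)"
  have "app B y i = \<kappa> * y i" if "i < n" for i
    using arg_cong[OF v(3), of "\<lambda>z. z $ i"] that v(1) B
    by (simp add: app_def y_def scalar_prod_def lessThan_atLeast0)
  moreover have "app B y i = app A y i + (\<Sum>l<k. (\<tau> - of_real (\<alpha> l)) * ip n y (w l) * w l i)" if "i < n" for i
  proof -
    have "app B y i = app A y i + (\<Sum>j<n. \<Sum>l<k. (\<tau> - of_real (\<alpha> l)) * w l i * cnj (w l j) * y j)"
      using that by (simp add: app_def B_def algebra_simps sum.distrib sum_distrib_left sum_distrib_right)
    also have "(\<Sum>j<n. \<Sum>l<k. (\<tau> - of_real (\<alpha> l)) * w l i * cnj (w l j) * y j) = (\<Sum>l<k. (\<tau> - of_real (\<alpha> l)) * ip n y (w l) * w l i)"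
      by (subst sum.swap) (simp add: ip_def sum_distrib_left sum_distrib_right mult_ac)
    finally show ?thesis .
  qed
  ultimately have yB: "app A y i + (\<Sum>l<k. (\<tau> - of_real (\<alpha> l)) * ip n y (w l) * w l i) = \<kappa> * y i" if "i < n" for i
    using that by auto
  have perp: "ip n y (w m) = 0" if m: "m < k" for m
  proof -
    have "\<kappa> * ip n y (w m) = ip n (\<lambda>i. \<kappa> * y i) (w m)" by (simp add: ip_scale_left)
    also have "\<dots> = ip n (\<lambda>i. app A y i + (\<Sum>l<k. (\<tau> - of_real (\<alpha> l)) * ip n y (w l) * w l i)) (w m)"
      using yB by (intro ip_cong) auto
    also have "\<dots> = ip n (app A y) (w m) + ip n (\<lambda>i. \<Sum>l<k. ((\<tau> - of_real (\<alpha> l)) * ip n y (w l)) * w l i) (w m)"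
      by (simp add: ip_def algebra_simps sum.distrib)
    also have "ip n (\<lambda>i. \<Sum>l<k. ((\<tau> - of_real (\<alpha> l)) * ip n y (w l)) * w l i) (w m) = (\<tau> - of_real (\<alpha> m)) * ip n y (w m)"
      using m by (subst ip_ortho_sum[OF o]) auto
    also have "ip n (app A y) (w m) = ip n y (\<lambda>i. of_real (\<alpha> m) * w m i)"
      unfolding herm_ip[OF assms(1,2)] using ev m by (intro ip_cong) auto
    also have "\<dots> = of_real (\<alpha> m) * ip n y (w m)" unfolding ip_scale_right by simp
    finally have "(\<kappa> - \<tau>) * ip n y (w m) = 0" by (simp add: algebra_simps)
    then show ?thesis using \<kappa>(2) by simp
  qed
  have yA: "app A y i = \<kappa> * y i" if "i < n" for i
    using yB[OF that] perp by simp
  have "\<exists>i<n. y i \<noteq> 0" using v(1,2) unfolding y_def by (metis carrier_vecD eq_vecI index_zero_vec(1,2))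
  then have pos: "nsq n y > 0" using nsq_nonneg[of n y] nsq_0_iff[of n y] by fastforce
  \<comment> \<open>\<open>\<kappa>\<close> is a root of a complex polynomial; only the symmetry of
    \<open>A\<close> makes it real, as \<open>eigensystem\<close> demands.\<close>
  have "\<kappa> * ip n y y = ip n (app A y) y"
    unfolding ip_scale_left[symmetric] using yA by (intro ip_cong) auto
  also have "\<dots> = ip n y (\<lambda>i. \<kappa> * y i)"
    unfolding herm_ip[OF assms(1,2)] using yA by (intro ip_cong) auto
  also have "\<dots> = cnj \<kappa> * ip n y y" by (rule ip_scale_right)
  finally have "\<kappa> = cnj \<kappa>" using pos by (simp add: ip_self)
  then have \<kappa>r: "\<kappa> = of_real (Re \<kappa>)" by (metis Reals_cnj_iff of_real_Re)
  define z where "z = (\<lambda>i. complex_of_real (1 / sqrt (nsq n y)) * y i)"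
  have zz: "ip n z z = 1" 
    using pos unfolding ip_self z_def nsq_scale by (simp add: power_divide norm_divide)
  have zw: "ip n z (w m) = 0" "ip n (w m) z = 0" if "m < k" for m
  proof -
    show "ip n z (w m) = 0" unfolding z_def ip_scale_left perp[OF that] by simp
    then show "ip n (w m) z = 0" by (subst ip_commute) simp
  qed
  have zA: "app A z i = of_real (Re \<kappa>) * z i" if "i < n" for i
    unfolding z_def app_scale yA[OF that] \<kappa>r[symmetric] by (simp add: mult.left_commute)
  have "eigensystem A (Suc k) (w(k := z)) (\<alpha>(k := Re \<kappa>))"
    unfolding eigensystem_def n ortho_def
  proof (intro conjI ballI allI impI)
    fix a b assume "a \<in> {..<Suc k}" "b \<in> {..<Suc k}"
    then show "ip n ((w(k := z)) a) ((w(k := z)) b) = (if a = b then 1 else 0)"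
      using orthoD[OF o] zw zz by (auto simp: less_Suc_eq)
  next
    fix l i assume "l < Suc k" "i < n"
    then show "app A ((w(k := z)) l) i = complex_of_real ((\<alpha>(k := Re \<kappa>)) l) * (w(k := z)) l i"
      using ev zA by (auto simp: less_Suc_eq)
  qed
  then show ?thesis by blast
qed

lemma spectral:
  assumes "herm A"
  obtains w \<alpha> where "eigensystem A (dim_row A) w \<alpha>"
proof -
  have "\<exists>w \<alpha>. eigensystem A k w \<alpha>" if "k \<le> dim_row A" for k
    using that
  proof (induction k)
    case 0
    show ?case by (auto simp: eigensystem_def ortho_def)
  next
    case (Suc k)
    then show ?case using eigensystem_Suc[OF assms refl] by auto
  qed
  then show ?thesis using that by blast
qed

lemma eigensystem_entries:
  assumes "eigensystem A n w \<alpha>" "A \<in> carrier_mat n n" "i < n" "j < n"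
  shows "A $$ (i, j) = (\<Sum>k<n. of_real (\<alpha> k) * w k i * cnj (w k j))"
proof -
  have o: "ortho n {..<n} w" using assms by (auto simp: eigensystem_def)
  have "A $$ (i, j) = (\<Sum>m<n. if m = j then A $$ (i, m) else 0)" using assms by simp
  also have "\<dots> = (\<Sum>m<n. A $$ (i, m) * (\<Sum>k<n. w k m * cnj (w k j)))"
    using assms(4) by (intro sum.cong refl) (subst ortho_delta[OF o], auto)
  also have "\<dots> = (\<Sum>k<n. app A (w k) i * cnj (w k j))"
    using assms(2) unfolding app_def sum_distrib_left sum_distrib_right
    by (subst sum.swap) (simp add: mult_ac)
  also have "\<dots> = (\<Sum>k<n. of_real (\<alpha> k) * w k i * cnj (w k j))"
    using assms by (intro sum.cong refl) (auto simp: eigensystem_def)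
  finally show ?thesis .
qed

section \<open>Positive matrices and their square roots\<close>

lemma psd_iff:
  assumes "A \<in> carrier_mat n n"
  shows "psd A \<longleftrightarrow> (\<forall>x. 0 \<le> ip n (app A x) x)"
proof -
  have e: "(A *\<^sub>v v) \<bullet>c v = ip n (app A (($) v)) (($) v)" if "v \<in> carrier_vec n" for v
    using assms that by (auto simp: ip_def app_def scalar_prod_def lessThan_atLeast0 intro!: sum.cong)
  have "0 \<le> ip n (app A x) x" if "psd A" for x
  proof -
    have "0 \<le> ip n (app A (($) (vec n x))) (($) (vec n x))"
      using that assms unfolding e[of "vec n x", symmetric, simplified] psd_def by simp
    also have "app A (($) (vec n x)) = app A x" using assms by (intro app_cong[of _ n]) auto
    also have "ip n (app A x) (($) (vec n x)) = ip n (app A x) x" by (intro ip_cong) auto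
    finally show ?thesis .
  qed
  then show ?thesis using assms e by (auto simp: psd_def)
qed

text \<open>Polarization. In the order on complex numbers, nonnegative includes real, so the
  quadratic form is real at \<open>e_i + c e_j\<close>; the values 0, 1, -1 and \<open>\<i>\<close>
  of \<open>c\<close> determine how the two off-diagonal entries are related.\<close>

lemma psd_herm:
  assumes "psd A"
  shows "herm A"
proof -
  define n where "n = dim_row A"
  have A: "A \<in> carrier_mat n n" using assms by (auto simp: psd_def n_def)
  have q: "Im (A $$ (i, i)) = 0 \<and> A $$ (j, i) = cnj (A $$ (i, j))" if ij: "i < n" "j < n" "i \<noteq> j" for i j
  proof -
    have "Im (A $$ (i, i) + c * A $$ (i, j) + cnj c * A $$ (j, i) + cnj c * c * A $$ (j, j)) = 0" for c
    proof -
      define x where "x = (\<lambda>m. if m = i then 1 else if m = j then c else 0)"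
      have s: "(\<Sum>m<n. f m * x m) = f i + c * f j" for f :: "nat \<Rightarrow> complex"
      proof -
        have "(\<Sum>m<n. f m * x m) = (\<Sum>m<n. (if m = i then f m else 0) + (if m = j then c * f m else 0))"
          using ij by (intro sum.cong) (auto simp: x_def)
        then show ?thesis using ij by (simp add: sum.distrib)
      qed
      have s': "(\<Sum>m<n. f m * cnj (x m)) = f i + cnj c * f j" for f :: "nat \<Rightarrow> complex"
        using arg_cong[OF s[of "\<lambda>m. cnj (f m)"], of cnj] by (simp add: cnj_sum)
      have ap: "app A x m = A $$ (m, i) + c * A $$ (m, j)" for m
        using A s[of "\<lambda>j. A $$ (m, j)"] by (simp add: app_def)
      have "ip n (app A x) x = A $$ (i, i) + c * A $$ (i, j) + cnj c * (A $$ (j, i) + c * A $$ (j, j))"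
        unfolding ip_def s' ap by simp
      moreover have "0 \<le> ip n (app A x) x" using assms psd_iff[OF A] by blast
      ultimately show ?thesis by (simp add: less_eq_complex_def algebra_simps)
    qed
    from this[of 0] this[of 1] this[of \<i>] this[of "-1"] show ?thesis
      by (auto simp: complex_eq_iff)
  qed
  \<comment> \<open>\<open>q\<close> needs a second index, so the diagonal is treated separately;
    this covers \<open>n = 1\<close>.\<close>
  have "Im (A $$ (i, i)) = 0" if "i < n" for i
  proof -
    have "0 \<le> ip n (app A (\<lambda>j. if j = i then 1 else 0)) (\<lambda>j. if j = i then 1 else 0)"
      using assms psd_iff[OF A] by blast
    also have "\<dots> = A $$ (i, i)"
      using that A by (simp add: ip_def app_def if_distrib[where f="\<lambda>z. _ * z"] if_distrib[where f=cnj] cong: if_cong)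
    finally show ?thesis by (simp add: less_eq_complex_def)
  qed
  then have "A $$ (i, i) = cnj (A $$ (i, i))" if "i < n" for i
    using that by (simp add: complex_eq_iff)
  then have "A $$ (j, i) = cnj (A $$ (i, j))" if "i < n" "j < n" for i j
    using q[OF that] that by (cases "i = j") blast+
  then show ?thesis by (rule hermI[OF A])
qed

lemma psd_eigenvalue_nonneg:
  assumes "psd A" "eigensystem A k w \<alpha>" "l < k"
  shows "0 \<le> \<alpha> l"
proof -
  let ?n = "dim_row A"
  have "A \<in> carrier_mat ?n ?n" using assms(1) by (auto simp: psd_def)
  then have "0 \<le> ip ?n (app A (w l)) (w l)"
    using assms(1) psd_iff by blast
  also have "\<dots> = ip ?n (\<lambda>i. of_real (\<alpha> l) * w l i) (w l)"
    using assms by (intro ip_cong) (auto simp: eigensystem_def)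
  also have "\<dots> = of_real (\<alpha> l)"
    using assms unfolding ip_scale_left by (simp add: eigensystem_def ortho_def)
  finally show ?thesis by (simp add: less_eq_complex_def)
qed

lemma app_of_eigensum:
  assumes "A \<in> carrier_mat n n" "\<And>i j. i < n \<Longrightarrow> j < n \<Longrightarrow> A $$ (i, j) = (\<Sum>k\<in>I. a k * u k i * cnj (u k j))" "i < n"
  shows "app A x i = (\<Sum>k\<in>I. a k * ip n x (u k) * u k i)"
proof -
  have "app A x i = (\<Sum>j<n. \<Sum>k\<in>I. a k * u k i * cnj (u k j) * x j)"
    using assms unfolding app_def by (simp add: sum_distrib_right)
  then show ?thesis
    by (subst (asm) sum.swap) (simp add: ip_def sum_distrib_left sum_distrib_right mult_ac)
qed

lemma psd_eigensum:
  assumes A: "A \<in> carrier_mat n n" "\<And>i j. i < n \<Longrightarrow> j < n \<Longrightarrow> A $$ (i, j) = (\<Sum>k\<in>I. of_real (a k) * u k i * cnj (u k j))"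
    and nn: "\<And>k. k \<in> I \<Longrightarrow> 0 \<le> a k"
  shows "psd A"
proof -
  have "ip n (app A x) x = of_real (\<Sum>k\<in>I. a k * (cmod (ip n x (u k)))\<^sup>2)" for x
  proof -
    have "ip n (app A x) x = ip n (\<lambda>i. \<Sum>k\<in>I. of_real (a k) * ip n x (u k) * u k i) x"
      using app_of_eigensum[OF A] by (intro ip_cong) auto
    also have "\<dots> = (\<Sum>k\<in>I. of_real (a k) * ip n x (u k) * cnj (ip n x (u k)))"
      unfolding ip_sum_left using ip_commute by metis
    finally show ?thesis by (simp add: mult.assoc flip: complex_norm_square)
  qed
  then show ?thesis unfolding psd_iff[OF A(1)] using nn by (auto intro!: sum_nonneg simp: less_eq_complex_def)
qed

text \<open>An eigenvector of \<open>B * B\<close> has components only along those eigenvectors of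
  \<open>B\<close> whose eigenvalue squares to \<open>\<alpha> l\<close>. As \<open>B\<close> has no
  negative eigenvalues, that eigenvalue is the root \<open>sqrt (\<alpha> l)\<close>.\<close>

lemma psd_root_eigensystem:
  assumes "psd B" "B \<in> carrier_mat n n" "eigensystem (B * B) k w \<alpha>" "l < k" "i < n"
  shows "app B (w l) i = of_real (sqrt (\<alpha> l)) * w l i"
proof -
  obtain b \<mu> where b: "eigensystem B n b \<mu>"
    using spectral[OF psd_herm[OF assms(1)]] assms(2) by auto
  have o: "ortho n {..<n} b" and eb: "\<And>m i. m < n \<Longrightarrow> i < n \<Longrightarrow> app B (b m) i = of_real (\<mu> m) * b m i"
    using b assms(2) by (auto simp: eigensystem_def)
  have h: "herm B" "dim_row B = n" using psd_herm assms by auto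
  have ipB: "ip n (app B x) (b m) = of_real (\<mu> m) * ip n x (b m)" if "m < n" for x m
  proof -
    have "ip n (app B x) (b m) = ip n x (\<lambda>i. of_real (\<mu> m) * b m i)"
      unfolding herm_ip[OF h] using eb that by (intro ip_cong) auto
    then show ?thesis by (simp add: ip_scale_right)
  qed
  have *: "of_real (\<mu> m) * ip n (w l) (b m) = of_real (sqrt (\<alpha> l)) * ip n (w l) (b m)" if m: "m < n" for m
  proof (cases "ip n (w l) (b m) = 0")
    case False
    have "of_real (\<alpha> l) * ip n (w l) (b m) = ip n (app (B * B) (w l)) (b m)"
      unfolding ip_scale_left[symmetric] using assms by (intro ip_cong) (auto simp: eigensystem_def)
    also have "\<dots> = ip n (app B (app B (w l))) (b m)"
      using assms by (intro ip_cong) (auto simp: app_mult)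
    also have "\<dots> = of_real (\<mu> m * \<mu> m) * ip n (w l) (b m)"
      using m by (simp add: ipB)
    finally have "\<alpha> l = \<mu> m * \<mu> m" using False by (metis mult_cancel_right of_real_eq_iff)
    moreover have "0 \<le> \<mu> m" using psd_eigenvalue_nonneg[OF assms(1) b m] .
    ultimately show ?thesis by simp
  qed simp
  have "app B (w l) i = (\<Sum>m<n. ip n (app B (w l)) (b m) * b m i)"
    using assms by (intro ortho_expand[OF o]) auto
  also have "\<dots> = of_real (sqrt (\<alpha> l)) * (\<Sum>m<n. ip n (w l) (b m) * b m i)"
    unfolding sum_distrib_left by (intro sum.cong refl) (simp add: ipB * mult.assoc[symmetric])
  also have "(\<Sum>m<n. ip n (w l) (b m) * b m i) = w l i"
    using assms by (intro ortho_expand[OF o, symmetric]) auto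
  finally show ?thesis .
qed

text \<open>Both roots share an eigensystem, built on eigenvectors of \<open>C * C\<close>, and a
  full eigensystem determines the entries. Without uniqueness the definite description in
  \<open>mat_sqrt\<close> would denote nothing known.\<close>

lemma psd_root_unique:
  assumes "psd B" "B \<in> carrier_mat n n" "psd C" "C \<in> carrier_mat n n" "B * B = C * C"
  shows "B = C"
proof -
  have "C * C \<in> carrier_mat n n" using assms by simp
  moreover have "herm (C * C)"
  proof -
    have C: "herm C" using psd_herm assms by auto
    have hc: "(C * C) $$ (j, i) = cnj ((C * C) $$ (i, j))" if ij: "i < n" "j < n" for i j
    proof -
      have "(C * C) $$ (j, i) = (\<Sum>k<n. C $$ (j, k) * C $$ (k, i))"
        using ij assms(4) by (simp add: index_mult_mat_sum del: index_mult_mat(1))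
      also have "\<dots> = (\<Sum>k<n. cnj (C $$ (i, k) * C $$ (k, j)))"
      proof (intro sum.cong refl)
        fix k assume "k \<in> {..<n}"
        then have k: "k < n" by simp
        have "C $$ (j, k) = cnj (C $$ (k, j))" "C $$ (k, i) = cnj (C $$ (i, k))"
          by (rule hermD[OF C]; use k ij assms(4) in simp)+
        then show "C $$ (j, k) * C $$ (k, i) = cnj (C $$ (i, k) * C $$ (k, j))" by (simp add: mult.commute)
      qed
      also have "\<dots> = cnj ((C * C) $$ (i, j))"
        using ij assms(4) by (simp add: index_mult_mat_sum cnj_sum del: index_mult_mat(1))
      finally show ?thesis .
    qed
    show ?thesis by (rule hermI[of _ n]) (use assms(4) in simp, rule hc)
  qed
  ultimately obtain w \<alpha> where e: "eigensystem (C * C) n w \<alpha>" using spectral by (metis carrier_matD(1))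
  have "eigensystem D n w (\<lambda>l. sqrt (\<alpha> l))" if "psd D" "D \<in> carrier_mat n n" "D * D = C * C" for D
    using psd_root_eigensystem[OF that(1,2), of n w \<alpha>] e that assms(4) by (auto simp: eigensystem_def)
  from eigensystem_entries[OF this[OF assms(1,2,5)] assms(2)] eigensystem_entries[OF this[OF assms(3,4) refl] assms(4)]
  show ?thesis using assms(2,4) by (intro eq_matI) auto
qed

lemma mat_sqrt_eqI:
  assumes "psd B" "B \<in> carrier_mat n n" "B * B = A"
  shows "mat_sqrt A = B"
  unfolding mat_sqrt_def
proof (rule the_equality)
  have "dim_row A = n" using assms by auto
  then show "B \<in> carrier_mat (dim_row A) (dim_row A) \<and> psd B \<and> B * B = A" using assms by simp
  fix C assume "C \<in> carrier_mat (dim_row A) (dim_row A) \<and> psd C \<and> C * C = A"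
  then show "C = B" using assms \<open>dim_row A = n\<close> by (intro psd_root_unique[of C n B]) auto
qed

lemma mat_sqrt_psd:
  assumes "psd A" "A \<in> carrier_mat n n"
  shows "psd (mat_sqrt A)" "mat_sqrt A \<in> carrier_mat n n" "mat_sqrt A * mat_sqrt A = A"
proof -
  obtain w \<alpha> where e: "eigensystem A n w \<alpha>" using spectral[OF psd_herm[OF assms(1)]] assms(2) by auto
  have nn: "0 \<le> \<alpha> k" if "k < n" for k using psd_eigenvalue_nonneg[OF assms(1) e that] .
  have o: "ortho n {..<n} w" using e assms(2) by (auto simp: eigensystem_def)
  define B where "B = mat n n (\<lambda>(i, j). \<Sum>k<n. of_real (sqrt (\<alpha> k)) * w k i * cnj (w k j))"
  have B: "B \<in> carrier_mat n n" by (simp add: B_def)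
  have Be: "B $$ (i, j) = (\<Sum>k<n. of_real (sqrt (\<alpha> k)) * w k i * cnj (w k j))" if "i < n" "j < n" for i j
    using that by (simp add: B_def)
  have p: "psd B" by (rule psd_eigensum[OF B Be]) (auto simp: nn)
  have "B * B = A"
  proof (rule eq_matI)
    fix i j assume "i < dim_row A" "j < dim_col A"
    then have ij: "i < n" "j < n" using assms(2) by auto
    have "(B * B) $$ (i, j) = app B (\<lambda>m. \<Sum>k<n. (of_real (sqrt (\<alpha> k)) * cnj (w k j)) * w k m) i"
      using ij B unfolding app_def by (simp add: index_mult_mat_sum Be mult_ac del: index_mult_mat(1))
    also have "\<dots> = (\<Sum>k<n. of_real (sqrt (\<alpha> k)) * cnj (w k j) * (of_real (sqrt (\<alpha> k)) * w k i))"
      unfolding app_sum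
    proof (intro sum.cong refl)
      fix k assume "k \<in> {..<n}"
      then have "app B (w k) i = of_real (sqrt (\<alpha> k)) * w k i"
      proof -
        assume k: "k \<in> {..<n}"
        have "app B (w k) i = (\<Sum>l<n. of_real (sqrt (\<alpha> l)) * ip n (w k) (w l) * w l i)"
          by (rule app_of_eigensum[OF B]) (use Be ij in auto)
        also have "\<dots> = (\<Sum>l<n. if l = k then of_real (sqrt (\<alpha> l)) * w l i else 0)"
          by (intro sum.cong refl) (simp add: orthoD[OF o k])
        finally show ?thesis using k by simp
      qed
      then show "of_real (sqrt (\<alpha> k)) * cnj (w k j) * app B (w k) i = of_real (sqrt (\<alpha> k)) * cnj (w k j) * (of_real (sqrt (\<alpha> k)) * w k i)" by simp
    qed
    also have "\<dots> = (\<Sum>k<n. of_real (\<alpha> k) * w k i * cnj (w k j))"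
    proof (intro sum.cong refl)
      fix k assume "k \<in> {..<n}"
      then have "complex_of_real (sqrt (\<alpha> k)) * of_real (sqrt (\<alpha> k)) = of_real (\<alpha> k)"
        using nn by (simp flip: of_real_mult)
      then show "of_real (sqrt (\<alpha> k)) * cnj (w k j) * (of_real (sqrt (\<alpha> k)) * w k i) = of_real (\<alpha> k) * w k i * cnj (w k j)"
        by (metis (no_types, lifting) mult.assoc mult.commute)
    qed
    also have "\<dots> = A $$ (i, j)" using eigensystem_entries[OF e assms(2) ij] by simp
    finally show "(B * B) $$ (i, j) = A $$ (i, j)" .
  qed (use B assms(2) in auto)
  from mat_sqrt_eqI[OF p B this] p B this
  show "psd (mat_sqrt A)" "mat_sqrt A \<in> carrier_mat n n" "mat_sqrt A * mat_sqrt A = A" by auto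
qed

text \<open>For a pure \<open>\<sigma>\<close> the absolute value can be computed:
  \<open>\<sigma>\<close> is its own root, the product \<open>R * \<sigma>\<close> has rank at most
  one, and its adjoint times itself is \<open>\<sigma>\<close> scaled by the squared norm
  \<open>c\<close> of \<open>app R y\<close>. The trace of the root is \<open>sqrt c\<close>, and
  \<open>c\<close> is the quadratic form of \<open>\<rho>\<close> at \<open>y\<close>.\<close>

lemma fidelity_pure:
  assumes "psd \<rho>" "\<rho> \<in> carrier_mat n n" and \<sigma>: "\<sigma> = mat n n (\<lambda>(i, j). y i * cnj (y j))" and "nsq n y = 1"
  shows "fidelity \<rho> \<sigma> = sqrt (Re (ip n (app \<rho> y) y))"
proof -
  have c\<sigma>: "\<sigma> \<in> carrier_mat n n" by (simp add: \<sigma>)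
  have yy: "(\<Sum>k<n. cnj (y k) * y k) = 1"
    using assms(4) ip_self[of n y] by (simp add: ip_def mult.commute)
  define R where "R = mat_sqrt \<rho>"
  have R: "psd R" "R \<in> carrier_mat n n" "R * R = \<rho>" using mat_sqrt_psd[OF assms(1,2)] by (auto simp: R_def)
  \<comment> \<open>Serves twice: with factor 1 for \<open>\<sigma>\<close> itself, and with factor
    \<open>c\<close> inside \<open>mat_abs\<close>.\<close>
  have scaled: "mat_sqrt (mat n n (\<lambda>(i, j). of_real c * (y i * cnj (y j)))) = mat n n (\<lambda>(i, j). of_real (sqrt c) * (y i * cnj (y j)))"
    if "0 \<le> c" for c
  proof (rule mat_sqrt_eqI[where n = n])
    show "psd (mat n n (\<lambda>(i, j). of_real (sqrt c) * (y i * cnj (y j))))"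
      by (rule psd_eigensum[where I = "{0::nat}" and a = "\<lambda>_. sqrt c" and u = "\<lambda>_. y" and n = n]) (auto simp: that mult.assoc)
    have sc: "complex_of_real (sqrt c) * of_real (sqrt c) = of_real c" using that by (simp flip: of_real_mult)
    show "mat n n (\<lambda>(i, j). of_real (sqrt c) * (y i * cnj (y j))) * mat n n (\<lambda>(i, j). of_real (sqrt c) * (y i * cnj (y j))) =
      mat n n (\<lambda>(i, j). of_real c * (y i * cnj (y j)))"
    proof (rule eq_matI, goal_cases)
      case (1 i j)
      then have "(mat n n (\<lambda>(i, j). of_real (sqrt c) * (y i * cnj (y j))) * mat n n (\<lambda>(i, j). of_real (sqrt c) * (y i * cnj (y j)))) $$ (i, j)
        = (\<Sum>k<n. (of_real (sqrt c) * of_real (sqrt c)) * (y i * cnj (y j)) * (cnj (y k) * y k))"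
        by (simp add: index_mult_mat_sum mult_ac del: index_mult_mat(1))
      then show ?case using 1 unfolding sc sum_distrib_left[symmetric] yy by simp
    qed auto
  qed simp
  have s\<sigma>: "mat_sqrt \<sigma> = \<sigma>" using scaled[of 1] by (simp add: \<sigma>)
  define c where "c = nsq n (app R y)"
  have X: "(R * \<sigma>) $$ (i, j) = app R y i * cnj (y j)" if "i < n" "j < n" for i j
    using that R c\<sigma> by (simp add: index_mult_mat_sum \<sigma> app_def sum_distrib_right mult.assoc del: index_mult_mat(1))
  have "mat_adjoint (R * \<sigma>) * (R * \<sigma>) = mat n n (\<lambda>(i, j). of_real c * (y i * cnj (y j)))"
  proof (rule eq_matI, goal_cases)
    case (1 i j)
    then have "(mat_adjoint (R * \<sigma>) * (R * \<sigma>)) $$ (i, j) = (\<Sum>k<n. (app R y k * cnj (app R y k)) * (y i * cnj (y j)))"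
      using R c\<sigma> by (subst index_mult_mat_sum) (auto simp: X mult_ac simp del: index_mult_mat(1))
    also have "\<dots> = of_real c * (y i * cnj (y j))"
      unfolding sum_distrib_right[symmetric] c_def ip_self[symmetric] ip_def ..
    finally show ?case using 1 by simp
  qed (use R c\<sigma> in auto)
  then have "mat_abs (R * \<sigma>) = mat n n (\<lambda>(i, j). of_real (sqrt c) * (y i * cnj (y j)))"
    unfolding mat_abs_def using scaled[of c] nsq_nonneg by (simp add: c_def)
  then have "fidelity \<rho> \<sigma> = Re (\<Sum>i<n. of_real (sqrt c) * (y i * cnj (y i)))"
    unfolding fidelity_def s\<sigma> R_def[symmetric] by (simp add: mat_trace_def)
  also have "\<dots> = sqrt c" using yy unfolding sum_distrib_left[symmetric] by (simp add: mult.commute)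
  also have "of_real c = ip n (app \<rho> y) y"
  proof -
    have "ip n (app \<rho> y) y = ip n (app R (app R y)) y"
      unfolding R(3)[symmetric] using R by (intro ip_cong) (auto simp: app_mult)
    also have "\<dots> = of_real c" using herm_ip[OF psd_herm[OF R(1)], of n] R by (simp add: c_def ip_self)
    finally show ?thesis by simp
  qed
  then have "c = Re (ip n (app \<rho> y) y)" by (metis Re_complex_of_real)
  finally show ?thesis by simp
qed

section \<open>Von Neumann entropy from an orthonormal decomposition\<close>

lemma char_poly_eigensystem:
  assumes "eigensystem A n w \<alpha>" and A: "A \<in> carrier_mat n n"
  shows "char_poly A = (\<Prod>k<n. [:- of_real (\<alpha> k), 1:])"
proof -
  have o: "ortho n {..<n} w" using assms by (auto simp: eigensystem_def)
  define W where "W = mat n n (\<lambda>(i, k). w k i)"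
  define W' where "W' = mat n n (\<lambda>(k, i). cnj (w k i))"
  define D where "D = mat n n (\<lambda>(i, j). if i = j then complex_of_real (\<alpha> i) else 0)"
  have c: "W \<in> carrier_mat n n" "W' \<in> carrier_mat n n" "D \<in> carrier_mat n n"
    by (auto simp: W_def W'_def D_def)
  have WW': "W * W' = 1\<^sub>m n"
    using c by (intro eq_matI) (auto simp: index_mult_mat_sum W_def W'_def ortho_delta[OF o] simp del: index_mult_mat(1))
  then have W'W: "W' * W = 1\<^sub>m n" using mat_mult_left_right_inverse c by blast
  have "A = W * D * W'"
  proof (rule eq_matI, goal_cases)
    case (1 i j)
    then have ij: "i < n" "j < n" using c by auto
    have "(W * D) $$ (i, k) = of_real (\<alpha> k) * w k i" if "k < n" for k
    proof -
      have "(W * D) $$ (i, k) = (\<Sum>m<n. if m = k then of_real (\<alpha> m) * w m i else 0)"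
        using c ij that by (subst index_mult_mat_sum) (auto simp: W_def D_def simp del: sum.delta sum.delta' intro!: sum.cong)
      then show ?thesis using that by simp
    qed
    then have "(W * D * W') $$ (i, j) = (\<Sum>k<n. of_real (\<alpha> k) * w k i * cnj (w k j))"
      using c ij by (subst index_mult_mat_sum) (auto simp: W'_def simp del: index_mult_mat(1) intro!: sum.cong)
    then show ?case using eigensystem_entries[OF assms ij] by simp
  qed (use A c in auto)
  then have "similar_mat_wit A D W W'"
    using A c WW' W'W unfolding similar_mat_wit_def by (auto simp: Let_def)
  then have "similar_mat A D" unfolding similar_mat_def by blast
  then have "char_poly A = char_poly D" by (rule char_poly_similar)
  also have "\<dots> = (\<Prod>a\<leftarrow>diag_mat D. [:- a, 1:])"
    by (rule char_poly_upper_triangular[OF c(3)]) (auto simp: D_def upper_triangular_def)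
  also have "diag_mat D = map (\<lambda>i. of_real (\<alpha> i)) [0..<n]"
    by (auto simp: diag_mat_def D_def)
  also have "(\<Prod>a\<leftarrow>map (\<lambda>i. of_real (\<alpha> i)) [0..<n]. [:- a, 1:]) = (\<Prod>k<n. [:- complex_of_real (\<alpha> k), 1:])"
    by (simp add: comp_def prod.distinct_set_conv_list[symmetric] atLeast0LessThan)
  finally show ?thesis .
qed

text \<open>\<open>von_neumann_entropy\<close> runs over distinct eigenvalues weighted by root
  order; this spreads the sum over a list of eigenvalues with repetitions.\<close>

lemma sum_over_roots:
  fixes g :: "complex \<Rightarrow> real" and e :: "nat \<Rightarrow> complex"
  assumes "A \<in> carrier_mat n n" and cp: "char_poly A = (\<Prod>k<n. [:- e k, 1:])"
  shows "(\<Sum>x | eigenvalue A x. real (Polynomial.order x (char_poly A)) * g x) = (\<Sum>k<n. g (e k))"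
proof -
  have "eigenvalue A x \<longleftrightarrow> x \<in> e ` {..<n}" for x
    unfolding eigenvalue_root_char_poly[OF assms(1)] cp poly_prod by auto
  then have ev: "{x. eigenvalue A x} = e ` {..<n}" by auto
  have ord: "Polynomial.order x (\<Prod>k\<in>K. [:- e k, 1:]) = card {k\<in>K. e k = x}" if "finite K" for x and K :: "nat set"
    using that
  proof (induction K)
    case (insert a K)
    have "Polynomial.order x (\<Prod>k\<in>insert a K. [:- e k, 1:]) =
        Polynomial.order x [:- e a, 1:] + card {k\<in>K. e k = x}"
      using insert by (simp add: order_mult prod_zero_iff del: mult_pCons_left)
    also have "Polynomial.order x [:- e a, 1:] = (if e a = x then 1 else 0)"
      using order_power_n_n[of x 1] order_root[of "[:- e a, 1:]" x] by auto
    also have "\<dots> + card {k\<in>K. e k = x} = card {k\<in>insert a K. e k = x}"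
    proof (cases "e a = x")
      case True
      then have "{k\<in>insert a K. e k = x} = insert a {k\<in>K. e k = x}" by auto
      then show ?thesis using insert True by simp
    next
      case False
      then have "{k\<in>insert a K. e k = x} = {k\<in>K. e k = x}" by auto
      then show ?thesis using False by simp
    qed
    finally show ?case .
  qed simp
  have "(\<Sum>k<n. g (e k)) = (\<Sum>x\<in>e ` {..<n}. \<Sum>k | k \<in> {..<n} \<and> e k = x. g (e k))"
    by (rule sum.image_gen) simp
  also have "\<dots> = (\<Sum>x\<in>e ` {..<n}. real (card {k\<in>{..<n}. e k = x}) * g x)"
    by (intro sum.cong refl) simp
  finally show ?thesis unfolding ev cp by (simp add: ord)
qed

text \<open>Eigenvectors \<open>w\<close> of \<open>\<rho>\<close> and the vectors \<open>u\<close> are orthogonal whenever their eigenvalues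
  differ, so any function of the eigenvalues may be moved from one family to the other under
  \<open>\<Sum> |\<langle>w, u\<rangle>|\<^sup>2\<close>. This avoids completing \<open>u\<close> to a basis.\<close>

lemma von_neumann_entropy_eigensum:
  assumes A: "A \<in> carrier_mat n n"
    and Ae: "\<And>i j. i < n \<Longrightarrow> j < n \<Longrightarrow> A $$ (i, j) = (\<Sum>k\<in>I. of_real (p k) * u k i * cnj (u k j))"
    and o: "ortho n I u" and fin: "finite I" and nn: "\<And>k. k \<in> I \<Longrightarrow> 0 \<le> p k"
  shows "von_neumann_entropy A = - (\<Sum>k\<in>I. p k * log 2 (p k))"
proof -
  have psd: "psd A" by (rule psd_eigensum[OF A Ae nn])
  obtain w \<alpha> where e: "eigensystem A n w \<alpha>" using spectral[OF psd_herm[OF psd]] A by auto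
  have ow: "ortho n {..<n} w" using e A by (auto simp: eigensystem_def)
  define h where "h x = x * log 2 x" for x :: real
  define c where "c m k = (cmod (ip n (w m) (u k)))\<^sup>2" for m k
  have apw: "app A (w m) i = (\<Sum>k\<in>I. of_real (p k) * ip n (w m) (u k) * u k i)" if "i < n" for m i
    by (rule app_of_eigensum[OF A]) (use Ae that in auto)
  have ev: "app A (w m) i = of_real (\<alpha> m) * w m i" if "m < n" "i < n" for m i
    using e that A by (auto simp: eigensystem_def)
  have match: "\<alpha> m = p k \<or> c m k = 0" if "m < n" "k \<in> I" for m k
  proof -
    have "of_real (\<alpha> m) * ip n (w m) (u k) = ip n (\<lambda>i. of_real (\<alpha> m) * w m i) (u k)"
      by (simp add: ip_scale_left)
    also have "\<dots> = ip n (\<lambda>i. \<Sum>l\<in>I. (of_real (p l) * ip n (w m) (u l)) * u l i) (u k)"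
      using apw ev that by (intro ip_cong) auto
    also have "\<dots> = of_real (p k) * ip n (w m) (u k)" by (rule ip_ortho_sum[OF o fin that(2)])
    finally show ?thesis by (auto simp: c_def)
  qed
  \<comment> \<open>The \<open>u k\<close> need not span the space, so a row may sum to less than 1;
    this happens only for \<open>\<alpha> m = 0\<close>, where \<open>h\<close> vanishes.\<close>
  have row: "\<alpha> m = 0 \<or> (\<Sum>k\<in>I. c m k) = 1" if "m < n" for m
  proof -
    have "complex_of_real (\<alpha> m) = ip n (\<lambda>i. of_real (\<alpha> m) * w m i) (w m)"
      using orthoD[OF ow, of m m] that by (simp add: ip_scale_left)
    also have "\<dots> = ip n (\<lambda>i. \<Sum>l\<in>I. (of_real (p l) * ip n (w m) (u l)) * u l i) (w m)"
      using apw ev that by (intro ip_cong) auto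
    also have "\<dots> = (\<Sum>l\<in>I. of_real (p l) * (ip n (w m) (u l) * cnj (ip n (w m) (u l))))"
      unfolding ip_sum_left by (intro sum.cong refl) (simp add: ip_commute[of n "u _" "w m"])
    also have "\<dots> = of_real (\<Sum>l\<in>I. p l * c m l)"
      by (simp add: c_def flip: complex_norm_square)
    finally have "\<alpha> m = (\<Sum>l\<in>I. p l * c m l)" by (simp only: of_real_eq_iff)
    also have "\<dots> = \<alpha> m * (\<Sum>l\<in>I. c m l)"
      unfolding sum_distrib_left using match[OF that] by (intro sum.cong refl) (metis mult_zero_right)
    finally show ?thesis by simp
  qed
  have col: "(\<Sum>m<n. c m k) = 1" if "k \<in> I" for k
  proof -
    have "(\<Sum>m<n. c m k) = (\<Sum>m<n. (cmod (ip n (u k) (w m)))\<^sup>2)"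
      unfolding c_def by (subst ip_commute) simp
    then show ?thesis using parseval[OF ow, of "u k"] ortho_nsq[OF o that] by simp
  qed
  have "(\<Sum>m<n. h (\<alpha> m)) = (\<Sum>m<n. \<Sum>k\<in>I. c m k * h (\<alpha> m))"
  proof (intro sum.cong refl)
    fix m assume "m \<in> {..<n}"
    then show "h (\<alpha> m) = (\<Sum>k\<in>I. c m k * h (\<alpha> m))"
      using row[of m] by (auto simp: h_def simp flip: sum_distrib_right)
  qed
  also have "\<dots> = (\<Sum>m<n. \<Sum>k\<in>I. c m k * h (p k))"
    using match by (intro sum.cong refl) (metis lessThan_iff mult_zero_left)
  also have "\<dots> = (\<Sum>k\<in>I. (\<Sum>m<n. c m k) * h (p k))"
    by (subst sum.swap) (simp add: sum_distrib_right)
  also have "\<dots> = (\<Sum>k\<in>I. h (p k))" by (simp add: col)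
  finally show ?thesis
    using sum_over_roots[OF A char_poly_eigensystem[OF e A], of "\<lambda>x. h (Re x)"]
    by (simp add: von_neumann_entropy_def h_def)
qed

section \<open>Rearrangement inequalities\<close>

text \<open>The bathtub principle: with weights at most 1 and of total at most \<open>l\<close>,
  nothing beats weight 1 on the \<open>l\<close> largest values.\<close>

lemma sum_capped_weights_le:
  fixes s c :: "nat \<Rightarrow> real"
  assumes "antimono s" "\<And>j. 0 \<le> s j" "\<And>j. j < r \<Longrightarrow> 0 \<le> c j \<and> c j \<le> 1" "(\<Sum>j<r. c j) \<le> real l"
  shows "(\<Sum>j<r. s j * c j) \<le> (\<Sum>j<l. s j)"
proof -
  define R where "R = max r l"
  define c' where "c' j = (if j < r then c j else 0)" for j
  have c': "(\<Sum>j<r. f j * c j) = (\<Sum>j<R. f j * c' j)" for f :: "nat \<Rightarrow> real"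
    by (rule sum.mono_neutral_cong_left) (auto simp: c'_def R_def)
  have ind: "(\<Sum>j<l. f j) = (\<Sum>j<R. f j * of_bool (j < l))" for f :: "nat \<Rightarrow> real"
    by (rule sum.mono_neutral_cong_left) (auto simp: R_def)
  \<comment> \<open>Comparison with the threshold \<open>s l\<close>: before \<open>l\<close> the
    weight can only be too small, from \<open>l\<close> on only too large, so every product has the
    right sign.\<close>
  have "(\<Sum>j<R. (s j - s l) * (c' j - of_bool (j < l))) \<le> 0"
  proof (rule sum_nonpos)
    fix j
    show "(s j - s l) * (c' j - of_bool (j < l)) \<le> 0"
    proof (cases "j < l")
      case True
      then have "s l \<le> s j" "c' j \<le> 1" using assms by (auto simp: antimono_def c'_def)
      then show ?thesis using True by (simp add: mult_nonneg_nonpos)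
    next
      case False
      then have "s j \<le> s l" "0 \<le> c' j" using assms by (auto simp: antimono_def c'_def)
      then show ?thesis using False by (simp add: mult_nonpos_nonneg)
    qed
  qed
  also have "(\<Sum>j<R. (s j - s l) * (c' j - of_bool (j < l))) =
      (\<Sum>j<R. s j * c' j) - (\<Sum>j<R. s j * of_bool (j < l)) - s l * ((\<Sum>j<R. 1 * c' j) - (\<Sum>j<R. 1 * of_bool (j < l)))"
    by (simp add: algebra_simps sum.distrib sum_subtractf sum_distrib_left)
  also have "\<dots> = (\<Sum>j<r. s j * c j) - (\<Sum>j<l. s j) - s l * ((\<Sum>j<r. c j) - real l)"
    unfolding c'[symmetric] ind[symmetric] by simp
  finally show ?thesis
    using mult_nonneg_nonpos[of "s l" "(\<Sum>j<r. c j) - real l"] assms(2)[of l] assms(4) by linarith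
qed

text \<open>Summation by parts: a decreasing nonnegative \<open>t\<close> is a nonnegative
  combination of indicators of initial segments, for which the inequality is assumed.\<close>

lemma abel_sum_mono:
  fixes t w z :: "nat \<Rightarrow> real"
  assumes "antimono t" "\<And>j. 0 \<le> t j" "\<And>l. (\<Sum>k<l. w k) \<le> (\<Sum>k<l. z k)"
  shows "(\<Sum>k<n. t k * w k) \<le> (\<Sum>k<n. t k * z k)"
proof -
  \<comment> \<open>The induction needs the boundary term of the summation by parts; it is
    nonnegative and is dropped afterwards.\<close>
  have "t n * (\<Sum>k<n. z k - w k) \<le> (\<Sum>k<n. t k * (z k - w k))"
  proof (induction n)
    case (Suc n)
    have "0 \<le> (\<Sum>k<Suc n. z k - w k)" using assms(3)[of "Suc n"] unfolding sum_subtractf by linarith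
    then have "t (Suc n) * (\<Sum>k<Suc n. z k - w k) \<le> t n * (\<Sum>k<Suc n. z k - w k)"
      by (rule mult_right_mono[rotated]) (use assms(1) in \<open>auto simp: antimono_def\<close>)
    also have "\<dots> \<le> (\<Sum>k<Suc n. t k * (z k - w k))"
      using Suc by (simp add: distrib_left)
    finally show ?case .
  qed simp
  moreover have "0 \<le> t n * (\<Sum>k<n. z k - w k)"
    using assms(2)[of n] assms(3)[of n] by (simp add: sum_subtractf)
  ultimately show ?thesis by (simp add: right_diff_distrib sum_subtractf)
qed

lemma sorted_enumeration:
  fixes f :: "'a \<Rightarrow> real"
  assumes "finite A"
  obtains g where "bij_betw g {..<card A} A" "\<And>i j. i \<le> j \<Longrightarrow> j < card A \<Longrightarrow> f (g j) \<le> f (g i)"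
proof -
  obtain xs where xs: "set xs = A" "distinct xs" using finite_distinct_list[OF assms] by blast
  define ys where "ys = sort_key (\<lambda>x. - f x) xs"
  have ys: "set ys = A" "distinct ys" "sorted (map (\<lambda>x. - f x) ys)"
    using xs by (auto simp: ys_def)
  have len: "length ys = card A" using ys distinct_card by metis
  have "bij_betw ((!) ys) {..<card A} A"
    using ys len by (metis bij_betw_nth)
  moreover have "f (ys ! j) \<le> f (ys ! i)" if "i \<le> j" "j < card A" for i j
    using sorted_nth_mono[OF ys(3), of i j] that len by simp
  ultimately show ?thesis using that by blast
qed

section \<open>Schmidt decompositions\<close>

text \<open>\<open>p\<close> holds squared coefficients and is not normalized, so that the branches
  of a measurement are covered; zero coefficients are allowed, as in
  \<open>schmidt_distribution\<close>.\<close>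

definition schmidt :: "complex mat \<Rightarrow> 'k set \<Rightarrow> ('k \<Rightarrow> real) \<Rightarrow> ('k \<Rightarrow> nat \<Rightarrow> complex) \<Rightarrow> ('k \<Rightarrow> nat \<Rightarrow> complex) \<Rightarrow> bool" where
  "schmidt C I p u v \<longleftrightarrow> finite I \<and> (\<forall>k\<in>I. 0 \<le> p k) \<and> ortho (dim_row C) I u \<and> ortho (dim_col C) I v \<and>
     (\<forall>i<dim_row C. \<forall>j<dim_col C. C $$ (i, j) = (\<Sum>k\<in>I. of_real (sqrt (p k)) * u k i * v k j))"

text \<open>Continuing \<open>p\<close> by 0 lets partial sums of any length be compared, as
  \<open>decr_prob\<close> does.\<close>

definition sorted_schmidt :: "complex mat \<Rightarrow> nat \<Rightarrow> (nat \<Rightarrow> real) \<Rightarrow> (nat \<Rightarrow> nat \<Rightarrow> complex) \<Rightarrow> (nat \<Rightarrow> nat \<Rightarrow> complex) \<Rightarrow> bool" where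
  "sorted_schmidt C r p u v \<longleftrightarrow> schmidt C {..<r} p u v \<and> antimono p \<and> (\<forall>k. 0 \<le> p k) \<and> (\<forall>k\<ge>r. p k = 0)"

lemma schmidtD:
  assumes "schmidt C I p u v"
  shows "finite I" "\<And>k. k \<in> I \<Longrightarrow> 0 \<le> p k" "ortho (dim_row C) I u" "ortho (dim_col C) I v"
    "\<And>i j. i < dim_row C \<Longrightarrow> j < dim_col C \<Longrightarrow> C $$ (i, j) = (\<Sum>k\<in>I. of_real (sqrt (p k)) * u k i * v k j)"
  using assms unfolding schmidt_def by blast+

lemma sorted_schmidtD:
  assumes "sorted_schmidt C r p u v"
  shows "schmidt C {..<r} p u v" "antimono p" "\<And>k. 0 \<le> p k" "\<And>k. r \<le> k \<Longrightarrow> p k = 0"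
  using assms unfolding sorted_schmidt_def by blast+

lemma schmidt_transpose:
  assumes "schmidt C I p u v"
  shows "schmidt (transpose_mat C) I p v u"
  using assms by (auto simp: schmidt_def mult_ac)

lemma sorted_schmidt_transpose: "sorted_schmidt C r p u v \<Longrightarrow> sorted_schmidt (transpose_mat C) r p v u"
  by (auto simp: sorted_schmidt_def schmidt_transpose)

lemma schmidt_app:
  assumes "schmidt C I p u v" "i < dim_row C"
  shows "app C x i = (\<Sum>k\<in>I. (of_real (sqrt (p k)) * ip (dim_col C) x (\<lambda>j. cnj (v k j))) * u k i)"
proof -
  have "app C x i = (\<Sum>j<dim_col C. \<Sum>k\<in>I. of_real (sqrt (p k)) * u k i * v k j * x j)"
    using schmidtD(5)[OF assms(1)] assms(2) by (simp add: app_def sum_distrib_right)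
  then show ?thesis
    by (subst (asm) sum.swap) (simp add: ip_def sum_distrib_left sum_distrib_right mult_ac)
qed

lemma schmidt_nsq_app:
  assumes "schmidt C I p u v"
  shows "nsq (dim_row C) (app C x) = (\<Sum>k\<in>I. p k * (cmod (ip (dim_col C) x (\<lambda>j. cnj (v k j))))\<^sup>2)"
proof -
  have "nsq (dim_row C) (app C x) =
      nsq (dim_row C) (\<lambda>i. \<Sum>k\<in>I. (of_real (sqrt (p k)) * ip (dim_col C) x (\<lambda>j. cnj (v k j))) * u k i)"
    by (intro nsq_cong schmidt_app[OF assms])
  also have "\<dots> = (\<Sum>k\<in>I. (cmod (of_real (sqrt (p k)) * ip (dim_col C) x (\<lambda>j. cnj (v k j))))\<^sup>2)"
    by (rule nsq_ortho_sum) (use schmidtD[OF assms] in auto)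
  also have "\<dots> = (\<Sum>k\<in>I. p k * (cmod (ip (dim_col C) x (\<lambda>j. cnj (v k j))))\<^sup>2)"
    using schmidtD(2)[OF assms] by (intro sum.cong refl) (simp add: norm_mult power_mult_distrib)
  finally show ?thesis .
qed

definition frob_sq :: "complex mat \<Rightarrow> real" where
  "frob_sq C = (\<Sum>j<dim_col C. nsq (dim_row C) (\<lambda>i. C $$ (i, j)))"

lemma app_unit: "j < dim_col C \<Longrightarrow> app C (\<lambda>l. if l = j then 1 else 0) i = C $$ (i, j)"
  by (simp add: app_def if_distrib[where f="\<lambda>z. _ * z"] cong: if_cong)

lemma frob_sq_app: "frob_sq C = (\<Sum>j<dim_col C. nsq (dim_row C) (app C (\<lambda>l. if l = j then 1 else 0)))"
  unfolding frob_sq_def by (intro sum.cong nsq_cong refl) (simp add: app_unit)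

lemma schmidt_frob_sq:
  assumes "schmidt C I p u v"
  shows "frob_sq C = (\<Sum>k\<in>I. p k)"
proof -
  have "frob_sq C = (\<Sum>j<dim_col C. \<Sum>k\<in>I. p k * (cmod (v k j))\<^sup>2)"
    unfolding frob_sq_app schmidt_nsq_app[OF assms] by (intro sum.cong refl) (simp add: ip_unit)
  also have "\<dots> = (\<Sum>k\<in>I. p k * nsq (dim_col C) (v k))"
    by (subst sum.swap) (simp add: nsq_def sum_distrib_left)
  also have "\<dots> = (\<Sum>k\<in>I. p k)"
    using ortho_nsq[OF schmidtD(4)[OF assms]] by simp
  finally show ?thesis .
qed

lemma schmidt_reindex:
  assumes s: "schmidt C I p u v" and g: "bij_betw g J I"
  shows "schmidt C J (\<lambda>k. p (g k)) (\<lambda>k. u (g k)) (\<lambda>k. v (g k))"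
proof -
  have g': "inj_on g J" "g ` J \<subseteq> I" "finite J" using g schmidtD(1)[OF s] by (auto simp: bij_betw_def bij_betw_finite finite_image_iff)
  show ?thesis unfolding schmidt_def
  proof (intro conjI ballI allI impI)
    fix i j assume "i < dim_row C" "j < dim_col C"
    then show "C $$ (i, j) = (\<Sum>k\<in>J. of_real (sqrt (p (g k))) * u (g k) i * v (g k) j)"
      using schmidtD(5)[OF s] sum.reindex_bij_betw[OF g, of "\<lambda>k. of_real (sqrt (p k)) * u k i * v k j"] by simp
  qed (use g' schmidtD[OF s] in \<open>auto intro: ortho_reindex\<close>)
qed

lemma schmidt_sort:
  assumes s: "schmidt C I p u v"
  shows "\<exists>g. bij_betw g {..<card I} I \<and>
    sorted_schmidt C (card I) (\<lambda>k. if k < card I then p (g k) else 0) (\<lambda>k. u (g k)) (\<lambda>k. v (g k))"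
proof -
  obtain g where g: "bij_betw g {..<card I} I" "\<And>i j. i \<le> j \<Longrightarrow> j < card I \<Longrightarrow> p (g j) \<le> p (g i)"
    using sorted_enumeration[OF schmidtD(1)[OF s]] by blast
  have nn: "0 \<le> p (g k)" if "k < card I" for k
    using schmidtD(2)[OF s] g(1) that by (auto simp: bij_betw_def)
  have "schmidt C {..<card I} (\<lambda>k. if k < card I then p (g k) else 0) (\<lambda>k. u (g k)) (\<lambda>k. v (g k))"
    using schmidt_reindex[OF s g(1)] by (auto simp: schmidt_def)
  then show ?thesis using g nn by (auto simp: sorted_schmidt_def antimono_def)
qed

text \<open>Singular values from the Gram matrix \<open>G\<close> of the columns: the images
  \<open>app C (w k)\<close> of its eigenvectors are orthogonal with squared norms
  \<open>\<alpha> k\<close>, and normalized they are the left vectors. The right vectors are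
  conjugated because a Schmidt decomposition multiplies \<open>u k i\<close> by \<open>v k j\<close>
  without conjugation.\<close>

lemma schmidt_exists: "\<exists>I p u v. schmidt C (I :: nat set) p u v"
proof -
  define m n where "m = dim_row C" and "n = dim_col C"
  define G where "G = mat n n (\<lambda>(i, j). ip m (\<lambda>a. C $$ (a, j)) (\<lambda>a. C $$ (a, i)))"
  have G: "G \<in> carrier_mat n n" by (simp add: G_def)
  have "herm G" by (rule hermI[OF G]) (simp add: G_def, rule ip_commute)
  then obtain w \<alpha> where e: "eigensystem G n w \<alpha>" using spectral G by (metis carrier_matD(1))
  have o: "ortho n {..<n} w" using e G by (auto simp: eigensystem_def)
  have C: "ip m (app C (w k)) (app C (w l)) = (if k = l then of_real (\<alpha> k) else 0)" if kl: "k < n" "l < n" for k l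
  proof -
    have ap: "app C x = (\<lambda>a. \<Sum>j<n. x j * C $$ (a, j))" for x
      by (auto simp: app_def n_def mult.commute)
    have "ip m (app C (w k)) (app C (w l)) = (\<Sum>i<n. cnj (w l i) * (\<Sum>j<n. w k j * G $$ (i, j)))"
      unfolding ap ip_sum_left ip_sum_right
      by (simp add: G_def sum_distrib_left) (subst sum.swap, simp add: mult_ac)
    also have "\<dots> = ip n (app G (w k)) (w l)"
      using G by (simp add: ip_def app_def mult.commute)
    also have "\<dots> = ip n (\<lambda>i. of_real (\<alpha> k) * w k i) (w l)"
      using e kl G by (intro ip_cong) (auto simp: eigensystem_def)
    also have "\<dots> = (if k = l then of_real (\<alpha> k) else 0)"
      using orthoD[OF o] kl by (simp add: ip_scale_left)
    finally show ?thesis .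
  qed
  have nsqC: "nsq m (app C (w k)) = \<alpha> k" if "k < n" for k
    using C[OF that that] by (simp add: ip_self)
  then have nn: "0 \<le> \<alpha> k" if "k < n" for k using nsq_nonneg that by metis
  \<comment> \<open>Where the eigenvalue is 0 the image is 0 too; it cannot be normalized and
    contributes nothing.\<close>
  define I where "I = {k. k < n \<and> \<alpha> k > 0}"
  define u where "u k i = of_real (1 / sqrt (\<alpha> k)) * app C (w k) i" for k i
  define v where "v k j = cnj (w k j)" for k j
  have ou: "ortho m I u"
    unfolding ortho_def
  proof (intro ballI)
    fix k l assume "k \<in> I" "l \<in> I"
    then show "ip m (u k) (u l) = (if k = l then 1 else 0)"
      unfolding u_def ip_scale_left ip_scale_right using C[of k l]
      by (auto simp: I_def field_simps simp flip: of_real_mult)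
  qed
  have ov: "ortho n I v"
    unfolding v_def using ortho_cnj[OF o] by (rule ortho_subset) (auto simp: I_def)
  have "schmidt C I \<alpha> u v"
    unfolding schmidt_def m_def[symmetric] n_def[symmetric]
  proof (intro conjI ballI allI impI)
    fix i j assume ij: "i < m" "j < n"
    have "C $$ (i, j) = (\<Sum>l<n. if l = j then C $$ (i, l) else 0)" using ij by simp
    also have "\<dots> = (\<Sum>l<n. C $$ (i, l) * (\<Sum>k<n. w k l * cnj (w k j)))"
      using ij by (intro sum.cong refl) (subst ortho_delta[OF o], auto)
    also have "\<dots> = (\<Sum>k<n. app C (w k) i * cnj (w k j))"
      unfolding app_def n_def[symmetric] sum_distrib_left sum_distrib_right
      by (subst sum.swap) (simp add: mult_ac)
    also have "\<dots> = (\<Sum>k\<in>I. of_real (sqrt (\<alpha> k)) * u k i * v k j)"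
    proof (rule sum.mono_neutral_cong_right)
      show "\<forall>k\<in>{..<n} - I. app C (w k) i * cnj (w k j) = 0"
      proof
        fix k assume "k \<in> {..<n} - I"
        then have "k < n" "\<alpha> k = 0" using nn[of k] by (auto simp: I_def)
        then have "nsq m (app C (w k)) = 0" using nsqC by simp
        then show "app C (w k) i * cnj (w k j) = 0" using ij by (simp add: nsq_0_iff)
      qed
    next
      fix k assume "k \<in> I"
      then show "app C (w k) i * cnj (w k j) = of_real (sqrt (\<alpha> k)) * u k i * v k j"
        by (simp add: I_def u_def v_def)
    qed (auto simp: I_def)
    finally show "C $$ (i, j) = (\<Sum>k\<in>I. of_real (sqrt (\<alpha> k)) * u k i * v k j)" .
  qed (use ou ov in \<open>auto simp: I_def\<close>)
  then show ?thesis by blast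
qed

section \<open>Squared singular values and Ky Fan's principle\<close>

definition sq_sing :: "complex mat \<Rightarrow> nat \<Rightarrow> real" where
  "sq_sing C = (SOME p. \<exists>r u v. sorted_schmidt C r p u v)"

lemma sq_sing_schmidt: obtains r u v where "sorted_schmidt C r (sq_sing C) u v"
proof -
  obtain I p u v where "schmidt C (I :: nat set) p u v" using schmidt_exists by blast
  from schmidt_sort[OF this] have "\<exists>p r u v. sorted_schmidt C r p u v" by blast
  then have "\<exists>r u v. sorted_schmidt C r (sq_sing C) u v" unfolding sq_sing_def by (rule someI_ex)
  then show ?thesis using that by blast
qed

lemma schmidt_card_le:
  assumes "schmidt C I p u v"
  shows "card I \<le> dim_row C" "card I \<le> dim_col C"
  using schmidtD[OF assms] by (auto intro: ortho_card_le)

text \<open>The norms add up to the \<open>p k\<close> weighted by \<open>c k\<close>, the squared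
  length of the projection of the \<open>k\<close>-th right singular vector onto the span of the
  \<open>x j\<close>. Bessel's inequality for the \<open>x j\<close> caps each weight at 1, and for
  the singular vectors it caps the total at \<open>card J\<close>.\<close>

lemma ky_fan:
  assumes s: "sorted_schmidt C r p u v" and x: "ortho (dim_col C) J x" "finite J"
  shows "(\<Sum>j\<in>J. nsq (dim_row C) (app C (x j))) \<le> (\<Sum>k<card J. p k)"
proof -
  note s' = sorted_schmidtD[OF s]
  let ?n = "dim_col C"
  have ov: "ortho ?n {..<r} (\<lambda>k j. cnj (v k j))" using ortho_cnj schmidtD(4)[OF s'(1)] by blast
  define c where "c k = (\<Sum>j\<in>J. (cmod (ip ?n (x j) (\<lambda>j. cnj (v k j))))\<^sup>2)" for k
  have "(\<Sum>j\<in>J. nsq (dim_row C) (app C (x j))) = (\<Sum>k<r. p k * c k)"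
    unfolding schmidt_nsq_app[OF s'(1)] c_def sum_distrib_left by (rule sum.swap)
  also have "\<dots> \<le> (\<Sum>k<card J. p k)"
  proof (rule sum_capped_weights_le[OF s'(2,3)])
    fix k assume k: "k < r"
    have "c k = (\<Sum>j\<in>J. (cmod (ip ?n (\<lambda>j. cnj (v k j)) (x j)))\<^sup>2)"
      unfolding c_def by (subst ip_commute) simp
    also have "\<dots> \<le> nsq ?n (\<lambda>j. cnj (v k j))" by (rule bessel[OF x])
    also have "\<dots> = 1" using ortho_nsq[OF ov] k by simp
    finally show "0 \<le> c k \<and> c k \<le> 1" by (simp add: c_def sum_nonneg)
  next
    have "(\<Sum>k<r. c k) = (\<Sum>j\<in>J. \<Sum>k<r. (cmod (ip ?n (x j) (\<lambda>j. cnj (v k j))))\<^sup>2)"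
      unfolding c_def by (rule sum.swap)
    also have "\<dots> \<le> (\<Sum>j\<in>J. nsq ?n (x j))" by (intro sum_mono bessel[OF ov]) simp
    also have "\<dots> = real (card J)" using ortho_nsq[OF x(1)] by simp
    finally show "(\<Sum>k<r. c k) \<le> real (card J)" .
  qed
  finally show ?thesis .
qed

lemma ky_fan_attained:
  assumes s: "schmidt C I p u v" and "J \<subseteq> I"
  shows "(\<Sum>k\<in>J. nsq (dim_row C) (app C (\<lambda>j. cnj (v k j)))) = (\<Sum>k\<in>J. p k)"
proof (intro sum.cong refl)
  fix k assume "k \<in> J"
  then have k: "k \<in> I" using assms by blast
  have "nsq (dim_row C) (app C (\<lambda>j. cnj (v k j))) = (\<Sum>l\<in>I. if l = k then p l else 0)"
    unfolding schmidt_nsq_app[OF s] by (intro sum.cong refl) (simp add: orthoD[OF ortho_cnj[OF schmidtD(4)[OF s]] k])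
  then show "nsq (dim_row C) (app C (\<lambda>j. cnj (v k j))) = p k" using k schmidtD(1)[OF s] by simp
qed

text \<open>A Ky Fan maximizer for the state before the measurement is a competitor for each of the
  states after it.\<close>

lemma sorted_schmidt_measurement:
  assumes s: "schmidt C I p u v" "J \<subseteq> I" and "finite S"
    and D: "\<And>i. i \<in> S \<Longrightarrow> dim_col (D i) = dim_col C"
    and s': "\<And>i. i \<in> S \<Longrightarrow> sorted_schmidt (D i) (r' i) (q i) (u' i) (v' i)"
    and iso: "\<And>x. (\<Sum>i\<in>S. nsq (dim_row (D i)) (app (D i) x)) = nsq (dim_row C) (app C x)"
  shows "(\<Sum>k\<in>J. p k) \<le> (\<Sum>i\<in>S. \<Sum>k<card J. q i k)"
proof -
  have J: "finite J" using s schmidtD(1) finite_subset by blast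
  have "(\<Sum>k\<in>J. p k) = (\<Sum>k\<in>J. nsq (dim_row C) (app C (\<lambda>j. cnj (v k j))))"
    using ky_fan_attained[OF s] by simp
  also have "\<dots> = (\<Sum>i\<in>S. \<Sum>k\<in>J. nsq (dim_row (D i)) (app (D i) (\<lambda>j. cnj (v k j))))"
    unfolding iso[symmetric] by (rule sum.swap)
  also have "\<dots> \<le> (\<Sum>i\<in>S. \<Sum>k<card J. q i k)"
  proof (intro sum_mono ky_fan[OF s'] J)
    fix i assume "i \<in> S"
    then show "ortho (dim_col (D i)) J (\<lambda>k j. cnj (v k j))"
      unfolding D[OF \<open>i \<in> S\<close>] using s by (intro ortho_cnj) (auto dest: schmidtD intro: ortho_subset)
  qed
  finally show ?thesis .
qed

text \<open>The Hilbert-Schmidt inner product, which is the overlap of the two state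
  vectors.\<close>

definition mip :: "complex mat \<Rightarrow> complex mat \<Rightarrow> complex" where
  "mip C D = (\<Sum>i<dim_row C. \<Sum>j<dim_col C. C $$ (i, j) * cnj (D $$ (i, j)))"

lemma mip_schmidt:
  assumes "schmidt C I p u v" "schmidt D J q x y" "dim_row D = dim_row C" "dim_col D = dim_col C"
  shows "mip C D = (\<Sum>k\<in>I. \<Sum>l\<in>J. of_real (sqrt (p k) * sqrt (q l)) * (ip (dim_row C) (u k) (x l) * ip (dim_col C) (v k) (y l)))"
proof -
  let ?m = "dim_row C" and ?n = "dim_col C"
  have "mip C D = (\<Sum>i<?m. ip ?n (\<lambda>j. \<Sum>k\<in>I. (of_real (sqrt (p k)) * u k i) * v k j) (\<lambda>j. \<Sum>l\<in>J. (of_real (sqrt (q l)) * x l i) * y l j))"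
    unfolding mip_def ip_def using schmidtD(5)[OF assms(1)] schmidtD(5)[OF assms(2)] assms(3,4)
    by (intro sum.cong refl) simp
  also have "\<dots> = (\<Sum>i<?m. \<Sum>k\<in>I. \<Sum>l\<in>J. of_real (sqrt (p k) * sqrt (q l)) * ip ?n (v k) (y l) * (u k i * cnj (x l i)))"
    unfolding ip_sum_left ip_sum_right by (simp add: sum_distrib_left mult_ac)
  also have "\<dots> = (\<Sum>k\<in>I. \<Sum>i<?m. \<Sum>l\<in>J. of_real (sqrt (p k) * sqrt (q l)) * ip ?n (v k) (y l) * (u k i * cnj (x l i)))"
    by (rule sum.swap)
  also have "\<dots> = (\<Sum>k\<in>I. \<Sum>l\<in>J. \<Sum>i<?m. of_real (sqrt (p k) * sqrt (q l)) * ip ?n (v k) (y l) * (u k i * cnj (x l i)))"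
    by (intro sum.cong refl sum.swap)
  also have "\<dots> = (\<Sum>k\<in>I. \<Sum>l\<in>J. of_real (sqrt (p k) * sqrt (q l)) * (ip ?m (u k) (x l) * ip ?n (v k) (y l)))"
    unfolding ip_def[of ?m] by (simp add: sum_distrib_left sum_distrib_right mult_ac)
  finally show ?thesis .
qed

text \<open>The inequality of arithmetic and geometric means replaces the products of overlaps of
  left and of right vectors by the entries of \<open>M\<close>, whose rows and columns sum to at
  most 1 by Bessel's inequality. For such a matrix the aligned pairing of two decreasing sequences
  is the best one.\<close>

lemma von_neumann_trace_inequality:
  assumes C: "sorted_schmidt C r p u v" and D: "sorted_schmidt D r' q x y"
    and dim: "dim_row D = dim_row C" "dim_col D = dim_col C"
  shows "cmod (mip C D) \<le> (\<Sum>k<r'. sqrt (q k) * sqrt (p k))"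
proof -
  note C' = sorted_schmidtD[OF C] and D' = sorted_schmidtD[OF D]
  let ?m = "dim_row C" and ?n = "dim_col C"
  define a where "a j k = cmod (ip ?m (u j) (x k))" for j k
  define b where "b j k = cmod (ip ?n (v j) (y k))" for j k
  define M where "M j k = ((a j k)\<^sup>2 + (b j k)\<^sup>2) / 2" for j k
  have M0: "0 \<le> M j k" for j k by (simp add: M_def)
  have a': "a j k = cmod (ip ?m (x k) (u j))" and b': "b j k = cmod (ip ?n (y k) (v j))" for j k
    unfolding a_def b_def by (subst ip_commute, simp)+
  have sqM: "(\<Sum>k\<in>K. M j k) = ((\<Sum>k\<in>K. (a j k)\<^sup>2) + (\<Sum>k\<in>K. (b j k)\<^sup>2)) / 2" for K j
    by (simp add: M_def sum.distrib flip: sum_divide_distrib)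
  have sqM': "(\<Sum>j\<in>K. M j k) = ((\<Sum>j\<in>K. (a j k)\<^sup>2) + (\<Sum>j\<in>K. (b j k)\<^sup>2)) / 2" for K k
    by (simp add: M_def sum.distrib flip: sum_divide_distrib)
  have ou: "ortho ?m {..<r} u" "ortho ?n {..<r} v" using schmidtD[OF C'(1)] by auto
  have ox: "ortho ?m {..<r'} x" "ortho ?n {..<r'} y" using schmidtD[OF D'(1)] dim by auto
  have Mrow: "(\<Sum>k<r'. M j k) \<le> 1" if "j < r" for j
    using bessel[OF ox(1), of "u j"] bessel[OF ox(2), of "v j"] ortho_nsq[OF ou(1), of j] ortho_nsq[OF ou(2), of j] that
    unfolding sqM a_def b_def by simp
  have Mcol: "(\<Sum>j<r. M j k) \<le> 1" if "k < r'" for k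
    using bessel[OF ou(1), of "x k"] bessel[OF ou(2), of "y k"] ortho_nsq[OF ox(1), of k] ortho_nsq[OF ox(2), of k] that
    unfolding sqM' a' b' by simp
  have sp: "antimono (\<lambda>k. sqrt (p k))" "\<And>k. 0 \<le> sqrt (p k)" using C' by (auto simp: antimono_def)
  have sq: "antimono (\<lambda>k. sqrt (q k))" "\<And>k. 0 \<le> sqrt (q k)" using D' by (auto simp: antimono_def)
  \<comment> \<open>What \<open>M\<close> makes of \<open>sqrt (p j)\<close>. Its partial sums stay
    below those of \<open>sqrt (p j)\<close> by the bathtub principle, with \<open>M\<close> summed
    over the first columns as weights; then summation by parts applies. The cutoff at
    \<open>r'\<close> makes this true for every length.\<close>
  define w where "w k = (if k < r' then \<Sum>j<r. sqrt (p j) * M j k else 0)" for k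
  have "cmod (mip C D) \<le> (\<Sum>j<r. \<Sum>k<r'. sqrt (p j) * sqrt (q k) * (a j k * b j k))"
    unfolding mip_schmidt[OF C'(1) D'(1) dim]
    by (rule order_trans[OF norm_sum], intro sum_mono, rule order_trans[OF norm_sum], intro sum_mono)
      (simp add: norm_mult a_def b_def C'(3) D'(3))
  also have "\<dots> \<le> (\<Sum>j<r. \<Sum>k<r'. sqrt (p j) * sqrt (q k) * M j k)"
  proof (intro sum_mono mult_left_mono)
    show "a j k * b j k \<le> M j k" for j k
      using sum_squares_bound[of "a j k" "b j k"] by (simp add: M_def)
  qed (simp add: C'(3) D'(3))
  also have "\<dots> = (\<Sum>k<r'. sqrt (q k) * w k)"
    by (subst sum.swap) (simp add: w_def sum_distrib_left mult_ac)
  also have "\<dots> \<le> (\<Sum>k<r'. sqrt (q k) * sqrt (p k))"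
  proof (rule abel_sum_mono[OF sq])
    fix l
    have "(\<Sum>k<l. w k) = (\<Sum>k<min l r'. \<Sum>j<r. sqrt (p j) * M j k)"
      by (rule sum.mono_neutral_cong_right) (auto simp: w_def)
    also have "\<dots> = (\<Sum>j<r. sqrt (p j) * (\<Sum>k<min l r'. M j k))"
      by (subst sum.swap) (simp add: sum_distrib_left)
    also have "\<dots> \<le> (\<Sum>j<l. sqrt (p j))"
    proof (rule sum_capped_weights_le[OF sp])
      fix j assume "j < r"
      have "(\<Sum>k<min l r'. M j k) \<le> (\<Sum>k<r'. M j k)"
        by (intro sum_mono2) (auto simp: M0)
      then show "0 \<le> (\<Sum>k<min l r'. M j k) \<and> (\<Sum>k<min l r'. M j k) \<le> 1"
        using Mrow[OF \<open>j < r\<close>] by (auto intro: sum_nonneg M0)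
    next
      have "(\<Sum>j<r. \<Sum>k<min l r'. M j k) = (\<Sum>k<min l r'. \<Sum>j<r. M j k)" by (rule sum.swap)
      also have "\<dots> \<le> (\<Sum>k<min l r'. 1)" by (intro sum_mono Mcol) auto
      finally show "(\<Sum>j<r. \<Sum>k<min l r'. M j k) \<le> real l" by simp
    qed
    finally show "(\<Sum>k<l. w k) \<le> (\<Sum>k<l. sqrt (p k))" .
  qed
  finally show ?thesis .
qed

section \<open>LOCC protocols on pure states\<close>

lemma sum_div_mod:
  fixes f :: "nat \<Rightarrow> nat \<Rightarrow> 'a :: comm_monoid_add"
  shows "(\<Sum>b<m * n. f (b div n) (b mod n)) = (\<Sum>i<m. \<Sum>j<n. f i j)"
proof -
  have "(\<Sum>b<m * n. f (b div n) (b mod n)) = (\<Sum>i<m. \<Sum>b\<in>{i * n..<i * n + n}. f (b div n) (b mod n))"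
    by (rule sum.nat_group[symmetric])
  also have "\<dots> = (\<Sum>i<m. \<Sum>j<n. f i j)"
  proof (rule sum.cong[OF refl])
    fix i
    have "(\<Sum>b\<in>{i * n..<i * n + n}. f (b div n) (b mod n)) = (\<Sum>j\<in>{0..<n}. f ((j + i * n) div n) ((j + i * n) mod n))"
      using sum.shift_bounds_nat_ivl[of "\<lambda>b. f (b div n) (b mod n)" 0 "i * n" n] by (simp add: add.commute)
    also have "\<dots> = (\<Sum>j<n. f i j)" by (intro sum.cong) auto
    finally show "(\<Sum>b\<in>{i * n..<i * n + n}. f (b div n) (b mod n)) = (\<Sum>j<n. f i j)" .
  qed
  finally show ?thesis .
qed

lemma div_mod_less:
  assumes "a < m * (n :: nat)"
  shows "a div n < m" "a mod n < n"
proof -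
  have "0 < n" using assms by (cases n) auto
  then show "a div n < m" "a mod n < n" using assms by (auto simp: less_mult_imp_div_less)
qed

definition amp :: "complex mat \<Rightarrow> nat \<Rightarrow> complex" where
  "amp C a = C $$ (a div dim_col C, a mod dim_col C)"

text \<open>The probabilities are hidden in the norms of the unnormalized states \<open>Cs\<close>;
  concatenation of lists is addition of operators.\<close>

definition mixture :: "nat \<Rightarrow> complex mat list \<Rightarrow> complex mat" where
  "mixture N Cs = mat N N (\<lambda>(a, b). \<Sum>C\<leftarrow>Cs. amp C a * cnj (amp C b))"

lemma mixture_carrier [simp]: "mixture N Cs \<in> carrier_mat N N" "dim_row (mixture N Cs) = N" "dim_col (mixture N Cs) = N"
  by (auto simp: mixture_def)

lemma density_mixture: "C \<in> carrier_mat dA dB \<Longrightarrow> density C = mixture (dA * dB) [C]"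
  by (auto simp: density_def Let_def mixture_def state_vec_def amp_def intro!: eq_matI)

lemma mixture_conj:
  assumes A: "A \<in> carrier_mat M N" and h: "\<And>C a. C \<in> set Cs \<Longrightarrow> a < M \<Longrightarrow> app A (amp C) a = amp (h C) a"
  shows "A * mixture N Cs * mat_adjoint A = mixture M (map h Cs)"
proof (rule eq_matI, goal_cases)
  case (1 i j)
  then have ij: "i < M" "j < M" by auto
  have *: "(A * mixture N Cs) $$ (i, b) = (\<Sum>C\<leftarrow>Cs. app A (amp C) i * cnj (amp C b))" if "b < N" for b
  proof -
    have "(A * mixture N Cs) $$ (i, b) = (\<Sum>k<N. \<Sum>C\<leftarrow>Cs. A $$ (i, k) * amp C k * cnj (amp C b))"
      using A ij that by (simp add: index_mult_mat_sum mixture_def sum_list_const_mult[symmetric] mult.assoc del: index_mult_mat(1))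
    also have "\<dots> = (\<Sum>C\<leftarrow>Cs. \<Sum>k<N. A $$ (i, k) * amp C k * cnj (amp C b))"
      by (induction Cs) (auto simp: sum.distrib)
    also have "\<dots> = (\<Sum>C\<leftarrow>Cs. app A (amp C) i * cnj (amp C b))"
      using A by (simp add: app_def sum_distrib_right)
    finally show ?thesis .
  qed
  have "(A * mixture N Cs * mat_adjoint A) $$ (i, j) = (\<Sum>b<N. \<Sum>C\<leftarrow>Cs. app A (amp C) i * (cnj (A $$ (j, b)) * cnj (amp C b)))"
    using A ij by (subst index_mult_mat_sum) (auto simp: * sum_list_mult_const[symmetric] sum_list_const_mult[symmetric] mult_ac simp del: index_mult_mat(1))
  also have "\<dots> = (\<Sum>C\<leftarrow>Cs. \<Sum>b<N. app A (amp C) i * (cnj (A $$ (j, b)) * cnj (amp C b)))"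
    by (induction Cs) (auto simp: sum.distrib)
  also have "\<dots> = (\<Sum>C\<leftarrow>Cs. app A (amp C) i * cnj (app A (amp C) j))"
    using A by (simp add: app_def[of _ _ j] cnj_sum sum_distrib_left)
  also have "\<dots> = (\<Sum>C\<leftarrow>Cs. amp (h C) i * cnj (amp (h C) j))"
    using h ij by (intro arg_cong[of _ _ sum_list] map_cong) auto
  finally show ?case using ij by (simp add: mixture_def o_def)
qed (use A in auto)

lemma kron_carrier: "A \<in> carrier_mat a b \<Longrightarrow> B \<in> carrier_mat c d \<Longrightarrow> kron A B \<in> carrier_mat (a * c) (b * d)"
  by (auto simp: kron_def)

lemma app_kron_amp:
  assumes "A \<in> carrier_mat a b" "B \<in> carrier_mat c d" "C \<in> carrier_mat b d" "x < a * c"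
  shows "app (kron A B) (amp C) x = (\<Sum>k<b. \<Sum>l<d. A $$ (x div c, k) * B $$ (x mod c, l) * C $$ (k, l))"
proof -
  have "app (kron A B) (amp C) x = (\<Sum>y<b * d. A $$ (x div c, y div d) * B $$ (x mod c, y mod d) * C $$ (y div d, y mod d))"
    using assms by (auto simp: app_def kron_def amp_def)
  then show ?thesis
    using sum_div_mod[of "\<lambda>k l. A $$ (x div c, k) * B $$ (x mod c, l) * C $$ (k, l)" d b] by simp
qed

lemma app_kron_alice:
  assumes "K \<in> carrier_mat d dA" "C \<in> carrier_mat dA dB" "x < d * dB"
  shows "app (kron K (1\<^sub>m dB)) (amp C) x = amp (K * C) x"
proof -
  have x: "x div dB < d" "x mod dB < dB" using div_mod_less[OF assms(3)] by auto
  have "app (kron K (1\<^sub>m dB)) (amp C) x = (\<Sum>k<dA. \<Sum>l<dB. if l = x mod dB then K $$ (x div dB, k) * C $$ (k, l) else 0)"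
    by (subst app_kron_amp[OF assms(1) one_carrier_mat assms(2,3)], intro sum.cong refl) (use x in auto)
  also have "\<dots> = (\<Sum>k<dA. K $$ (x div dB, k) * C $$ (k, x mod dB))" using x by simp
  also have "\<dots> = amp (K * C) x"
    using assms x by (simp add: amp_def index_mult_mat_sum del: index_mult_mat(1))
  finally show ?thesis .
qed

text \<open>Transposed and not conjugated, because \<open>K\<close> contracts the column index of
  \<open>C\<close> directly.\<close>

lemma app_kron_bob:
  assumes "K \<in> carrier_mat d dB" "C \<in> carrier_mat dA dB" "x < dA * d"
  shows "app (kron (1\<^sub>m dA) K) (amp C) x = amp (C * transpose_mat K) x"
proof -
  have x: "x div d < dA" "x mod d < d" using div_mod_less[OF assms(3)] by auto
  have "app (kron (1\<^sub>m dA) K) (amp C) x = (\<Sum>k<dA. if k = x div d then \<Sum>l<dB. K $$ (x mod d, l) * C $$ (k, l) else 0)"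
    by (subst app_kron_amp[OF one_carrier_mat assms(1) assms(2,3)], rule sum.cong[OF refl]) (use x in auto)
  also have "\<dots> = (\<Sum>l<dB. K $$ (x mod d, l) * C $$ (x div d, l))" using x by simp
  also have "\<dots> = amp (C * transpose_mat K) x"
    using assms x by (simp add: amp_def index_mult_mat_sum mult.commute del: index_mult_mat(1))
  finally show ?thesis .
qed

text \<open>Expanding the norms along the columns of the operators leaves the entries of the
  completeness relation. This is the only form in which completeness enters the converse
  bound.\<close>

lemma kraus_isometry:
  assumes K: "\<And>i. i < m \<Longrightarrow> K i \<in> carrier_mat (d i) n"
    and complete: "mat_sum n m (\<lambda>i. mat_adjoint (K i) * K i) = 1\<^sub>m n"
  shows "(\<Sum>i<m. nsq (d i) (app (K i) y)) = nsq n y"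
proof -
  have delta: "(\<Sum>i<m. ip (d i) (\<lambda>a. K i $$ (a, k)) (\<lambda>a. K i $$ (a, l))) = (if k = l then 1 else 0)" if "k < n" "l < n" for k l
  proof -
    have "mat_sum n m (\<lambda>i. mat_adjoint (K i) * K i) $$ (l, k) = (\<Sum>i<m. ip (d i) (\<lambda>a. K i $$ (a, k)) (\<lambda>a. K i $$ (a, l)))"
      unfolding mat_sum_def using that
    proof (simp, intro sum.cong refl)
      fix i assume "i \<in> {..<m}"
      then have "K i \<in> carrier_mat (d i) n" using K by simp
      then show "(mat_adjoint (K i) * K i) $$ (l, k) = ip (d i) (\<lambda>a. K i $$ (a, k)) (\<lambda>a. K i $$ (a, l))"
        using that by (subst index_mult_mat_sum) (auto simp: ip_def mult.commute)
    qed
    then show ?thesis unfolding complete using that by auto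
  qed
  have "complex_of_real (\<Sum>i<m. nsq (d i) (app (K i) y)) = (\<Sum>i<m. ip (d i) (\<lambda>a. \<Sum>k<n. y k * K i $$ (a, k)) (\<lambda>a. \<Sum>l<n. y l * K i $$ (a, l)))"
    unfolding of_real_sum ip_self[symmetric] using K by (intro sum.cong refl ip_cong) (auto simp: app_def mult.commute)
  also have "\<dots> = (\<Sum>i<m. \<Sum>l<n. \<Sum>k<n. cnj (y l) * y k * ip (d i) (\<lambda>a. K i $$ (a, k)) (\<lambda>a. K i $$ (a, l)))"
    unfolding ip_sum_left ip_sum_right
    by (simp add: sum_distrib_left mult_ac) (intro sum.cong refl sum.swap)
  also have "\<dots> = (\<Sum>l<n. \<Sum>i<m. \<Sum>k<n. cnj (y l) * y k * ip (d i) (\<lambda>a. K i $$ (a, k)) (\<lambda>a. K i $$ (a, l)))"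
    by (rule sum.swap)
  also have "\<dots> = (\<Sum>l<n. \<Sum>k<n. cnj (y l) * y k * (\<Sum>i<m. ip (d i) (\<lambda>a. K i $$ (a, k)) (\<lambda>a. K i $$ (a, l))))"
    by (rule sum.cong[OF refl], subst sum.swap) (simp add: sum_distrib_left)
  also have "\<dots> = (\<Sum>l<n. \<Sum>k<n. if k = l then cnj (y l) * y k else 0)"
    by (intro sum.cong refl) (simp add: delta)
  also have "\<dots> = of_real (nsq n y)"
    unfolding ip_self[symmetric] by (simp add: ip_def mult.commute)
  finally show ?thesis by (simp only: of_real_eq_iff)
qed

lemma frob_sq_transpose: "frob_sq (transpose_mat C) = frob_sq C"
  unfolding frob_sq_def nsq_def by (simp, subst sum.swap) simp

text \<open>Alice acts on rows, so \<open>C\<close> and all the \<open>K i * C\<close> have the same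
  column space dimension and one family of test vectors serves them all.\<close>

lemma measurement_alice:
  assumes K: "\<And>i. i < m \<Longrightarrow> K i \<in> carrier_mat (d i) dA"
    and complete: "mat_sum dA m (\<lambda>i. mat_adjoint (K i) * K i) = 1\<^sub>m dA" and C: "C \<in> carrier_mat dA dB"
  shows "frob_sq C = (\<Sum>i<m. frob_sq (K i * C))"
    and "sorted_schmidt C r p u v \<Longrightarrow> (\<And>i. i < m \<Longrightarrow> sorted_schmidt (K i * C) (r' i) (q i) (u' i) (v' i)) \<Longrightarrow>
      (\<Sum>k<l. p k) \<le> (\<Sum>i<m. \<Sum>k<l. q i k)"
proof -
  have iso: "(\<Sum>i<m. nsq (dim_row (K i * C)) (app (K i * C) x)) = nsq (dim_row C) (app C x)" for x
  proof -
    have "(\<Sum>i<m. nsq (dim_row (K i * C)) (app (K i * C) x)) = (\<Sum>i<m. nsq (d i) (app (K i) (app C x)))"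
    proof (intro sum.cong refl)
      fix i assume "i \<in> {..<m}"
      then have Ki: "K i \<in> carrier_mat (d i) dA" using K by simp
      then have "nsq (d i) (app (K i * C) x) = nsq (d i) (app (K i) (app C x))"
        by (intro nsq_cong app_mult[OF Ki C])
      then show "nsq (dim_row (K i * C)) (app (K i * C) x) = nsq (d i) (app (K i) (app C x))" using Ki by simp
    qed
    then show ?thesis using kraus_isometry[OF K complete] C by simp
  qed
  show "frob_sq C = (\<Sum>i<m. frob_sq (K i * C))"
    unfolding frob_sq_app iso[symmetric] by (subst sum.swap) simp
  assume s: "sorted_schmidt C r p u v" "\<And>i. i < m \<Longrightarrow> sorted_schmidt (K i * C) (r' i) (q i) (u' i) (v' i)"
  \<comment> \<open>The decomposition supplies only \<open>r\<close> test vectors; from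
    \<open>r\<close> on \<open>p\<close> is 0.\<close>
  have "(\<Sum>k<l. p k) = (\<Sum>k<min l r. p k)"
    using sorted_schmidtD(4)[OF s(1)] by (intro sum.mono_neutral_right) auto
  also have "\<dots> \<le> (\<Sum>i<m. \<Sum>k<card {..<min l r}. q i k)"
    by (rule sorted_schmidt_measurement[OF sorted_schmidtD(1)[OF s(1)] _ _ _ s(2) iso]) auto
  also have "\<dots> \<le> (\<Sum>i<m. \<Sum>k<l. q i k)"
    using sorted_schmidtD(3)[OF s(2)] by (intro sum_mono sum_mono2) auto
  finally show "(\<Sum>k<l. p k) \<le> (\<Sum>i<m. \<Sum>k<l. q i k)" .
qed

text \<open>Transposition exchanges the parties and keeps the Schmidt coefficients.\<close>

lemma measurement_bob:
  assumes K: "\<And>i. i < m \<Longrightarrow> K i \<in> carrier_mat (d i) dB"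
    and complete: "mat_sum dB m (\<lambda>i. mat_adjoint (K i) * K i) = 1\<^sub>m dB" and C: "C \<in> carrier_mat dA dB"
  shows "frob_sq C = (\<Sum>i<m. frob_sq (C * transpose_mat (K i)))"
    and "sorted_schmidt C r p u v \<Longrightarrow> (\<And>i. i < m \<Longrightarrow> sorted_schmidt (C * transpose_mat (K i)) (r' i) (q i) (u' i) (v' i)) \<Longrightarrow>
      (\<Sum>k<l. p k) \<le> (\<Sum>i<m. \<Sum>k<l. q i k)"
proof -
  have t: "K i * transpose_mat C = transpose_mat (C * transpose_mat (K i))" if "i < m" for i
    using transpose_mult[of C dA dB "transpose_mat (K i)" "d i"] K[OF that] C by simp
  have C': "transpose_mat C \<in> carrier_mat dB dA" using C by simp
  show "frob_sq C = (\<Sum>i<m. frob_sq (C * transpose_mat (K i)))"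
    using measurement_alice(1)[OF K complete C'] by (simp add: t frob_sq_transpose)
  assume s: "sorted_schmidt C r p u v" "\<And>i. i < m \<Longrightarrow> sorted_schmidt (C * transpose_mat (K i)) (r' i) (q i) (u' i) (v' i)"
  show "(\<Sum>k<l. p k) \<le> (\<Sum>i<m. \<Sum>k<l. q i k)"
    by (rule measurement_alice(2)[OF K complete C' sorted_schmidt_transpose[OF s(1)], where r' = r' and u' = v' and v' = u'])
      (use s(2) t in \<open>auto intro: sorted_schmidt_transpose\<close>)
qed

section \<open>Unravelling protocols into pure branches\<close>

definition sing_sum :: "nat \<Rightarrow> complex mat \<Rightarrow> real" where
  "sing_sum l C = (\<Sum>k<l. sq_sing C k)"

lemma sing_sum_alice:
  assumes "\<And>i. i < m \<Longrightarrow> K i \<in> carrier_mat (d i) dA" "mat_sum dA m (\<lambda>i. mat_adjoint (K i) * K i) = 1\<^sub>m dA" "C \<in> carrier_mat dA dB"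
  shows "sing_sum l C \<le> (\<Sum>i<m. sing_sum l (K i * C))"
proof -
  have "\<forall>D. \<exists>r u v. sorted_schmidt D r (sq_sing D) u v" using sq_sing_schmidt by metis
  then obtain r u v where "\<And>D. sorted_schmidt D (r D) (sq_sing D) (u D) (v D)" by metis
  then show ?thesis unfolding sing_sum_def by (intro measurement_alice(2)[OF assms])
qed

lemma sing_sum_bob:
  assumes "\<And>i. i < m \<Longrightarrow> K i \<in> carrier_mat (d i) dB" "mat_sum dB m (\<lambda>i. mat_adjoint (K i) * K i) = 1\<^sub>m dB" "C \<in> carrier_mat dA dB"
  shows "sing_sum l C \<le> (\<Sum>i<m. sing_sum l (C * transpose_mat (K i)))"
proof -
  have "\<forall>D. \<exists>r u v. sorted_schmidt D r (sq_sing D) u v" using sq_sing_schmidt by metis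
  then obtain r u v where "\<And>D. sorted_schmidt D (r D) (sq_sing D) (u D) (v D)" by metis
  then show ?thesis unfolding sing_sum_def by (intro measurement_bob(2)[OF assms])
qed

text \<open>\<open>f C\<close> lists the unnormalized final states of the branches that start in
  \<open>C\<close>. The second part speaks of mixtures because the output of one map, already mixed,
  is the input of the next; it stands in for linearity, which the type of \<open>E\<close> does not
  provide.\<close>

definition unravels :: "nat \<Rightarrow> nat \<Rightarrow> nat \<Rightarrow> nat \<Rightarrow> (complex mat \<Rightarrow> complex mat) \<Rightarrow> (complex mat \<Rightarrow> complex mat list) \<Rightarrow> bool" where
  "unravels dA dB eA eB E f \<longleftrightarrow>
     (\<forall>C \<in> carrier_mat dA dB. set (f C) \<subseteq> carrier_mat eA eB \<and> frob_sq C = (\<Sum>D\<leftarrow>f C. frob_sq D) \<and>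
        (\<forall>l. sing_sum l C \<le> (\<Sum>D\<leftarrow>f C. sing_sum l D))) \<and>
     (\<forall>Cs. set Cs \<subseteq> carrier_mat dA dB \<longrightarrow> E (mixture (dA * dB) Cs) = mixture (eA * eB) (concat (map f Cs)))"

lemma sum_sum_list_swap: "(\<Sum>i<m. \<Sum>C\<leftarrow>Cs. g i C) = (\<Sum>C\<leftarrow>Cs. \<Sum>i<m. (g i C :: 'a :: comm_monoid_add))"
  by (induction Cs) (auto simp: sum.distrib)

lemma sum_list_concat_upt:
  "(\<Sum>D\<leftarrow>concat (map F [0..<m]). g D) = (\<Sum>i<m. \<Sum>D\<leftarrow>F i. (g D :: 'a :: comm_monoid_add))"
  by (induction m) (auto simp: add.commute)

lemma sum_list_concat_map: "(\<Sum>D\<leftarrow>concat (map F Cs). g D) = (\<Sum>C\<leftarrow>Cs. \<Sum>D\<leftarrow>F C. (g D :: 'a :: comm_monoid_add))"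
  by (induction Cs) auto

text \<open>\<open>h i\<close> is the action of the \<open>i\<close>-th Kraus operator \<open>A i\<close> on coefficient matrices.\<close>

lemma unravels_measurement:
  assumes A: "\<And>i. i < m \<Longrightarrow> A i \<in> carrier_mat (a i * b i) (dA * dB)"
    and act: "\<And>i C x. i < m \<Longrightarrow> C \<in> carrier_mat dA dB \<Longrightarrow> x < a i * b i \<Longrightarrow> app (A i) (amp C) x = amp (h i C) x"
    and h: "\<And>i C. i < m \<Longrightarrow> C \<in> carrier_mat dA dB \<Longrightarrow> h i C \<in> carrier_mat (a i) (b i)"
    and fr: "\<And>C. C \<in> carrier_mat dA dB \<Longrightarrow> frob_sq C = (\<Sum>i<m. frob_sq (h i C))"
    and ss: "\<And>l C. C \<in> carrier_mat dA dB \<Longrightarrow> sing_sum l C \<le> (\<Sum>i<m. sing_sum l (h i C))"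
    and f: "\<And>i. i < m \<Longrightarrow> unravels (a i) (b i) eA eB (E i) (f i)"
  shows "unravels dA dB eA eB (\<lambda>\<rho>. mat_sum (eA * eB) m (\<lambda>i. E i (A i * \<rho> * mat_adjoint (A i))))
    (\<lambda>C. concat (map (\<lambda>i. f i (h i C)) [0..<m]))"
  unfolding unravels_def
proof (intro conjI ballI allI impI)
  fix C :: "complex mat" assume C: "C \<in> carrier_mat dA dB"
  show "set (concat (map (\<lambda>i. f i (h i C)) [0..<m])) \<subseteq> carrier_mat eA eB"
    using f h[OF _ C] by (fastforce simp: unravels_def)
  show "frob_sq C = (\<Sum>D\<leftarrow>concat (map (\<lambda>i. f i (h i C)) [0..<m]). frob_sq D)"
    unfolding sum_list_concat_upt fr[OF C] using f h[OF _ C] by (intro sum.cong refl) (auto simp: unravels_def)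
  fix l
  have "sing_sum l C \<le> (\<Sum>i<m. sing_sum l (h i C))" by (rule ss[OF C])
  also have "\<dots> \<le> (\<Sum>i<m. \<Sum>D\<leftarrow>f i (h i C). sing_sum l D)"
    using f h[OF _ C] by (intro sum_mono) (auto simp: unravels_def)
  finally show "sing_sum l C \<le> (\<Sum>D\<leftarrow>concat (map (\<lambda>i. f i (h i C)) [0..<m]). sing_sum l D)"
    unfolding sum_list_concat_upt .
next
  fix Cs :: "complex mat list" assume Cs: "set Cs \<subseteq> carrier_mat dA dB"
  have E: "E i (A i * mixture (dA * dB) Cs * mat_adjoint (A i)) = mixture (eA * eB) (concat (map (\<lambda>C. f i (h i C)) Cs))" if i: "i < m" for i
  proof -
    have "A i * mixture (dA * dB) Cs * mat_adjoint (A i) = mixture (a i * b i) (map (h i) Cs)"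
      using Cs by (intro mixture_conj[OF A[OF i]] act[OF i]) auto
    moreover have "set (map (h i) Cs) \<subseteq> carrier_mat (a i) (b i)" using Cs h[OF i] by auto
    ultimately show ?thesis using f[OF i] by (simp add: unravels_def o_def)
  qed
  show "mat_sum (eA * eB) m (\<lambda>i. E i (A i * mixture (dA * dB) Cs * mat_adjoint (A i))) =
      mixture (eA * eB) (concat (map (\<lambda>C. concat (map (\<lambda>i. f i (h i C)) [0..<m])) Cs))"
  proof (rule eq_matI, goal_cases)
    case (1 x y)
    then have xy: "x < eA * eB" "y < eA * eB" by auto
    have "mat_sum (eA * eB) m (\<lambda>i. E i (A i * mixture (dA * dB) Cs * mat_adjoint (A i))) $$ (x, y) =
        (\<Sum>i<m. \<Sum>C\<leftarrow>Cs. \<Sum>D\<leftarrow>f i (h i C). amp D x * cnj (amp D y))"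
      using xy by (simp add: mat_sum_def E) (simp add: mixture_def sum_list_concat_map)
    also have "\<dots> = mixture (eA * eB) (concat (map (\<lambda>C. concat (map (\<lambda>i. f i (h i C)) [0..<m])) Cs)) $$ (x, y)"
      using xy by (simp add: mixture_def sum_list_concat_map sum_sum_list_swap interv_sum_list_conv_sum_set_nat atLeast0LessThan)
    finally show ?case .
  qed (auto simp: mat_sum_def)
qed

lemma locc_unravels:
  assumes "locc dA dB eA eB E"
  shows "\<exists>f. unravels dA dB eA eB E f"
  using assms
proof induction
  case (stop eA eB)
  have "concat (map (\<lambda>C. [C]) Cs) = Cs" for Cs :: "complex mat list" by (induction Cs) auto
  then have "unravels eA eB eA eB (\<lambda>\<rho>. \<rho>) (\<lambda>C. [C])" by (simp add: unravels_def)
  then show ?case by blast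
next
  case (alice m K d dA dB eA eB E)
  then obtain f where f: "\<And>i. i < m \<Longrightarrow> unravels (d i) dB eA eB (E i) (f i)" by metis
  have "unravels dA dB eA eB (\<lambda>\<rho>. mat_sum (eA * eB) m (\<lambda>i. E i (kron (K i) (1\<^sub>m dB) * \<rho> * mat_adjoint (kron (K i) (1\<^sub>m dB)))))
      (\<lambda>C. concat (map (\<lambda>i. f i (K i * C)) [0..<m]))"
    by (rule unravels_measurement[where a = d and b = "\<lambda>_. dB"])
      (use alice(1) f in \<open>auto intro: kron_carrier mult_carrier_mat app_kron_alice measurement_alice(1)[OF alice(1,2)] sing_sum_alice[OF alice(1,2)]\<close>)
  then show ?case by blast
next
  case (bob m K d dB dA eA eB E)
  then obtain f where f: "\<And>i. i < m \<Longrightarrow> unravels dA (d i) eA eB (E i) (f i)" by metis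
  have "unravels dA dB eA eB (\<lambda>\<rho>. mat_sum (eA * eB) m (\<lambda>i. E i (kron (1\<^sub>m dA) (K i) * \<rho> * mat_adjoint (kron (1\<^sub>m dA) (K i)))))
      (\<lambda>C. concat (map (\<lambda>i. f i (C * transpose_mat (K i))) [0..<m]))"
    by (rule unravels_measurement[where b = d and a = "\<lambda>_. dA"])
      (use bob(1) f in \<open>auto intro: kron_carrier mult_carrier_mat app_kron_bob measurement_bob(1)[OF bob(1,2)] sing_sum_bob[OF bob(1,2)]\<close>)
  then show ?case by blast
qed

section \<open>Majorization and Nielsen's protocol\<close>

text \<open>Induction on the number of positions where \<open>x\<close> and \<open>y\<close> differ: a transfer between two
  positions makes one more of them agree. Only \<open>x\<close> has to be decreasing, so that \<open>y\<close> need not be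
  sorted again after the transfer.\<close>

lemma majorized_mixture_of_permutations:
  fixes x y :: "nat \<Rightarrow> real"
  assumes "\<And>i j. i \<le> j \<Longrightarrow> j < m \<Longrightarrow> x j \<le> x i"
    and "\<And>l. l \<le> m \<Longrightarrow> (\<Sum>i<l. x i) \<le> (\<Sum>i<l. y i)"
    and "(\<Sum>i<m. x i) = (\<Sum>i<m. y i)"
  shows "\<exists>W. (\<forall>\<pi>. 0 \<le> W \<pi>) \<and> (\<Sum>\<pi> | \<pi> permutes {..<m}. W \<pi>) = 1 \<and>
    (\<forall>k<m. x k = (\<Sum>\<pi> | \<pi> permutes {..<m}. W \<pi> * y (\<pi> k)))"
  using assms
proof (induction "card {i. i < m \<and> x i \<noteq> y i}" arbitrary: y rule: less_induct)
  case less
  let ?P = "{\<pi>. \<pi> permutes {..<m}}"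
  have fin: "finite ?P" by (simp add: finite_permutations)
  show ?case
  proof (cases "\<forall>i<m. x i = y i")
    case True
    define W where "W \<pi> = (if \<pi> = id then 1 else 0 :: real)" for \<pi> :: "nat \<Rightarrow> nat"
    have sel: "(\<Sum>\<pi>\<in>?P. W \<pi> * f \<pi>) = f id" for f :: "(nat \<Rightarrow> nat) \<Rightarrow> real"
    proof -
      have "(\<Sum>\<pi>\<in>?P. W \<pi> * f \<pi>) = (\<Sum>\<pi>\<in>?P. if \<pi> = id then f \<pi> else 0)"
        by (intro sum.cong) (auto simp: W_def)
      then show ?thesis using fin permutes_id by simp
    qed
    show ?thesis using True sel[of "\<lambda>_. 1"] sel[of "\<lambda>\<pi>. y (\<pi> _)"] by (intro exI[of _ W]) (auto simp: W_def)
  next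
    case False
    have "\<exists>k<m. y k < x k"
    proof (rule ccontr)
      assume "\<not> ?thesis"
      then have le: "x i \<le> y i" if "i < m" for i using that by (meson not_le)
      obtain i where "i < m" "x i < y i" using False le by (metis order_le_less)
      then have "(\<Sum>i<m. x i) < (\<Sum>i<m. y i)" by (intro sum_strict_mono_ex1) (use le in auto)
      then show False using less.prems(3) by simp
    qed
    \<comment> \<open>The first position where \<open>y\<close> falls short of \<open>x\<close>.
      Before it \<open>y\<close> dominates, and strictly somewhere, as the partial sums of length
      \<open>Suc k\<close> still compare.\<close>
    then obtain k where k: "k < m" "y k < x k" and kmin: "\<And>i. i < k \<Longrightarrow> \<not> (i < m \<and> y i < x i)"
      using exists_least_iff[of "\<lambda>k. k < m \<and> y k < x k"] by blast
    have le: "x i \<le> y i" if "i < k" for i using kmin[OF that] that k by simp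
    have "\<exists>j<k. x j < y j"
    proof (rule ccontr)
      assume "\<not> ?thesis"
      then have "y i \<le> x i" if "i < k" for i using that by (meson not_le)
      then have "(\<Sum>i<k. x i) = (\<Sum>i<k. y i)" using le by (intro sum.cong[OF refl] antisym) auto
      then show False using less.prems(2)[of "Suc k"] k by simp
    qed
    then obtain j where j: "j < k" "x j < y j" by blast
    have "x k \<le> x j" using less.prems(1) j k by simp
    \<comment> \<open>The largest amount that can move from \<open>j\<close> to \<open>k\<close>
      without overshooting \<open>x\<close> at either place; at one of the two, agreement is
      reached.\<close>
    define \<delta> where "\<delta> = min (y j - x j) (x k - y k)"
    have \<delta>: "0 < \<delta>" "\<delta> \<le> y j - x j" "\<delta> \<le> x k - y k" using j k by (auto simp: \<delta>_def)
    \<comment> \<open>The transfer as a convex combination of the identity and a transposition;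
      \<open>t\<close> is at most 1 because \<open>y k < x k \<le> x j < y j\<close> makes
      \<open>y j - y k\<close> at least \<open>\<delta>\<close>.\<close>
    define t where "t = \<delta> / (y j - y k)"
    have t: "0 \<le> t" "t \<le> 1" and ty: "t * (y j - y k) = \<delta>"
      using \<delta> \<open>x k \<le> x j\<close> by (auto simp: t_def)
    define \<tau> where "\<tau> = Transposition.transpose j k"
    have \<tau>: "\<tau> permutes {..<m}" using j k by (auto simp: \<tau>_def intro: permutes_swap_id)
    have \<tau>\<tau>: "\<tau> \<circ> \<tau> = id" by (simp add: \<tau>_def)
    define y' where "y' i = (1 - t) * y i + t * y (\<tau> i)" for i
    have y'j: "y' j = y j - \<delta>" and y'k: "y' k = y k + \<delta>"
      using ty by (auto simp: y'_def \<tau>_def algebra_simps)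
    have y'o: "y' i = y i" if "i \<noteq> j" "i \<noteq> k" for i
      using that by (simp add: y'_def \<tau>_def algebra_simps)
    have part: "(\<Sum>i<l. y' i) = (\<Sum>i<l. y i) - (if j < l then \<delta> else 0) + (if k < l then \<delta> else 0)" for l
      using j by (induction l) (auto simp: y'j y'k y'o less_Suc_eq)
    have ne: "x j \<noteq> y j" "x k \<noteq> y k" using j k by auto
    have "x j = y' j \<or> x k = y' k" using y'j y'k by (auto simp: \<delta>_def min_def)
    then have "\<exists>i<m. x i = y' i \<and> x i \<noteq> y i" using ne j k by (meson less_trans)
    moreover have "x i \<noteq> y i" if "x i \<noteq> y' i" for i
      using that ne y'o[of i] by (cases "i = j"; cases "i = k") auto
    ultimately have "{i. i < m \<and> x i \<noteq> y' i} \<subset> {i. i < m \<and> x i \<noteq> y i}" by blast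
    then have card: "card {i. i < m \<and> x i \<noteq> y' i} < card {i. i < m \<and> x i \<noteq> y i}"
      by (intro psubset_card_mono) auto
    have "(\<Sum>i<l. x i) \<le> (\<Sum>i<l. y' i)" if "l \<le> m" for l
    proof (cases "j < l \<and> l \<le> k")
      case True
      \<comment> \<open>Only partial sums that contain \<open>j\<close> but not \<open>k\<close>
        shrink; the surplus of \<open>y\<close> at \<open>j\<close> pays for it.\<close>
      have "y j - x j \<le> (\<Sum>i<l. y i - x i)"
        by (rule member_le_sum) (use True le in auto)
      then show ?thesis using True \<delta>(2) by (simp add: part sum_subtractf)
    next
      case False
      then show ?thesis using less.prems(2)[OF that] j by (auto simp: part)
    qed
    moreover have "(\<Sum>i<m. x i) = (\<Sum>i<m. y' i)" using less.prems(3) j k by (simp add: part)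
    ultimately obtain W where W: "\<And>\<pi>. 0 \<le> W \<pi>" "(\<Sum>\<pi>\<in>?P. W \<pi>) = 1" "\<And>i. i < m \<Longrightarrow> x i = (\<Sum>\<pi>\<in>?P. W \<pi> * y' (\<pi> i))"
      using less.hyps[OF card less.prems(1)] by blast
    \<comment> \<open>\<open>y'\<close> mixes \<open>y\<close> and \<open>y \<circ> \<tau>\<close>,
      so composing with \<open>\<tau>\<close> turns weights for \<open>y'\<close> into weights for
      \<open>y\<close>.\<close>
    define V where "V \<pi> = (1 - t) * W \<pi> + t * W (\<tau> \<circ> \<pi>)" for \<pi>
    have move: "(\<Sum>\<pi>\<in>?P. W (\<tau> \<circ> \<pi>) * f \<pi>) = (\<Sum>\<pi>\<in>?P. W \<pi> * f (\<tau> \<circ> \<pi>))" for f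
      by (rule sum.reindex_bij_witness[of _ "\<lambda>\<pi>. \<tau> \<circ> \<pi>" "\<lambda>\<pi>. \<tau> \<circ> \<pi>"])
        (use \<tau> permutes_compose in \<open>auto simp: comp_assoc[symmetric] \<tau>\<tau>\<close>)
    have V: "(\<Sum>\<pi>\<in>?P. V \<pi> * f \<pi>) = (\<Sum>\<pi>\<in>?P. W \<pi> * ((1 - t) * f \<pi> + t * f (\<tau> \<circ> \<pi>)))" for f
    proof -
      have "(\<Sum>\<pi>\<in>?P. V \<pi> * f \<pi>) = (1 - t) * (\<Sum>\<pi>\<in>?P. W \<pi> * f \<pi>) + t * (\<Sum>\<pi>\<in>?P. W (\<tau> \<circ> \<pi>) * f \<pi>)"
        by (simp add: V_def sum.distrib sum_subtractf sum_distrib_left algebra_simps)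
      also have "\<dots> = (\<Sum>\<pi>\<in>?P. W \<pi> * ((1 - t) * f \<pi> + t * f (\<tau> \<circ> \<pi>)))"
        unfolding move by (simp add: sum.distrib sum_subtractf sum_distrib_left algebra_simps)
      finally show ?thesis .
    qed
    show ?thesis
    proof (intro exI[of _ V] conjI allI impI)
      show "0 \<le> V \<pi>" for \<pi> using W(1) t by (simp add: V_def)
      show "(\<Sum>\<pi>\<in>?P. V \<pi>) = 1" using V[of "\<lambda>_. 1"] W(2) by simp
      show "x i = (\<Sum>\<pi>\<in>?P. V \<pi> * y (\<pi> i))" if "i < m" for i
        unfolding V W(3)[OF that] y'_def by simp
    qed
  qed
qed

text \<open>Kraus operators \<open>\<Sum>\<^sub>k c i k z i k u\<^sub>k\<^sup>*\<close> for \<open>i < N\<close>, completed by operators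
  that detect the orthogonal complement of the \<open>u k\<close> and then prepare \<open>z0\<close>.\<close>

definition completed_kraus ::
  "nat \<Rightarrow> nat \<Rightarrow> 'k set \<Rightarrow> ('k \<Rightarrow> nat \<Rightarrow> complex) \<Rightarrow> nat \<Rightarrow> (nat \<Rightarrow> 'k \<Rightarrow> complex) \<Rightarrow> (nat \<Rightarrow> 'k \<Rightarrow> nat \<Rightarrow> complex) \<Rightarrow>
    (nat \<Rightarrow> complex) \<Rightarrow> nat \<Rightarrow> complex mat" where
  "completed_kraus e n I u N c z z0 i = mat e n (\<lambda>(a, b).
     if i < N then \<Sum>k\<in>I. c i k * z i k a * cnj (u k b)
     else z0 a * ((if b = i - N then 1 else 0) - (\<Sum>k\<in>I. u k (i - N) * cnj (u k b))))"

lemma completed_kraus_carrier [simp]: "completed_kraus e n I u N c z z0 i \<in> carrier_mat e n"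
  "dim_row (completed_kraus e n I u N c z z0 i) = e" "dim_col (completed_kraus e n I u N c z z0 i) = n"
  by (simp_all add: completed_kraus_def)

lemma sum_lessThan_add: "(\<Sum>i<N + (n :: nat). f i) = (\<Sum>i<N. f i) + (\<Sum>i<n. f (N + i) :: 'a :: comm_monoid_add)"
  by (induction n) (auto simp: add.assoc)

text \<open>The completing operators factor through the projection onto the complement, so they
  annihilate the span of the \<open>u k\<close>.\<close>

lemma completed_kraus_app:
  assumes u: "ortho n I u" "finite I" and a: "a < e"
    and x: "\<And>b. b < n \<Longrightarrow> x b = (\<Sum>k\<in>I. \<beta> k * u k b)" and i: "i < N + n"
  shows "app (completed_kraus e n I u N c z z0 i) x a = (if i < N then \<Sum>k\<in>I. \<beta> k * c i k * z i k a else 0)"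
proof -
  have ux: "(\<Sum>b<n. cnj (u k b) * x b) = \<beta> k" if "k \<in> I" for k
  proof -
    have "(\<Sum>b<n. cnj (u k b) * x b) = ip n x (u k)" by (simp add: ip_def mult.commute)
    also have "\<dots> = ip n (\<lambda>b. \<Sum>k\<in>I. \<beta> k * u k b) (u k)" by (intro ip_cong x) auto
    also have "\<dots> = \<beta> k" by (rule ip_ortho_sum[OF u that])
    finally show ?thesis .
  qed
  show ?thesis
  proof (cases "i < N")
    case True
    then have "app (completed_kraus e n I u N c z z0 i) x a = (\<Sum>b<n. \<Sum>k\<in>I. c i k * z i k a * (cnj (u k b) * x b))"
      using a by (simp add: app_def completed_kraus_def sum_distrib_left sum_distrib_right mult_ac)
    also have "\<dots> = (\<Sum>k\<in>I. c i k * z i k a * (\<Sum>b<n. cnj (u k b) * x b))"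
      by (subst sum.swap) (simp add: sum_distrib_left)
    also have "\<dots> = (\<Sum>k\<in>I. \<beta> k * c i k * z i k a)"
      by (intro sum.cong refl) (simp add: ux)
    finally show ?thesis using True by simp
  next
    case False
    then have j: "i - N < n" using i by simp
    have "app (completed_kraus e n I u N c z z0 i) x a =
        z0 a * (\<Sum>b<n. (if b = i - N then x b else 0) - (\<Sum>k\<in>I. u k (i - N) * (cnj (u k b) * x b)))"
      using a False unfolding sum_distrib_left app_def
      by (simp add: completed_kraus_def, intro sum.cong refl) (simp add: algebra_simps sum_distrib_left)
    also have "(\<Sum>b<n. (if b = i - N then x b else 0) - (\<Sum>k\<in>I. u k (i - N) * (cnj (u k b) * x b))) =
        x (i - N) - (\<Sum>k\<in>I. u k (i - N) * (\<Sum>b<n. cnj (u k b) * x b))"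
      unfolding sum_subtractf using j by (subst sum.swap) (simp add: sum_distrib_left)
    also have "\<dots> = 0" using x[OF j] by (simp add: ux) (simp add: mult.commute)
    finally show ?thesis using False by simp
  qed
qed

text \<open>The first \<open>N\<close> operators contribute the projection \<open>Pr\<close> onto
  the span of the \<open>u k\<close>, the others \<open>(1 - Pr)^2 = 1 - Pr\<close>. The
  \<open>z i k\<close> are asked to be orthonormal only at nonzero weights: in Nielsen's protocol
  the remaining ones may lie outside the Schmidt family of the target.\<close>

lemma completed_kraus_complete:
  assumes u: "ortho n I u" "finite I" and z0: "nsq e z0 = 1"
    and z: "\<And>i k l. i < N \<Longrightarrow> k \<in> I \<Longrightarrow> l \<in> I \<Longrightarrow> c i k \<noteq> 0 \<Longrightarrow> c i l \<noteq> 0 \<Longrightarrow> ip e (z i k) (z i l) = (if k = l then 1 else 0)"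
    and c: "\<And>k. k \<in> I \<Longrightarrow> (\<Sum>i<N. (cmod (c i k))\<^sup>2) = 1"
  shows "mat_sum n (N + n) (\<lambda>i. mat_adjoint (completed_kraus e n I u N c z z0 i) * completed_kraus e n I u N c z z0 i) = 1\<^sub>m n"
    (is "mat_sum n (N + n) (\<lambda>i. mat_adjoint (?K i) * ?K i) = _")
proof (rule eq_matI, goal_cases)
  case (1 b d)
  then have bd: "b < n" "d < n" by auto
  define Pr where "Pr b d = (\<Sum>k\<in>I. u k b * cnj (u k d))" for b d
  have entry: "(mat_adjoint (?K i) * ?K i) $$ (b, d) = ip e (\<lambda>a. ?K i $$ (a, d)) (\<lambda>a. ?K i $$ (a, b))" for i
    using bd by (subst index_mult_mat_sum) (auto simp: ip_def mult.commute)
  have left: "ip e (\<lambda>a. ?K i $$ (a, d)) (\<lambda>a. ?K i $$ (a, b)) = (\<Sum>k\<in>I. of_real ((cmod (c i k))\<^sup>2) * (u k b * cnj (u k d)))"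
    if i: "i < N" for i
  proof -
    have "ip e (\<lambda>a. ?K i $$ (a, d)) (\<lambda>a. ?K i $$ (a, b)) =
        ip e (\<lambda>a. \<Sum>k\<in>I. (c i k * cnj (u k d)) * z i k a) (\<lambda>a. \<Sum>k\<in>I. (c i k * cnj (u k b)) * z i k a)"
      using bd i by (intro ip_cong) (auto simp: completed_kraus_def mult_ac)
    also have "\<dots> = (\<Sum>l\<in>I. \<Sum>k\<in>I. cnj (c i l) * c i k * ip e (z i k) (z i l) * (u l b * cnj (u k d)))"
      unfolding ip_sum_left ip_sum_right by (simp add: sum_distrib_left mult_ac) (rule sum.swap)
    also have "\<dots> = (\<Sum>l\<in>I. \<Sum>k\<in>I. if k = l then cnj (c i l) * c i k * (u l b * cnj (u k d)) else 0)"
    proof (intro sum.cong refl)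
      fix l k assume "l \<in> I" "k \<in> I"
      then show "cnj (c i l) * c i k * ip e (z i k) (z i l) * (u l b * cnj (u k d)) =
          (if k = l then cnj (c i l) * c i k * (u l b * cnj (u k d)) else 0)"
        using z[OF i, of k l] by (cases "c i k = 0 \<or> c i l = 0") auto
    qed
    also have "\<dots> = (\<Sum>k\<in>I. of_real ((cmod (c i k))\<^sup>2) * (u k b * cnj (u k d)))"
      using u(2) by (simp add: complex_norm_square mult.commute del: of_real_power)
    finally show ?thesis .
  qed
  have right: "ip e (\<lambda>a. ?K (N + i) $$ (a, d)) (\<lambda>a. ?K (N + i) $$ (a, b)) =
      ((if d = i then 1 else 0) - Pr i d) * cnj ((if b = i then 1 else 0) - Pr i b)" for i
  proof -
    have "ip e (\<lambda>a. ?K (N + i) $$ (a, d)) (\<lambda>a. ?K (N + i) $$ (a, b)) =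
        ip e (\<lambda>a. ((if d = i then 1 else 0) - Pr i d) * z0 a) (\<lambda>a. ((if b = i then 1 else 0) - Pr i b) * z0 a)"
      using bd by (intro ip_cong) (auto simp: completed_kraus_def Pr_def mult_ac)
    then show ?thesis unfolding ip_scale_left ip_scale_right ip_self z0 by simp
  qed
  have Prcnj: "cnj (Pr i b) = Pr b i" for i b by (simp add: Pr_def cnj_sum mult.commute)
  have PrPr: "(\<Sum>i<n. Pr b i * Pr i d) = Pr b d"
  proof -
    have "(\<Sum>i<n. Pr b i * Pr i d) = (\<Sum>k\<in>I. u k b * (\<Sum>i<n. Pr i d * cnj (u k i)))"
      unfolding Pr_def[of b] sum_distrib_left sum_distrib_right by (subst sum.swap) (simp add: mult_ac)
    also have "\<dots> = (\<Sum>k\<in>I. u k b * ip n (\<lambda>i. \<Sum>l\<in>I. cnj (u l d) * u l i) (u k))"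
      by (simp add: ip_def Pr_def mult.commute)
    also have "\<dots> = Pr b d"
      unfolding Pr_def by (intro sum.cong refl) (simp add: ip_ortho_sum[OF u])
    finally show ?thesis .
  qed
  have "(\<Sum>i<n. ((if d = i then 1 else 0) - Pr i d) * cnj ((if b = i then 1 else 0) - Pr i b)) =
      (\<Sum>i<n. ((if i = d then (if b = i then 1 else 0) else 0) - (if i = d then Pr b i else 0) - (if i = b then Pr i d else 0)) + Pr b i * Pr i d)"
    by (intro sum.cong refl) (auto simp: Prcnj algebra_simps)
  also have "\<dots> = (if b = d then 1 else 0) - Pr b d"
    using bd by (simp add: sum.distrib sum_subtractf PrPr)
  finally have res: "(\<Sum>i<n. ((if d = i then 1 else 0) - Pr i d) * cnj ((if b = i then 1 else 0) - Pr i b)) = (if b = d then 1 else 0) - Pr b d" .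
  have "(\<Sum>i<N. \<Sum>k\<in>I. of_real ((cmod (c i k))\<^sup>2) * (u k b * cnj (u k d))) = (\<Sum>k\<in>I. of_real (\<Sum>i<N. (cmod (c i k))\<^sup>2) * (u k b * cnj (u k d)))"
    by (subst sum.swap) (simp add: sum_distrib_right del: of_real_power)
  also have "\<dots> = Pr b d" by (simp add: c Pr_def del: of_real_sum)
  finally have "(\<Sum>i<N + n. (mat_adjoint (?K i) * ?K i) $$ (b, d)) = (if b = d then 1 else 0)"
    unfolding sum_lessThan_add entry by (simp add: left right res del: of_real_power complex_cnj_diff)
  then show ?case using bd by (simp add: mat_sum_def)
qed (auto simp: mat_sum_def)

lemma schmidt_support:
  assumes "schmidt C I p u v" "i < dim_row C" "j < dim_col C"
  shows "C $$ (i, j) = (\<Sum>k | k \<in> I \<and> p k \<noteq> 0. of_real (sqrt (p k)) * u k i * v k j)"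
  unfolding schmidtD(5)[OF assms] using schmidtD(1)[OF assms(1)]
  by (intro sum.mono_neutral_right) auto

lemma frob_sq_carrier_pos:
  assumes "C \<in> carrier_mat a b" "frob_sq C \<noteq> 0"
  shows "0 < a" "0 < b"
  using assms by (cases a; cases b; auto simp: frob_sq_def nsq_def)+

text \<open>Write \<open>p\<close> as the mixture of the \<open>q \<circ> h i\<close> with weights
  \<open>w i\<close>. Alice's operator \<open>i\<close> maps \<open>u k\<close> to
  \<open>x (h i k)\<close> with amplitude \<open>sqrt (w i * q (h i k) / p k)\<close>; her
  completeness relation is exactly this mixture. Outcome \<open>i\<close> leaves
  \<open>sqrt (w i)\<close> times a state with the coefficients of \<open>C'\<close>, carried by the
  pairs \<open>x (h i k)\<close>, \<open>v k\<close>. Bob, told \<open>i\<close>, maps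
  \<open>v k\<close> to \<open>y (h i k)\<close>. Every branch is a multiple of \<open>C'\<close>,
  so the output is pure.\<close>

theorem nielsen:
  assumes C: "C \<in> carrier_mat dA dB" "sorted_schmidt C r p u v"
    and C': "C' \<in> carrier_mat eA eB" "sorted_schmidt C' r' q x y"
    and maj: "\<And>l. (\<Sum>k<l. p k) \<le> (\<Sum>k<l. q k)" and eq: "frob_sq C = frob_sq C'" and pos: "frob_sq C' \<noteq> 0"
  shows "\<exists>E. locc dA dB eA eB E \<and> E (density C) = density C'"
proof -
  note S = sorted_schmidtD[OF C(2)] and S' = sorted_schmidtD[OF C'(2)]
  note s = schmidtD[OF S(1)] and s' = schmidtD[OF S'(1)]
  define m where "m = max r r'"
  have "(\<Sum>k<m. p k) = frob_sq C" "(\<Sum>k<m. q k) = frob_sq C'"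
    unfolding schmidt_frob_sq[OF S(1)] schmidt_frob_sq[OF S'(1)] m_def
    using S(4) S'(4) by (intro sum.mono_neutral_right; auto)+
  then obtain W where W: "\<And>\<pi>. 0 \<le> W \<pi>" "(\<Sum>\<pi> | \<pi> permutes {..<m}. W \<pi>) = 1"
    "\<And>k. k < m \<Longrightarrow> p k = (\<Sum>\<pi> | \<pi> permutes {..<m}. W \<pi> * q (\<pi> k))"
    using majorized_mixture_of_permutations[of m p q] maj eq S(2) by (auto simp: antimono_def)
  define N where "N = card {\<pi>. \<pi> permutes {..<m}}"
  obtain h where h: "bij_betw h {..<N} {\<pi>. \<pi> permutes {..<m}}"
    using ex_bij_betw_nat_finite[of "{\<pi>. \<pi> permutes {..<m}}"] finite_permutations[of "{..<m}"]
    unfolding N_def atLeast0LessThan by auto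
  define w where "w i = W (h i)" for i
  have w0: "0 \<le> w i" for i using W(1) by (simp add: w_def)
  have w1: "(\<Sum>i<N. w i) = 1" unfolding w_def sum.reindex_bij_betw[OF h] by (rule W(2))
  have pk: "p k = (\<Sum>i<N. w i * q (h i k))" if "k < m" for k
    unfolding w_def W(3)[OF that] using sum.reindex_bij_betw[OF h, of "\<lambda>\<pi>. W \<pi> * q (\<pi> k)"] by simp
  have hp: "h i permutes {..<m}" if "i < N" for i using bij_betwE[OF h] that by auto
  \<comment> \<open>The amplitudes divide by \<open>p k\<close>, and terms with
    \<open>p k = 0\<close> do not contribute to \<open>C\<close>.\<close>
  define I where "I = {k. k \<in> {..<r} \<and> p k \<noteq> 0}"
  have I: "finite I" "\<And>k. k \<in> I \<Longrightarrow> k < r \<and> k < m \<and> 0 < p k"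
    using S(3) by (auto simp: I_def m_def order_less_le)
  have IC: "C $$ (a, b) = (\<Sum>k\<in>I. of_real (sqrt (p k)) * u k a * v k b)" if "a < dA" "b < dB" for a b
    using schmidt_support[OF S(1)] that C(1) by (simp add: I_def)
  \<comment> \<open>Bob may only aim at vectors \<open>y (h i k)\<close> of the Schmidt family of
    \<open>C'\<close>, which a nonzero \<open>q (h i k)\<close> ensures. For
    \<open>i \<ge> N\<close> the set is empty, so that Bob has a complete measurement after Alice's
    completing outcomes as well.\<close>
  define I' where "I' i = {k \<in> I. i < N \<and> q (h i k) \<noteq> 0}" for i
  have qr: "l < r'" if "q l \<noteq> 0" for l using S'(4)[of l] that by (meson not_less)
  have ou: "ortho dA I u" using s(3) C(1) I(2) by (auto intro: ortho_subset)
  have ov: "ortho dB (I' i) v" for i using s(4) C(1) I(2) by (auto simp: I'_def intro: ortho_subset)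
  have oz: "ip eA (x (h i k)) (x (h i l)) = (if k = l then 1 else 0)"
    "ip eB (y (h i k)) (y (h i l)) = (if k = l then 1 else 0)"
    if "i < N" "q (h i k) \<noteq> 0" "q (h i l) \<noteq> 0" for i k l
    using orthoD[OF s'(3), of "h i k" "h i l"] orthoD[OF s'(4), of "h i k" "h i l"] C'(1) qr[OF that(2)] qr[OF that(3)]
      inj_eq[OF permutes_inj[OF hp[OF that(1)]]] by auto
  define c where "c i k = complex_of_real (sqrt (w i * q (h i k) / p k))" for i k
  have c2: "(\<Sum>i<N. (cmod (c i k))\<^sup>2) = 1" if "k \<in> I" for k
  proof -
    have "(\<Sum>i<N. (cmod (c i k))\<^sup>2) = (\<Sum>i<N. w i * q (h i k)) / p k"
      using I(2)[OF that] w0 S'(3) by (simp add: c_def sum_divide_distrib)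
    also have "\<dots> = p k / p k" using pk[of k] I(2)[OF that] by simp
    finally show ?thesis using I(2)[OF that] by simp
  qed
  define z0 where "z0 = (\<lambda>j. if j = (0 :: nat) then 1 else 0 :: complex)"
  have z0: "nsq eA z0 = 1" "nsq eB z0 = 1"
    unfolding z0_def using frob_sq_carrier_pos[OF C'(1) pos] by (auto intro: nsq_unit)
  define KA where "KA = completed_kraus eA dA I u N c (\<lambda>i k. x (h i k)) z0"
  define KB where "KB i = completed_kraus eB dB (I' i) v 1 (\<lambda>_ _. 1) (\<lambda>_ k. y (h i k)) z0" for i
  have KA: "KA i \<in> carrier_mat eA dA" for i by (simp add: KA_def)
  have KB: "KB i j \<in> carrier_mat eB dB" for i j by (simp add: KB_def)
  have KA1: "mat_sum dA (N + dA) (\<lambda>i. mat_adjoint (KA i) * KA i) = 1\<^sub>m dA"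
    unfolding KA_def
    by (rule completed_kraus_complete[OF ou I(1) z0(1) _ c2]) (auto simp: c_def oz)
  have KB1: "mat_sum dB (1 + dB) (\<lambda>j. mat_adjoint (KB i j) * KB i j) = 1\<^sub>m dB" for i
    unfolding KB_def
    by (rule completed_kraus_complete[OF ov _ z0(2)]) (auto simp: I'_def I(1) oz)
  define E where "E i \<rho> = mat_sum (eA * eB) (1 + dB) (\<lambda>j. kron (1\<^sub>m eA) (KB i j) * \<rho> * mat_adjoint (kron (1\<^sub>m eA) (KB i j)))" for i \<rho>
  define \<Gamma> where "\<Gamma> \<rho> = mat_sum (eA * eB) (N + dA) (\<lambda>i. E i (kron (KA i) (1\<^sub>m dB) * \<rho> * mat_adjoint (kron (KA i) (1\<^sub>m dB))))" for \<rho>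
  have "locc eA dB eA eB (E i)" for i
    unfolding E_def by (rule locc.bob[where d = "\<lambda>_. eB", OF KB KB1 locc.stop])
  then have locc: "locc dA dB eA eB \<Gamma>"
    unfolding \<Gamma>_def by (intro locc.alice[where d = "\<lambda>_. eA", OF KA KA1])
  define D where "D i = KA i * C" for i
  have D: "D i \<in> carrier_mat eA dB" for i unfolding D_def by (rule mult_carrier_mat[OF KA C(1)])
  have De: "D i $$ (a, b) = (if i < N then \<Sum>k\<in>I. (of_real (sqrt (p k)) * v k b) * c i k * x (h i k) a else 0)"
    if "i < N + dA" "a < eA" "b < dB" for i a b
  proof -
    have "D i $$ (a, b) = app (KA i) (\<lambda>a'. C $$ (a', b)) a"
      using KA[of i] C(1) that by (simp add: D_def index_mult_mat_sum app_def del: index_mult_mat(1))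
    also have "\<dots> = (if i < N then \<Sum>k\<in>I. (of_real (sqrt (p k)) * v k b) * c i k * x (h i k) a else 0)"
      unfolding KA_def
      by (rule completed_kraus_app[OF ou I(1) that(2) _ that(1)]) (use that in \<open>simp add: IC mult_ac\<close>)
    finally show ?thesis .
  qed
  \<comment> \<open>The amplitude of a branch relative to \<open>C'\<close>; it is 0 at completing
    outcomes, since the states lie in the spans these outcomes exclude.\<close>
  define sc where "sc i j = (if i < N \<and> j = 0 then sqrt (w i) else 0)" for i j :: nat
  define F where "F i j = D i * transpose_mat (KB i j)" for i j
  have F: "F i j \<in> carrier_mat eA eB" for i j unfolding F_def by (intro mult_carrier_mat[OF D]) (simp add: KB)
  have Fe: "F i j $$ (a, b) = of_real (sc i j) * C' $$ (a, b)"
    if ij: "i < N + dA" "j < 1 + dB" and ab: "a < eA" "b < eB" for i j a b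
  proof -
    define \<beta> where "\<beta> k = of_real (sqrt (p k)) * c i k * x (h i k) a" for k
    have "F i j $$ (a, b) = app (KB i j) (\<lambda>b'. D i $$ (a, b')) b"
      using KB[of i j] D[of i] ab by (simp add: F_def index_mult_mat_sum app_def mult.commute del: index_mult_mat(1))
    also have "\<dots> = (if j < 1 then \<Sum>k\<in>I' i. \<beta> k * 1 * y (h i k) b else 0)"
      unfolding KB_def
    proof (rule completed_kraus_app[OF ov _ ab(2) _ ij(2)])
      fix b' assume b': "b' < dB"
      show "D i $$ (a, b') = (\<Sum>k\<in>I' i. \<beta> k * v k b')"
      proof (cases "i < N")
        case True
        then have "D i $$ (a, b') = (\<Sum>k\<in>I. \<beta> k * v k b')"
          using De[OF ij(1) ab(1) b'] by (simp add: \<beta>_def mult_ac)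
        also have "\<dots> = (\<Sum>k\<in>I' i. \<beta> k * v k b')"
          using True I(1) by (intro sum.mono_neutral_right) (auto simp: I'_def \<beta>_def c_def)
        finally show ?thesis .
      next
        case False
        then show ?thesis using De[OF ij(1) ab(1) b'] by (simp add: I'_def)
      qed
    qed (simp add: I'_def I(1))
    also have "\<dots> = of_real (sc i j) * C' $$ (a, b)"
    proof (cases "i < N \<and> j = 0 \<and> w i \<noteq> 0")
      case True
      define L where "L = {l. l \<in> {..<r'} \<and> q l \<noteq> 0}"
      \<comment> \<open>No term of \<open>C'\<close> is lost by restricting to \<open>I\<close>:
        where \<open>w i\<close> and \<open>q (h i k)\<close> are positive, so is the mixture
        \<open>p k\<close>.\<close>
      have inv: "k \<in> I" if "q (h i k) \<noteq> 0" "k < m" for k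
      proof -
        have "0 < w i * q (h i k)" using True w0[of i] S'(3)[of "h i k"] that by (simp add: order_less_le)
        also have "\<dots> \<le> p k"
          unfolding pk[OF that(2)]
          by (rule member_le_sum[of i "{..<N}" "\<lambda>i. w i * q (h i k)"]) (use True w0 S'(3) in auto)
        finally show ?thesis using S(4)[of k] by (auto simp: I_def not_less[symmetric])
      qed
      have "bij_betw (h i) (I' i) L"
      proof (rule bij_betw_imageI)
        show "inj_on (h i) (I' i)" using permutes_inj_on[OF hp] True by blast
        show "h i ` I' i = L"
        proof (intro subset_antisym subsetI)
          fix l assume "l \<in> h i ` I' i"
          then show "l \<in> L" using qr by (auto simp: L_def I'_def)
        next
          fix l assume l: "l \<in> L"
          then have "l \<in> {..<m}" by (auto simp: L_def m_def)
          then obtain k where k: "k < m" "l = h i k"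
            using permutes_image[OF hp[of i]] True by (auto simp: image_iff set_eq_iff)
          then have "k \<in> I' i" using inv[of k] l True by (auto simp: I'_def L_def)
          then show "l \<in> h i ` I' i" using k by auto
        qed
      qed
      from sum.reindex_bij_betw[OF this, of "\<lambda>l. of_real (sqrt (q l)) * x l a * y l b"]
      have "(\<Sum>k\<in>I' i. of_real (sqrt (q (h i k))) * x (h i k) a * y (h i k) b) = C' $$ (a, b)"
        using schmidt_support[OF S'(1), of a b] C'(1) ab by (simp add: L_def)
      moreover have "\<beta> k = of_real (sqrt (w i)) * (of_real (sqrt (q (h i k))) * x (h i k) a)" if "k \<in> I' i" for k
      proof -
        have "0 < p k" using that I(2) by (auto simp: I'_def)
        then have "sqrt (p k) * sqrt (w i * q (h i k) / p k) = sqrt (w i) * sqrt (q (h i k))"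
          by (simp add: real_sqrt_mult real_sqrt_divide)
        then show ?thesis unfolding \<beta>_def c_def by (simp flip: of_real_mult)
      qed
      ultimately show ?thesis using True by (simp add: sc_def mult_ac flip: sum_distrib_left)
    next
      case False
      moreover have "\<beta> k = 0" if "w i = 0" for k using that by (simp add: \<beta>_def c_def)
      ultimately show ?thesis by (cases "i < N") (auto simp: sc_def I'_def)
    qed
    finally show ?thesis .
  qed
  have Fa: "amp (F i j) a = of_real (sc i j) * amp C' a" if "i < N + dA" "j < 1 + dB" "a < eA * eB" for i j a
    using Fe[OF that(1,2)] div_mod_less[OF that(3)] F[of i j] C'(1) by (simp add: amp_def)
  have out: "E i (kron (KA i) (1\<^sub>m dB) * density C * mat_adjoint (kron (KA i) (1\<^sub>m dB))) =
      mat_sum (eA * eB) (1 + dB) (\<lambda>j. mixture (eA * eB) [F i j])" for i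
  proof -
    have "kron (KA i) (1\<^sub>m dB) * density C * mat_adjoint (kron (KA i) (1\<^sub>m dB)) = mixture (eA * dB) (map (\<lambda>C. KA i * C) [C])"
      unfolding density_mixture[OF C(1)]
      by (rule mixture_conj[OF kron_carrier[OF KA one_carrier_mat]]) (use app_kron_alice[OF KA C(1)] in auto)
    moreover have "kron (1\<^sub>m eA) (KB i j) * mixture (eA * dB) [D i] * mat_adjoint (kron (1\<^sub>m eA) (KB i j)) =
        mixture (eA * eB) (map (\<lambda>C. C * transpose_mat (KB i j)) [D i])" for j
      by (rule mixture_conj[OF kron_carrier[OF one_carrier_mat KB]]) (use app_kron_bob[OF KB D] in auto)
    ultimately show ?thesis by (simp add: E_def D_def F_def)
  qed
  have "\<Gamma> (density C) = density C'"
    unfolding \<Gamma>_def out density_mixture[OF C'(1)]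
  proof (rule eq_matI, goal_cases)
    case (1 a b)
    then have ab: "a < eA * eB" "b < eA * eB" by auto
    have "mat_sum (eA * eB) (N + dA) (\<lambda>i. mat_sum (eA * eB) (1 + dB) (\<lambda>j. mixture (eA * eB) [F i j])) $$ (a, b) =
        (\<Sum>i<N + dA. \<Sum>j<1 + dB. of_real ((sc i j)\<^sup>2) * (amp C' a * cnj (amp C' b)))"
      using ab by (simp add: mat_sum_def mixture_def Fa power2_eq_square mult_ac)
    also have "\<dots> = of_real (\<Sum>i<N + dA. \<Sum>j<1 + dB. (sc i j)\<^sup>2) * (amp C' a * cnj (amp C' b))"
      by (simp only: of_real_sum sum_distrib_right)
    also have "(\<Sum>i<N + dA. \<Sum>j<1 + dB. (sc i j)\<^sup>2) = (\<Sum>i<N. w i)"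
      unfolding sum_lessThan_add by (simp add: sc_def w0)
    finally show ?case using ab by (simp add: mixture_def w1)
  qed (auto simp: mat_sum_def)
  then show ?thesis using locc by blast
qed

section \<open>Decreasing rearrangements\<close>

text \<open>\<open>decr_prob\<close> lists the positive values only. In a decreasing enumeration of
  a larger set these fill an initial segment \<open>A\<close>, and what follows is 0 on both
  sides.\<close>

lemma decr_prob_enumeration:
  fixes P :: "'a pmf"
  assumes Y: "finite Y" "set_pmf P \<subseteq> Y" and g: "bij_betw g {..<card Y} Y"
    and dec: "\<And>i j. i \<le> j \<Longrightarrow> j < card Y \<Longrightarrow> pmf P (g j) \<le> pmf P (g i)"
  shows "decr_prob P i = (if i < card Y then pmf P (g i) else 0)"
proof -
  define A where "A = {i. i < card Y \<and> pmf P (g i) \<noteq> 0}"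
  have fA: "finite A" by (simp add: A_def)
  have down: "i \<in> A" if "j \<in> A" "i \<le> j" for i j
  proof -
    have "0 < pmf P (g j)" "j < card Y" using that by (auto simp: A_def pmf_pos)
    then show ?thesis using dec[OF that(2)] that by (auto simp: A_def)
  qed
  have A: "A = {..<card A}"
  proof (rule card_subset_eq)
    show "A \<subseteq> {..<card A}"
    proof
      fix j assume "j \<in> A"
      then have "{..j} \<subseteq> A" using down by auto
      then have "card {..j} \<le> card A" by (rule card_mono[OF fA])
      then show "j \<in> {..<card A}" by simp
    qed
  qed auto
  have inj: "inj_on g A" using g by (auto simp: A_def bij_betw_def intro: inj_on_subset)
  have gA: "g ` A = set_pmf P"
  proof (intro subset_antisym subsetI)
    fix y assume "y \<in> set_pmf P"
    then obtain i where "i < card Y" "y = g i" using Y g by (auto simp: bij_betw_def)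
    then show "y \<in> g ` A" using \<open>y \<in> set_pmf P\<close> by (auto simp: A_def set_pmf_iff)
  qed (auto simp: A_def set_pmf_iff)
  define xs where "xs = map (\<lambda>i. pmf P (g i)) [0..<card A]"
  have "image_mset (pmf P) (mset_set (set_pmf P)) = image_mset (\<lambda>i. pmf P (g i)) (mset_set A)"
    unfolding gA[symmetric] image_mset_mset_set[OF inj, symmetric] by (simp add: multiset.map_comp o_def)
  also have "\<dots> = mset xs"
    by (subst A) (simp add: xs_def lessThan_atLeast0)
  finally have M: "image_mset (pmf P) (mset_set (set_pmf P)) = mset (rev xs)" by simp
  have "sorted (rev xs)"
    unfolding sorted_rev_iff_nth_mono
  proof (intro allI impI)
    fix i j assume "i \<le> j" "j < length xs"
    then have "j \<in> A" by (subst A) (simp add: xs_def)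
    then show "xs ! j \<le> xs ! i" using dec[OF \<open>i \<le> j\<close>] \<open>i \<le> j\<close> \<open>j < length xs\<close> by (simp add: xs_def A_def)
  qed
  then have "rev (sorted_list_of_multiset (image_mset (pmf P) (mset_set (set_pmf P)))) = xs"
    unfolding M by (simp add: sorted_list_of_multiset_mset sorted_sort_id del: mset_rev)
  then have "decr_prob P i = (if i < card A then pmf P (g i) else 0)"
    by (simp add: decr_prob_def Let_def xs_def)
  moreover have "i < card A \<longleftrightarrow> i < card Y \<and> pmf P (g i) \<noteq> 0"
    using A by (auto simp: A_def)
  ultimately show ?thesis by auto
qed

lemma decr_prob_sorted:
  fixes P :: "'a pmf"
  assumes "finite Y" "set_pmf P \<subseteq> Y"
  obtains g where "bij_betw g {..<card Y} Y" "decr_prob P = (\<lambda>k. if k < card Y then pmf P (g k) else 0)"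
    "antimono (decr_prob P)"
proof -
  obtain g where g: "bij_betw g {..<card Y} Y" "\<And>i j. i \<le> j \<Longrightarrow> j < card Y \<Longrightarrow> pmf P (g j) \<le> pmf P (g i)"
    using sorted_enumeration[OF assms(1), of "pmf P"] by blast
  have "decr_prob P = (\<lambda>k. if k < card Y then pmf P (g k) else 0)"
    using decr_prob_enumeration[OF assms g] by auto
  then show ?thesis using that[OF g(1)] g(2) by (auto simp: antimono_def)
qed

lemma schmidt_pmf:
  assumes s: "schmidt C I (pmf P) u v" and P: "set_pmf P \<subseteq> I"
  shows "\<exists>g. bij_betw g {..<card I} I \<and>
    sorted_schmidt C (card I) (decr_prob P) (\<lambda>k. u (g k)) (\<lambda>k. v (g k)) \<and>
    decr_prob P = (\<lambda>k. if k < card I then pmf P (g k) else 0)"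
proof -
  obtain g where g: "bij_betw g {..<card I} I" "decr_prob P = (\<lambda>k. if k < card I then pmf P (g k) else 0)"
    "antimono (decr_prob P)" using decr_prob_sorted[OF schmidtD(1)[OF s] P] .
  have "schmidt C {..<card I} (decr_prob P) (\<lambda>k. u (g k)) (\<lambda>k. v (g k))"
    using schmidt_reindex[OF s g(1)] by (auto simp: schmidt_def g(2))
  moreover have "0 \<le> decr_prob P k" "card I \<le> k \<longrightarrow> decr_prob P k = 0" for k by (auto simp: g(2))
  ultimately show ?thesis using g unfolding sorted_schmidt_def by blast
qed

lemma finite_pmf_exists:
  fixes w :: "'a \<Rightarrow> real"
  assumes "finite Y" "\<And>y. y \<in> Y \<Longrightarrow> 0 \<le> w y" "(\<Sum>y\<in>Y. w y) = 1"
  obtains P where "set_pmf P \<subseteq> Y" "\<And>y. y \<in> Y \<Longrightarrow> pmf P y = w y"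
proof -
  define w' where "w' y = (if y \<in> Y then w y else 0)" for y
  have nn: "0 \<le> w' y" for y using assms by (simp add: w'_def)
  have "(\<integral>\<^sup>+ y. ennreal (w' y) \<partial>count_space UNIV) = (\<Sum>y\<in>Y. ennreal (w' y))"
    by (rule nn_integral_count_space'[OF assms(1)]) (auto simp: w'_def)
  also have "\<dots> = ennreal (\<Sum>y\<in>Y. w' y)" by (rule sum_ennreal) (rule nn)
  also have "\<dots> = 1" using assms(3) by (simp add: w'_def)
  finally have one: "(\<integral>\<^sup>+ y. ennreal (w' y) \<partial>count_space UNIV) = 1" .
  have "pmf (embed_pmf w') y = w' y" for y by (rule pmf_embed_pmf[OF nn one])
  moreover have "set_pmf (embed_pmf w') \<subseteq> Y"
    unfolding set_embed_pmf[OF nn one] by (auto simp: w'_def)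
  ultimately show ?thesis using that[of "embed_pmf w'"] by (simp add: w'_def)
qed

section \<open>Fidelity of the output of a protocol\<close>

lemma ip_amp: "C \<in> carrier_mat a b \<Longrightarrow> D \<in> carrier_mat a b \<Longrightarrow> ip (a * b) (amp C) (amp D) = mip C D"
  unfolding ip_def mip_def amp_def
  using sum_div_mod[of "\<lambda>i j. C $$ (i, j) * cnj (D $$ (i, j))" b a] by simp

text \<open>The target is pure, so only the quadratic form of the mixture at its amplitude vector
  matters, and each branch adds its squared overlap.\<close>

lemma fidelity_mixture:
  assumes F: "set Fs \<subseteq> carrier_mat a b" and \<phi>: "\<phi> \<in> carrier_mat a b" "frob_sq \<phi> = 1"
  shows "fidelity (mixture (a * b) Fs) (density \<phi>) = sqrt (\<Sum>F\<leftarrow>Fs. (cmod (mip F \<phi>))\<^sup>2)"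
proof -
  let ?N = "a * b"
  have app: "app (mixture ?N Fs) x i = (\<Sum>F\<leftarrow>Fs. ip ?N x (amp F) * amp F i)" if "i < ?N" for x i
  proof -
    have "app (mixture ?N Fs) x i = (\<Sum>j<?N. \<Sum>F\<leftarrow>Fs. amp F i * cnj (amp F j) * x j)"
      using that by (simp add: app_def mixture_def sum_list_mult_const[symmetric])
    also have "\<dots> = (\<Sum>F\<leftarrow>Fs. \<Sum>j<?N. amp F i * cnj (amp F j) * x j)" by (rule sum_sum_list_swap)
    also have "\<dots> = (\<Sum>F\<leftarrow>Fs. ip ?N x (amp F) * amp F i)"
      by (simp add: ip_def sum_distrib_left sum_distrib_right mult_ac)
    finally show ?thesis .
  qed
  have quad: "ip ?N (app (mixture ?N Fs) x) x = of_real (\<Sum>F\<leftarrow>Fs. (cmod (ip ?N (amp F) x))\<^sup>2)" for x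
  proof -
    have "ip ?N (app (mixture ?N Fs) x) x = (\<Sum>i<?N. \<Sum>F\<leftarrow>Fs. ip ?N x (amp F) * (amp F i * cnj (x i)))"
      unfolding ip_def[of _ "app _ _"] by (simp add: app sum_list_mult_const[symmetric] mult.assoc)
    also have "\<dots> = (\<Sum>F\<leftarrow>Fs. \<Sum>i<?N. ip ?N x (amp F) * (amp F i * cnj (x i)))" by (rule sum_sum_list_swap)
    also have "\<dots> = (\<Sum>F\<leftarrow>Fs. ip ?N x (amp F) * ip ?N (amp F) x)"
      by (simp add: ip_def[of _ "amp _" x] sum_distrib_left)
    also have "\<dots> = (\<Sum>F\<leftarrow>Fs. of_real ((cmod (ip ?N (amp F) x))\<^sup>2))"
      by (subst ip_commute) (simp add: complex_norm_square mult.commute del: of_real_power)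
    also have "\<dots> = of_real (\<Sum>F\<leftarrow>Fs. (cmod (ip ?N (amp F) x))\<^sup>2)" by (induction Fs) auto
    finally show ?thesis .
  qed
  have "psd (mixture ?N Fs)"
    unfolding psd_iff[OF mixture_carrier(1)] quad
    by (auto simp: less_eq_complex_def intro!: sum_list_nonneg)
  moreover have "density \<phi> = mat ?N ?N (\<lambda>(i, j). amp \<phi> i * cnj (amp \<phi> j))"
    unfolding density_mixture[OF \<phi>(1)] mixture_def by (intro cong_mat) auto
  moreover have "nsq ?N (amp \<phi>) = 1"
  proof -
    have "complex_of_real (nsq ?N (amp \<phi>)) = of_real (frob_sq \<phi>)"
      unfolding ip_self[symmetric] ip_amp[OF \<phi>(1) \<phi>(1)] using \<phi>(1)
      by (simp add: mip_def frob_sq_def nsq_def complex_norm_square del: of_real_power) (rule sum.swap)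
    then show ?thesis using \<phi>(2) by (simp only: of_real_eq_iff)
  qed
  ultimately have "fidelity (mixture ?N Fs) (density \<phi>) = sqrt (\<Sum>F\<leftarrow>Fs. (cmod (ip ?N (amp F) (amp \<phi>)))\<^sup>2)"
    using fidelity_pure[of "mixture ?N Fs" ?N "density \<phi>" "amp \<phi>"] quad by simp
  also have "map (\<lambda>F. (cmod (ip ?N (amp F) (amp \<phi>)))\<^sup>2) Fs = map (\<lambda>F. (cmod (mip F \<phi>))\<^sup>2) Fs"
    using F ip_amp \<phi>(1) by (intro map_cong) auto
  finally show ?thesis .
qed

lemma L2_set_sum_le: "L2_set (\<lambda>a. \<Sum>k\<in>K. f k a) A \<le> (\<Sum>k\<in>K. L2_set (f k) A)"
proof (induction K rule: infinite_finite_induct)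
  case (insert k K)
  have "L2_set (\<lambda>a. f k a + (\<Sum>k\<in>K. f k a)) A \<le> L2_set (f k) A + L2_set (\<lambda>a. \<Sum>k\<in>K. f k a) A"
    by (rule L2_set_triangle_ineq)
  then show ?case using insert by simp
qed (auto simp: L2_set_def)

text \<open>Concavity of the squared classical fidelity, in the form of Minkowski's inequality.\<close>

lemma minkowski_fidelity:
  assumes "\<And>F k. 0 \<le> s F k" "\<And>k. 0 \<le> t k"
  shows "sqrt (\<Sum>F\<leftarrow>Fs. (\<Sum>k<n. sqrt (s F k) * sqrt (t k))\<^sup>2) \<le> (\<Sum>k<n. sqrt (\<Sum>F\<leftarrow>Fs. s F k) * sqrt (t k))"
proof -
  have list: "(\<Sum>F\<leftarrow>Fs. h F) = (\<Sum>a<length Fs. h (Fs ! a))" for h :: "'a \<Rightarrow> real"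
    using sum_list_sum_nth[of "map h Fs"] by (simp add: atLeast0LessThan)
  have "sqrt (\<Sum>F\<leftarrow>Fs. (\<Sum>k<n. sqrt (s F k) * sqrt (t k))\<^sup>2) = L2_set (\<lambda>a. \<Sum>k<n. sqrt (s (Fs ! a) k) * sqrt (t k)) {..<length Fs}"
    by (simp add: list L2_set_def)
  also have "\<dots> \<le> (\<Sum>k<n. L2_set (\<lambda>a. sqrt (s (Fs ! a) k) * sqrt (t k)) {..<length Fs})"
    by (rule L2_set_sum_le)
  also have "\<dots> = (\<Sum>k<n. sqrt (\<Sum>F\<leftarrow>Fs. s F k) * sqrt (t k))"
    unfolding list L2_set_def
    by (intro sum.cong refl) (simp add: power_mult_distrib assms sum_distrib_right[symmetric] real_sqrt_mult)
  finally show ?thesis .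
qed

lemma sq_sing_facts:
  assumes "C \<in> carrier_mat a b"
  shows "antimono (sq_sing C)" "0 \<le> sq_sing C k" "a \<le> k \<Longrightarrow> sq_sing C k = 0" "sing_sum a C = frob_sq C"
proof -
  obtain r u v where s: "sorted_schmidt C r (sq_sing C) u v" by (rule sq_sing_schmidt)
  note s' = sorted_schmidtD[OF s]
  have r: "r \<le> a" using schmidt_card_le[OF s'(1)] assms by simp
  show "antimono (sq_sing C)" "0 \<le> sq_sing C k" "a \<le> k \<Longrightarrow> sq_sing C k = 0" using s' r by auto
  show "sing_sum a C = frob_sq C"
    unfolding sing_sum_def schmidt_frob_sq[OF s'(1)] using s'(4) r by (intro sum.mono_neutral_right) auto
qed

text \<open>Two decompositions of the same matrix are compared by the measurement bound, applied to
  the trivial measurement with one outcome.\<close>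

lemma sing_sum_ge_decr_prob:
  assumes "schmidt C I (pmf P) u v" "set_pmf P \<subseteq> I"
  shows "(\<Sum>k<l. decr_prob P k) \<le> sing_sum l C"
proof -
  obtain g where s: "sorted_schmidt C (card I) (decr_prob P) (\<lambda>k. u (g k)) (\<lambda>k. v (g k))"
    using schmidt_pmf[OF assms] by blast
  obtain r' u' v' where s': "sorted_schmidt C r' (sq_sing C) u' v'" by (rule sq_sing_schmidt)
  have "(\<Sum>k<l. decr_prob P k) = (\<Sum>k<min l (card I). decr_prob P k)"
    using sorted_schmidtD(4)[OF s] by (intro sum.mono_neutral_right) auto
  also have "\<dots> \<le> (\<Sum>i\<in>{()}. \<Sum>k<card {..<min l (card I)}. sq_sing C k)"
    by (rule sorted_schmidt_measurement[OF sorted_schmidtD(1)[OF s], where D = "\<lambda>_. C"]) (use s' in auto)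
  also have "\<dots> \<le> sing_sum l C"
    unfolding sing_sum_def using sorted_schmidtD(3)[OF s'] by (auto intro: sum_mono2)
  finally show ?thesis .
qed

lemma classical_fidelity_le_1:
  assumes "finite Y"
  shows "classical_fidelity Y P Q \<le> 1"
proof -
  have sum: "(\<Sum>y\<in>Y. pmf R y) \<le> 1" for R :: "'a pmf"
    using assms by (simp add: measure_measure_pmf_finite[symmetric])
  have "classical_fidelity Y P Q \<le> (\<Sum>y\<in>Y. (pmf P y + pmf Q y) / 2)"
    unfolding classical_fidelity_def by (rule sum_mono, rule arith_geo_mean_sqrt) auto
  also have "\<dots> = ((\<Sum>y\<in>Y. pmf P y) + (\<Sum>y\<in>Y. pmf Q y)) / 2"
    by (simp add: sum.distrib flip: sum_divide_distrib)
  finally show ?thesis using sum[of P] sum[of Q] by simp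
qed

section \<open>Equality of the quantum and the classical fidelity\<close>

lemma output_fidelity_le:
  assumes F: "set Fs \<subseteq> carrier_mat a b" and \<phi>: "\<phi> \<in> carrier_mat a b" "schmidt \<phi> J (pmf Q) x y" "set_pmf Q \<subseteq> J"
  shows "fidelity (mixture (a * b) Fs) (density \<phi>) \<le> (\<Sum>k<card J. sqrt (\<Sum>F\<leftarrow>Fs. sq_sing F k) * sqrt (decr_prob Q k))"
proof -
  obtain g where s: "sorted_schmidt \<phi> (card J) (decr_prob Q) (\<lambda>k. x (g k)) (\<lambda>k. y (g k))"
    using schmidt_pmf[OF \<phi>(2,3)] by blast
  have bound: "cmod (mip F \<phi>) \<le> (\<Sum>k<card J. sqrt (sq_sing F k) * sqrt (decr_prob Q k))" if "F \<in> set Fs" for F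
  proof -
    obtain r u v where sF: "sorted_schmidt F r (sq_sing F) u v" by (rule sq_sing_schmidt)
    show ?thesis using von_neumann_trace_inequality[OF sF s] F that \<phi>(1) by (auto simp: mult.commute)
  qed
  have frob_sq: "frob_sq \<phi> = 1" using schmidt_frob_sq[OF \<phi>(2)] sum_pmf_eq_1[OF schmidtD(1)[OF \<phi>(2)] \<phi>(3)] by simp
  have "(\<Sum>F\<leftarrow>Fs. (cmod (mip F \<phi>))\<^sup>2) \<le> (\<Sum>F\<leftarrow>Fs. (\<Sum>k<card J. sqrt (sq_sing F k) * sqrt (decr_prob Q k))\<^sup>2)"
    using bound by (intro sum_list_mono power_mono) auto
  then have "fidelity (mixture (a * b) Fs) (density \<phi>) \<le> sqrt (\<Sum>F\<leftarrow>Fs. (\<Sum>k<card J. sqrt (sq_sing F k) * sqrt (decr_prob Q k))\<^sup>2)"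
    unfolding fidelity_mixture[OF F \<phi>(1) frob_sq] by simp
  also have "\<dots> \<le> (\<Sum>k<card J. sqrt (\<Sum>F\<leftarrow>Fs. sq_sing F k) * sqrt (decr_prob Q k))"
    by (rule minkowski_fidelity) (use sq_sing_facts(2)[OF carrier_matI[OF refl refl]] sorted_schmidtD(3)[OF s] in auto)
  finally show ?thesis .
qed

text \<open>Monotonicity is the point: the summed sequence needs no sorting, so it can be read
  directly as a decreasing rearrangement.\<close>

lemma sum_sq_sing_facts:
  assumes F: "set Fs \<subseteq> carrier_mat a b" and frob_sq: "(\<Sum>F\<leftarrow>Fs. frob_sq F) = 1"
  defines "s \<equiv> \<lambda>k. \<Sum>F\<leftarrow>Fs. sq_sing F k"
  shows "antimono s" "0 \<le> s k" "(\<Sum>k<l. s k) = (\<Sum>F\<leftarrow>Fs. sing_sum l F)" "(\<Sum>k<a. s k) = 1"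
    "a \<le> k \<Longrightarrow> s k = 0" "(\<Sum>k<l. s k) \<le> 1"
proof -
  have f: "antimono (sq_sing D)" "0 \<le> sq_sing D k" "a \<le> k \<Longrightarrow> sq_sing D k = 0" "sing_sum a D = frob_sq D" if "D \<in> set Fs" for D k
    using sq_sing_facts[of D a b] F that by auto
  show "antimono s" unfolding antimono_def s_def using f(1) by (auto intro!: sum_list_mono simp: antimono_def)
  show nn: "0 \<le> s k" for k unfolding s_def using f(2) by (auto intro!: sum_list_nonneg)
  show sum: "(\<Sum>k<l. s k) = (\<Sum>F\<leftarrow>Fs. sing_sum l F)" for l
    unfolding s_def sing_sum_def by (rule sum_sum_list_swap)
  show one: "(\<Sum>k<a. s k) = 1"
    unfolding sum using f(4) frob_sq by (simp cong: map_cong)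
  show zero: "s k = 0" if "a \<le> k" for k
    unfolding s_def using f(3) that by (simp cong: map_cong)
  have "(\<Sum>k<l. s k) \<le> (\<Sum>k<max a l. s k)" by (rule sum_mono2) (auto simp: nn)
  also have "\<dots> = (\<Sum>k<a. s k)" by (rule sum.mono_neutral_right) (auto simp: zero)
  finally show "(\<Sum>k<l. s k) \<le> 1" using one by simp
qed

lemma classical_fidelity_sum:
  assumes "bij_betw g {..<card J} J"
  shows "classical_fidelity J P Q = (\<Sum>k<card J. sqrt (pmf P (g k)) * sqrt (pmf Q (g k)))"
  unfolding classical_fidelity_def real_sqrt_mult[symmetric]
  by (rule sum.reindex_bij_betw[OF assms, symmetric])

lemma locc_fidelity_le:
  assumes \<psi>: "\<psi> \<in> carrier_mat dA dB" "schmidt \<psi> I (pmf P) u v" "set_pmf P \<subseteq> I"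
    and \<phi>: "\<phi> \<in> carrier_mat eA eB" "schmidt \<phi> J (pmf Q) x y" "set_pmf Q \<subseteq> J"
    and locc: "locc dA dB K K \<Gamma>" "locc K K eA eB \<Gamma>'"
  shows "\<exists>P'' (P' :: nat pmf). set_pmf P'' \<subseteq> J \<and> set_pmf P' \<subseteq> {..<K} \<and> P \<prec>\<^sub>m P' \<and> P' \<prec>\<^sub>m P'' \<and>
    fidelity (\<Gamma>' (\<Gamma> (density \<psi>))) (density \<phi>) \<le> classical_fidelity J P'' Q"
proof -
  obtain f f' where f: "unravels dA dB K K \<Gamma> f" and f': "unravels K K eA eB \<Gamma>' f'"
    using locc_unravels locc by metis
  define Ds where "Ds = f \<psi>"
  define Fs where "Fs = concat (map f' Ds)"
  have frob_sq\<psi>: "frob_sq \<psi> = 1"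
    using schmidt_frob_sq[OF \<psi>(2)] sum_pmf_eq_1[OF schmidtD(1)[OF \<psi>(2)] \<psi>(3)] by simp
  have Ds: "set Ds \<subseteq> carrier_mat K K" "(\<Sum>D\<leftarrow>Ds. frob_sq D) = 1" "\<And>l. sing_sum l \<psi> \<le> (\<Sum>D\<leftarrow>Ds. sing_sum l D)"
    "\<Gamma> (density \<psi>) = mixture (K * K) Ds"
    using f \<psi>(1) frob_sq\<psi> unfolding unravels_def Ds_def density_mixture[OF \<psi>(1)] by auto
  have f'D: "set (f' D) \<subseteq> carrier_mat eA eB" "frob_sq D = (\<Sum>F\<leftarrow>f' D. frob_sq F)" "sing_sum l D \<le> (\<Sum>F\<leftarrow>f' D. sing_sum l F)"
    if "D \<in> set Ds" for D l
    using f' Ds(1) that unfolding unravels_def by auto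
  have Fs: "set Fs \<subseteq> carrier_mat eA eB" using f'D(1) by (auto simp: Fs_def)
  have Fs1: "(\<Sum>F\<leftarrow>Fs. frob_sq F) = 1"
    unfolding Fs_def sum_list_concat_map Ds(2)[symmetric] using f'D(2) by (intro arg_cong[of _ _ sum_list] map_cong) auto
  have DF: "(\<Sum>D\<leftarrow>Ds. sing_sum l D) \<le> (\<Sum>F\<leftarrow>Fs. sing_sum l F)" for l
    unfolding Fs_def sum_list_concat_map using f'D(3) by (intro sum_list_mono) auto
  have out: "\<Gamma>' (\<Gamma> (density \<psi>)) = mixture (eA * eB) Fs"
    unfolding Ds(4) Fs_def using f' Ds(1) by (simp add: unravels_def)
  define \<mu> where "\<mu> k = (\<Sum>D\<leftarrow>Ds. sq_sing D k)" for k
  define \<xi> where "\<xi> k = (\<Sum>F\<leftarrow>Fs. sq_sing F k)" for k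
  note \<mu> = sum_sq_sing_facts[OF Ds(1,2), folded \<mu>_def]
  note \<xi> = sum_sq_sing_facts[OF Fs Fs1, folded \<xi>_def]
  \<comment> \<open>Storage states are \<open>K\<close> by \<open>K\<close> matrices, so
    \<open>\<mu>\<close> has all its mass below \<open>K\<close>. This is where the storage size
    enters.\<close>
  obtain P' where P': "set_pmf P' \<subseteq> {..<K}" "\<And>k. k \<in> {..<K} \<Longrightarrow> pmf P' k = \<mu> k"
    using finite_pmf_exists[of "{..<K}" \<mu>] \<mu>(2,4) by auto
  have dP': "decr_prob P' k = \<mu> k" for k
    using decr_prob_enumeration[of "{..<K}" P' id k] P' \<mu>(1,5) by (auto simp: antimono_def)
  have "card J \<noteq> 0"
    using \<phi>(3) schmidtD(1)[OF \<phi>(2)] set_pmf_not_empty[of Q] by auto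
  then have n: "0 < card J" by simp
  have nle: "card J \<le> eA" using schmidt_card_le[OF \<phi>(2)] \<phi>(1) by simp
  obtain g where g: "bij_betw g {..<card J} J" "decr_prob Q = (\<lambda>k. if k < card J then pmf Q (g k) else 0)"
    using schmidt_pmf[OF \<phi>(2,3)] by blast
  \<comment> \<open>\<open>\<xi>\<close> may extend beyond \<open>card J\<close>; the mass found
    there is added at position 0, so that \<open>\<eta>\<close> is decreasing and sums to 1 over the
    first \<open>card J\<close> positions.\<close>
  define \<eta> where "\<eta> k = \<xi> k + (if k = 0 then 1 - (\<Sum>k<card J. \<xi> k) else 0)" for k
  have \<eta>\<xi>: "\<xi> k \<le> \<eta> k" for k using \<xi>(6)[of "card J"] by (simp add: \<eta>_def)
  then have \<eta>0: "0 \<le> \<eta> k" for k using \<xi>(2) order_trans by blast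
  have \<eta>sum: "(\<Sum>k<l. \<eta> k) = (\<Sum>k<l. \<xi> k) + 1 - (\<Sum>k<card J. \<xi> k)" if "0 < l" for l
    unfolding \<eta>_def sum.distrib using that by simp
  have \<eta>dec: "\<eta> j \<le> \<eta> i" if "i \<le> j" for i j
  proof (cases "j = 0")
    case False
    then have "\<eta> j = \<xi> j" by (simp add: \<eta>_def)
    also have "\<dots> \<le> \<xi> i" using \<xi>(1) that by (simp add: antimono_def)
    also have "\<dots> \<le> \<eta> i" by (rule \<eta>\<xi>)
    finally show ?thesis .
  qed (use that in simp)
  \<comment> \<open>\<open>g\<close> lists \<open>J\<close> by decreasing \<open>Q\<close>; placing
    \<open>\<eta>\<close> along it gives the aligned pairing that occurs in the trace
    inequality.\<close>
  define g' where "g' = the_inv_into {..<card J} g"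
  have g'g: "g' (g k) = k" if "k < card J" for k
    unfolding g'_def using g(1) that by (auto simp: bij_betw_def the_inv_into_f_f)
  have "(\<Sum>y\<in>J. \<eta> (g' y)) = (\<Sum>k<card J. \<eta> (g' (g k)))"
    by (rule sum.reindex_bij_betw[OF g(1), symmetric])
  also have "\<dots> = 1" using \<eta>sum[OF n] by (simp add: g'g)
  finally obtain P'' where P'': "set_pmf P'' \<subseteq> J" "\<And>y. y \<in> J \<Longrightarrow> pmf P'' y = \<eta> (g' y)"
    using finite_pmf_exists[OF schmidtD(1)[OF \<phi>(2)], of "\<lambda>y. \<eta> (g' y)"] \<eta>0 by auto
  have P''g: "pmf P'' (g k) = \<eta> k" if "k < card J" for k
    using P''(2)[of "g k"] bij_betwE[OF g(1)] g'g[OF that] that by simp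
  have dP'': "decr_prob P'' k = (if k < card J then \<eta> k else 0)" for k
    by (subst decr_prob_enumeration[OF schmidtD(1)[OF \<phi>(2)] P''(1) g(1)]) (auto simp: P''g \<eta>dec)
  have "P \<prec>\<^sub>m P'"
    unfolding majorized_def dP' \<mu>(3)
    using sing_sum_ge_decr_prob[OF \<psi>(2,3)] Ds(3) order_trans by blast
  moreover have "P' \<prec>\<^sub>m P''"
    unfolding majorized_def dP'
  proof
    fix l
    show "(\<Sum>k<l. \<mu> k) \<le> (\<Sum>k<l. decr_prob P'' k)"
    proof (cases "l \<le> card J")
      case True
      have "(\<Sum>k<l. \<mu> k) \<le> (\<Sum>k<l. \<xi> k)" unfolding \<mu>(3) \<xi>(3) by (rule DF)
      also have "\<dots> \<le> (\<Sum>k<l. \<eta> k)" by (intro sum_mono \<eta>\<xi>)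
      also have "\<dots> = (\<Sum>k<l. decr_prob P'' k)" using True by (simp add: dP'')
      finally show ?thesis .
    next
      case False
      \<comment> \<open>Beyond \<open>card J\<close> the right-hand side has reached 1, which no
        partial sum of \<open>\<mu>\<close> exceeds.\<close>
      have "(\<Sum>k<l. \<mu> k) \<le> (\<Sum>k<card J. \<eta> k)" using \<mu>(6) \<eta>sum[OF n] by simp
      also have "\<dots> = (\<Sum>k<l. decr_prob P'' k)"
        unfolding dP'' using False by (intro sum.mono_neutral_cong_left) auto
      finally show ?thesis .
    qed
  qed
  moreover have "fidelity (\<Gamma>' (\<Gamma> (density \<psi>))) (density \<phi>) \<le> classical_fidelity J P'' Q"
  proof -
    have "fidelity (\<Gamma>' (\<Gamma> (density \<psi>))) (density \<phi>) \<le> (\<Sum>k<card J. sqrt (\<xi> k) * sqrt (decr_prob Q k))"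
      unfolding out \<xi>_def by (rule output_fidelity_le[OF Fs \<phi>])
    also have "\<dots> \<le> (\<Sum>k<card J. sqrt (pmf P'' (g k)) * sqrt (pmf Q (g k)))"
      using \<eta>\<xi> by (intro sum_mono) (auto simp: g(2) P''g intro: mult_right_mono)
    finally show ?thesis unfolding classical_fidelity_sum[OF g(1)] .
  qed
  ultimately show ?thesis using P' P'' by blast
qed

lemma locc_fidelity_attained:
  assumes \<psi>: "\<psi> \<in> carrier_mat dA dB" "schmidt \<psi> I (pmf P) u v" "set_pmf P \<subseteq> I"
    and \<phi>: "\<phi> \<in> carrier_mat eA eB" "schmidt \<phi> J (pmf Q) x y" "set_pmf Q \<subseteq> J"
    and P: "set_pmf P'' \<subseteq> J" "set_pmf (P' :: nat pmf) \<subseteq> {..<K}" "P \<prec>\<^sub>m P'" "P' \<prec>\<^sub>m P''"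
  shows "\<exists>\<Gamma> \<Gamma>'. locc dA dB K K \<Gamma> \<and> locc K K eA eB \<Gamma>' \<and>
    fidelity (\<Gamma>' (\<Gamma> (density \<psi>))) (density \<phi>) = classical_fidelity J P'' Q"
proof -
  have frob1: "frob_sq C = 1" if "schmidt C L (pmf R) a b" "set_pmf R \<subseteq> L" for C a b and L :: "'z set" and R
    using schmidt_frob_sq[OF that(1)] sum_pmf_eq_1[OF schmidtD(1)[OF that(1)] that(2)] by simp
  \<comment> \<open>The diagonal storage state; the standard basis serves both parties as Schmidt
    basis.\<close>
  define C where "C = mat K K (\<lambda>(i, j). if i = j then complex_of_real (sqrt (pmf P' i)) else 0)"
  define e where "e k i = (if i = k then 1 else 0 :: complex)" for k i :: nat
  have C: "C \<in> carrier_mat K K" by (simp add: C_def)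
  have oe: "ortho K {..<K} e"
    unfolding ortho_def
  proof (intro ballI)
    fix k l assume "k \<in> {..<K}"
    then have "ip K (\<lambda>j. if j = k then 1 else 0) (e l) = cnj (e l k)"
      by (intro ip_unit) simp
    then show "ip K (e k) (e l) = (if k = l then 1 else 0)" by (simp add: ip_def e_def)
  qed
  have sC: "schmidt C {..<K} (pmf P') e e"
    unfolding schmidt_def
  proof (intro conjI ballI allI impI)
    fix i j assume "i < dim_row C" "j < dim_col C"
    then have ij: "i < K" "j < K" by (auto simp: C_def)
    have "(\<Sum>k<K. of_real (sqrt (pmf P' k)) * e k i * e k j) = (\<Sum>k<K. if k = i then of_real (sqrt (pmf P' k)) * e k j else 0)"
      by (intro sum.cong) (auto simp: e_def)
    then show "C $$ (i, j) = (\<Sum>k<K. of_real (sqrt (pmf P' k)) * e k i * e k j)"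
      using ij by (auto simp: C_def e_def)
  qed (use oe C in auto)
  \<comment> \<open>With the Schmidt vectors of \<open>\<phi>\<close> and no sorting, the overlap
    with \<open>\<phi>\<close> is exactly the classical fidelity, whatever the order of
    \<open>P''\<close>.\<close>
  define \<chi> where "\<chi> = mat eA eB (\<lambda>(i, j). \<Sum>k\<in>J. of_real (sqrt (pmf P'' k)) * x k i * y k j)"
  have \<chi>: "\<chi> \<in> carrier_mat eA eB" by (simp add: \<chi>_def)
  have s\<chi>: "schmidt \<chi> J (pmf P'') x y"
    using \<phi>(1,2) by (auto simp: schmidt_def \<chi>_def)
  obtain g1 where S1: "sorted_schmidt \<psi> (card I) (decr_prob P) (\<lambda>k. u (g1 k)) (\<lambda>k. v (g1 k))"
    using schmidt_pmf[OF \<psi>(2,3)] by blast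
  obtain g2 where S2: "sorted_schmidt C (card {..<K}) (decr_prob P') (\<lambda>k. e (g2 k)) (\<lambda>k. e (g2 k))"
    using schmidt_pmf[OF sC P(2)] by blast
  obtain g3 where S3: "sorted_schmidt \<chi> (card J) (decr_prob P'') (\<lambda>k. x (g3 k)) (\<lambda>k. y (g3 k))"
    using schmidt_pmf[OF s\<chi> P(1)] by blast
  have fr: "frob_sq \<psi> = 1" "frob_sq C = 1" "frob_sq \<chi> = 1"
    using frob1[OF \<psi>(2,3)] frob1[OF sC P(2)] frob1[OF s\<chi> P(1)] by auto
  obtain \<Gamma> where \<Gamma>: "locc dA dB K K \<Gamma>" "\<Gamma> (density \<psi>) = density C"
    using nielsen[OF \<psi>(1) S1 C S2] P(3) fr by (auto simp: majorized_def)
  obtain \<Gamma>' where \<Gamma>': "locc K K eA eB \<Gamma>'" "\<Gamma>' (density C) = density \<chi>"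
    using nielsen[OF C S2 \<chi> S3] P(4) fr by (auto simp: majorized_def)
  have "mip \<chi> \<phi> = (\<Sum>k\<in>J. \<Sum>l\<in>J. if l = k then of_real (sqrt (pmf P'' k) * sqrt (pmf Q l)) else 0)"
    unfolding mip_schmidt[OF s\<chi> \<phi>(2) carrier_matD[OF \<phi>(1), THEN trans[OF _ sym]], OF carrier_matD[OF \<chi>]]
    using orthoD[OF schmidtD(3)[OF s\<chi>]] orthoD[OF schmidtD(4)[OF s\<chi>]]
    by (intro sum.cong refl) auto
  also have "\<dots> = of_real (classical_fidelity J P'' Q)"
    using schmidtD(1)[OF s\<chi>] by (simp add: classical_fidelity_def real_sqrt_mult)
  finally have "cmod (mip \<chi> \<phi>) = classical_fidelity J P'' Q"
    by (simp add: classical_fidelity_def sum_nonneg del: of_real_sum)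
  then have "fidelity (density \<chi>) (density \<phi>) = classical_fidelity J P'' Q"
    unfolding density_mixture[OF \<chi>]
    using fidelity_mixture[of "[\<chi>]" eA eB \<phi>] \<chi> \<phi>(1) frob1[OF \<phi>(2,3)]
    by (simp add: classical_fidelity_def sum_nonneg)
  then show ?thesis using \<Gamma> \<Gamma>' by (intro exI[of _ \<Gamma>] exI[of _ \<Gamma>'] conjI) simp_all
qed

text \<open>A bound is known directly only for the classical set \<open>B\<close>; it passes to
  \<open>A\<close> by domination. If both sets are empty, as for a storage of dimension 0, the
  suprema are the same default value.\<close>

lemma cSup_eq_cofinal:
  fixes A B :: "real set"
  assumes "B \<subseteq> A" "\<And>a. a \<in> A \<Longrightarrow> \<exists>b\<in>B. a \<le> b" "bdd_above B"
  shows "Sup A = Sup B"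
proof (cases "A = {}")
  case True
  then show ?thesis using assms(1) by simp
next
  case False
  then have "B \<noteq> {}" using assms(2) by blast
  have "Sup A \<le> Sup B" using False assms(3,2) by (rule cSup_mono)
  moreover have "bdd_above A" using assms(2,3) unfolding bdd_above_def by (meson order_trans)
  then have "Sup B \<le> Sup A" using \<open>B \<noteq> {}\<close> assms(1) by (intro cSup_subset_mono)
  ultimately show ?thesis by simp
qed

theorem FQ_eq_FM:
  assumes \<psi>: "schmidt \<psi> I (pmf P) u v" "set_pmf P \<subseteq> I"
    and \<phi>: "schmidt \<phi> J (pmf Q) x y" "set_pmf Q \<subseteq> J"
  shows "FQ \<psi> \<phi> N = FM P J Q N"
  unfolding FQ_def FM_def
proof (rule cSup_eq_cofinal)
  have c: "\<psi> \<in> carrier_mat (dim_row \<psi>) (dim_col \<psi>)" "\<phi> \<in> carrier_mat (dim_row \<phi>) (dim_col \<phi>)" by auto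
  show "{classical_fidelity J P'' Q | P''. set_pmf P'' \<subseteq> J \<and>
      (\<exists>P' :: nat pmf. set_pmf P' \<subseteq> {..<storage_dim N} \<and> P \<prec>\<^sub>m P' \<and> P' \<prec>\<^sub>m P'')} \<subseteq>
    {fidelity (\<Gamma>' (\<Gamma> (density \<psi>))) (density \<phi>) | \<Gamma> \<Gamma>'.
      locc (dim_row \<psi>) (dim_col \<psi>) (storage_dim N) (storage_dim N) \<Gamma> \<and>
      locc (storage_dim N) (storage_dim N) (dim_row \<phi>) (dim_col \<phi>) \<Gamma>'}"
  proof safe
    fix P'' and P' :: "nat pmf"
    assume "set_pmf P'' \<subseteq> J" "set_pmf P' \<subseteq> {..<storage_dim N}" "P \<prec>\<^sub>m P'" "P' \<prec>\<^sub>m P''"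
    from locc_fidelity_attained[OF c(1) \<psi> c(2) \<phi> this]
    show "\<exists>\<Gamma> \<Gamma>'. classical_fidelity J P'' Q = fidelity (\<Gamma>' (\<Gamma> (density \<psi>))) (density \<phi>) \<and>
      locc (dim_row \<psi>) (dim_col \<psi>) (storage_dim N) (storage_dim N) \<Gamma> \<and>
      locc (storage_dim N) (storage_dim N) (dim_row \<phi>) (dim_col \<phi>) \<Gamma>'" by metis
  qed
  fix a assume "a \<in> {fidelity (\<Gamma>' (\<Gamma> (density \<psi>))) (density \<phi>) | \<Gamma> \<Gamma>'.
      locc (dim_row \<psi>) (dim_col \<psi>) (storage_dim N) (storage_dim N) \<Gamma> \<and>
      locc (storage_dim N) (storage_dim N) (dim_row \<phi>) (dim_col \<phi>) \<Gamma>'}"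
  then obtain \<Gamma> \<Gamma>' where "a = fidelity (\<Gamma>' (\<Gamma> (density \<psi>))) (density \<phi>)"
    "locc (dim_row \<psi>) (dim_col \<psi>) (storage_dim N) (storage_dim N) \<Gamma>"
    "locc (storage_dim N) (storage_dim N) (dim_row \<phi>) (dim_col \<phi>) \<Gamma>'" by blast
  with locc_fidelity_le[OF c(1) \<psi> c(2) \<phi> this(2,3)]
  show "\<exists>b\<in>{classical_fidelity J P'' Q | P''. set_pmf P'' \<subseteq> J \<and>
      (\<exists>P' :: nat pmf. set_pmf P' \<subseteq> {..<storage_dim N} \<and> P \<prec>\<^sub>m P' \<and> P' \<prec>\<^sub>m P'')}. a \<le> b" by blast
next
  show "bdd_above {classical_fidelity J P'' Q | P''. set_pmf P'' \<subseteq> J \<and>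
      (\<exists>P' :: nat pmf. set_pmf P' \<subseteq> {..<storage_dim N} \<and> P \<prec>\<^sub>m P' \<and> P' \<prec>\<^sub>m P'')}"
    using classical_fidelity_le_1[OF schmidtD(1)[OF \<phi>(1)]] by (intro bdd_aboveI[of _ 1]) auto
qed

section \<open>Tensor powers\<close>

lemma ip_kron: "ip (m * n) (\<lambda>i. u (i div n) * x (i mod n)) (\<lambda>i. u' (i div n) * x' (i mod n)) = ip m u u' * ip n x x'"
  unfolding ip_def sum_product
  using sum_div_mod[of "\<lambda>i j. u i * x j * cnj (u' i * x' j)" n m] by (simp add: mult_ac)

lemma schmidt_kron:
  assumes A: "schmidt A I p u v" and B: "schmidt B J q x y"
  shows "schmidt (kron A B) (I \<times> J) (\<lambda>kl. p (fst kl) * q (snd kl))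
    (\<lambda>kl i. u (fst kl) (i div dim_row B) * x (snd kl) (i mod dim_row B))
    (\<lambda>kl j. v (fst kl) (j div dim_col B) * y (snd kl) (j mod dim_col B))"
proof -
  have d: "dim_row (kron A B) = dim_row A * dim_row B" "dim_col (kron A B) = dim_col A * dim_col B"
    by (auto simp: kron_def)
  note a = schmidtD[OF A] and b = schmidtD[OF B]
  show ?thesis unfolding schmidt_def d
  proof (intro conjI ballI allI impI)
    fix i j assume ij: "i < dim_row A * dim_row B" "j < dim_col A * dim_col B"
    have "kron A B $$ (i, j) = A $$ (i div dim_row B, j div dim_col B) * B $$ (i mod dim_row B, j mod dim_col B)"
      using ij by (simp add: kron_def)
    also have "\<dots> = (\<Sum>kl\<in>I \<times> J. of_real (sqrt (p (fst kl) * q (snd kl))) * (u (fst kl) (i div dim_row B) * x (snd kl) (i mod dim_row B)) *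
        (v (fst kl) (j div dim_col B) * y (snd kl) (j mod dim_col B)))"
      unfolding a(5)[OF div_mod_less(1)[OF ij(1)] div_mod_less(1)[OF ij(2)]]
        b(5)[OF div_mod_less(2)[OF ij(1)] div_mod_less(2)[OF ij(2)]] sum_product sum.cartesian_product
      by (intro sum.cong refl) (auto simp: real_sqrt_mult mult_ac)
    finally show "kron A B $$ (i, j) = (\<Sum>kl\<in>I \<times> J. of_real (sqrt (p (fst kl) * q (snd kl))) * (u (fst kl) (i div dim_row B) * x (snd kl) (i mod dim_row B)) *
        (v (fst kl) (j div dim_col B) * y (snd kl) (j mod dim_col B)))" .
  qed (use a b in \<open>auto simp: ortho_def ip_kron\<close>)
qed

lemma pmf_replicate_Suc: "pmf (replicate_pmf (Suc n) P) (y # ys) = pmf P y * pmf (replicate_pmf n P) ys"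
proof -
  have "replicate_pmf (Suc n) P = map_pmf (\<lambda>yy. fst yy # snd yy) (pair_pmf P (replicate_pmf n P))"
    by (simp add: pair_pmf_def map_bind_pmf)
  also have "pmf \<dots> (y # ys) = pmf (pair_pmf P (replicate_pmf n P)) (y, ys)"
    using pmf_map_inj'[of "\<lambda>yy. fst yy # snd yy" "pair_pmf P (replicate_pmf n P)" "(y, ys)"]
    by (simp add: inj_on_def prod_eq_iff)
  finally show ?thesis by (simp add: pmf_pair)
qed

text \<open>Products of Schmidt vectors are Schmidt vectors of the product. Indexing by lists makes
  the coefficients literally \<open>pmf (replicate_pmf n P)\<close>, on the set of lists that
  \<open>R2M\<close> uses.\<close>

lemma schmidt_kron_pow:
  assumes "schmidt C I (pmf P) u v"
  shows "\<exists>u v. schmidt (kron_pow C n) {ys. set ys \<subseteq> I \<and> length ys = n} (pmf (replicate_pmf n P)) u v"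
proof (induction n)
  case 0
  have "{ys. set ys \<subseteq> I \<and> length ys = 0} = {[]}" by auto
  then have "schmidt (kron_pow C 0) {ys. set ys \<subseteq> I \<and> length ys = 0} (pmf (replicate_pmf 0 P)) (\<lambda>_ _. 1) (\<lambda>_ _. 1)"
    by (simp add: schmidt_def ortho_def ip_def)
  then show ?case by blast
next
  case (Suc n)
  let ?J = "\<lambda>n. {ys. set ys \<subseteq> I \<and> length ys = n}"
  obtain x y where "schmidt (kron_pow C n) (?J n) (pmf (replicate_pmf n P)) x y" using Suc by blast
  note k = schmidt_kron[OF assms this]
  have bij: "bij_betw (\<lambda>ys. (hd ys, tl ys)) (?J (Suc n)) (I \<times> ?J n)"
    by (rule bij_betw_byWitness[where f' = "\<lambda>yy. fst yy # snd yy"]) (auto simp: length_Suc_conv)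
  note schmidt_reindex[OF k bij]
  moreover have "pmf P (hd ys) * pmf (replicate_pmf n P) (tl ys) = pmf (replicate_pmf (Suc n) P) ys" if "ys \<in> ?J (Suc n)" for ys
    using that by (cases ys) (auto simp: pmf_replicate_Suc simp del: replicate_pmf.simps)
  ultimately show ?case
    unfolding schmidt_def by (auto simp del: replicate_pmf.simps)
qed

section \<open>From the given definitions to Schmidt decompositions\<close>

lemma schmidt_distribution_schmidt:
  assumes "schmidt_distribution C r P"
  obtains u v where "schmidt C {..<r} (pmf P) u v" "set_pmf P \<subseteq> {..<r}"
proof -
  obtain u v where uv: "orthonormal_family (dim_row C) r u" "orthonormal_family (dim_col C) r v"
    "\<And>i j. i < dim_row C \<Longrightarrow> j < dim_col C \<Longrightarrow>
      C $$ (i, j) = (\<Sum>k<r. complex_of_real (sqrt (pmf P k)) * u k $ i * v k $ j)"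
    and P: "set_pmf P \<subseteq> {..<r}"
    using assms unfolding schmidt_distribution_def by blast
  have o: "ortho d {..<r} (\<lambda>k i. w k $ i)" if w: "orthonormal_family d r w" for d w
    unfolding ortho_def
  proof (intro ballI)
    fix k l assume "k \<in> {..<r}" "l \<in> {..<r}"
    then have "w k \<in> carrier_vec d" "w l \<in> carrier_vec d" "w k \<bullet>c w l = (if k = l then 1 else 0)"
      using w by (auto simp: orthonormal_family_def)
    then show "ip d (\<lambda>i. w k $ i) (\<lambda>i. w l $ i) = (if k = l then 1 else 0)"
      by (simp add: ip_def scalar_prod_def lessThan_atLeast0)
  qed
  have "schmidt C {..<r} (pmf P) (\<lambda>k i. u k $ i) (\<lambda>k i. v k $ i)"
    using uv o by (auto simp: schmidt_def)
  then show ?thesis using that P by blast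
qed

text \<open>Orthonormality of the \<open>v k\<close> removes Bob's system and leaves the eigenvalues
  \<open>pmf P k\<close> with eigenvectors \<open>u k\<close>.\<close>

lemma entanglement_entropy_schmidt:
  assumes s: "schmidt C I (pmf P) u v" and P: "set_pmf P \<subseteq> I"
  shows "entanglement_entropy C = shannon_entropy P"
proof -
  let ?m = "dim_row C" and ?n = "dim_col C"
  define \<rho> where "\<rho> = partial_trace_B ?m ?n (density C)"
  have "von_neumann_entropy \<rho> = - (\<Sum>k\<in>I. pmf P k * log 2 (pmf P k))"
  proof (rule von_neumann_entropy_eigensum)
    show "\<rho> \<in> carrier_mat ?m ?m" by (simp add: \<rho>_def partial_trace_B_def)
    fix i k assume ik: "i < ?m" "k < ?m"
    have less: "a * ?n + j < ?m * ?n" if "a < ?m" "j < ?n" for a j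
    proof -
      have "a * ?n + j < Suc a * ?n" using that by simp
      also have "\<dots> \<le> ?m * ?n" using that by (intro mult_right_mono) auto
      finally show ?thesis .
    qed
    have "\<rho> $$ (i, k) = ip ?n (\<lambda>j. C $$ (i, j)) (\<lambda>j. C $$ (k, j))"
      using ik less by (auto simp: \<rho>_def partial_trace_B_def density_def Let_def state_vec_def ip_def)
    also have "\<dots> = ip ?n (\<lambda>j. \<Sum>l\<in>I. (of_real (sqrt (pmf P l)) * u l i) * v l j) (\<lambda>j. \<Sum>l\<in>I. (of_real (sqrt (pmf P l)) * u l k) * v l j)"
      using schmidtD(5)[OF s] ik by (intro ip_cong) auto
    also have "\<dots> = (\<Sum>l\<in>I. cnj (of_real (sqrt (pmf P l)) * u l k) * (of_real (sqrt (pmf P l)) * u l i))"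
      unfolding ip_sum_right
      by (intro sum.cong refl) (simp add: ip_ortho_sum[OF schmidtD(4,1)[OF s]])
    also have "\<dots> = (\<Sum>l\<in>I. of_real (pmf P l) * u l i * cnj (u l k))"
    proof (intro sum.cong refl)
      fix l
      have "complex_of_real (sqrt (pmf P l)) * of_real (sqrt (pmf P l)) = of_real (pmf P l)"
        by (simp flip: of_real_mult)
      then show "cnj (of_real (sqrt (pmf P l)) * u l k) * (of_real (sqrt (pmf P l)) * u l i) = of_real (pmf P l) * u l i * cnj (u l k)"
        by (simp add: mult_ac)
    qed
    finally show "\<rho> $$ (i, k) = (\<Sum>l\<in>I. of_real (pmf P l) * u l i * cnj (u l k))" .
  qed (use schmidtD[OF s] in auto)
  also have "(\<Sum>k\<in>I. pmf P k * log 2 (pmf P k)) = (\<Sum>k\<in>set_pmf P. pmf P k * log 2 (pmf P k))"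
    using schmidtD(1)[OF s] P by (intro sum.mono_neutral_right) (auto simp: set_pmf_iff)
  finally show ?thesis by (simp add: entanglement_entropy_def shannon_entropy_def \<rho>_def)
qed

theorem proposition34:
  fixes \<psi> \<phi> :: "complex mat" and P Q :: "nat pmf" and rP rQ :: nat and s1 \<nu> :: real
  assumes "pure_state \<psi>" and "entangled \<psi>"
    and "pure_state \<phi>" and "entangled \<phi>"
    and "schmidt_distribution \<psi> rP P" and "schmidt_distribution \<phi> rQ Q"
    and "0 < s1" and "s1 \<le> entanglement_entropy \<psi>"
    and "0 < \<nu>" and "\<nu> < 1"
  shows "R2Q \<psi> \<phi> s1 (s1 / entanglement_entropy \<phi>) \<nu> =
         R2M P {..<rQ} Q s1 (s1 / shannon_entropy Q) \<nu>"
proof -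
  obtain u v where \<psi>: "schmidt \<psi> {..<rP} (pmf P) u v" "set_pmf P \<subseteq> {..<rP}"
    using schmidt_distribution_schmidt[OF assms(5)] .
  obtain x y where \<phi>: "schmidt \<phi> {..<rQ} (pmf Q) x y" "set_pmf Q \<subseteq> {..<rQ}"
    using schmidt_distribution_schmidt[OF assms(6)] .
  have supp: "set_pmf (replicate_pmf n R) \<subseteq> {ys. set ys \<subseteq> {..<r} \<and> length ys = n}"
    if "set_pmf R \<subseteq> {..<r}" for n r and R :: "nat pmf"
    using that by (auto simp: set_replicate_pmf)
  \<comment> \<open>Equality for each \<open>n\<close>, \<open>t\<close> and \<open>N\<close>
    separately: the same sequences \<open>S\<close> and \<open>T\<close> then witness membership in
    both regions.\<close>
  have "FQ (kron_pow \<psi> n) (kron_pow \<phi> t) N =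
      FM (replicate_pmf n P) {ys. set ys \<subseteq> {..<rQ} \<and> length ys = t} (replicate_pmf t Q) N" for n t N
  proof -
    obtain u' v' where \<psi>n: "schmidt (kron_pow \<psi> n) {ys. set ys \<subseteq> {..<rP} \<and> length ys = n} (pmf (replicate_pmf n P)) u' v'"
      using schmidt_kron_pow[OF \<psi>(1)] by blast
    obtain x' y' where \<phi>t: "schmidt (kron_pow \<phi> t) {ys. set ys \<subseteq> {..<rQ} \<and> length ys = t} (pmf (replicate_pmf t Q)) x' y'"
      using schmidt_kron_pow[OF \<phi>(1)] by blast
    show ?thesis by (rule FQ_eq_FM[OF \<psi>n supp[OF \<psi>(2)] \<phi>t supp[OF \<phi>(2)]])
  qed
  then show ?thesis
    unfolding R2Q_def R2M_def entanglement_entropy_schmidt[OF \<phi>] by simp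
qed

end
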